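(* Let $\varphi$ be a unit in $N^+$ and let $T_\varphi$ be the Toeplitz operator with symbol $\varphi$ on $H^p$ for some $p>1$; let $\frac1p+\frac1q=1$. If $T_\varphi\mathcal{N}=\varphi\mathcal{N}$ is dense in $H^p$, then $$\mathcal{N}^\perp\cap\mathrm{dom}_q(T_{1/\varphi}^* )=\{0\}.$$ In the case $p=2$ this gives $\mathcal{N}^\perp\cap\mathcal{H}(b)=\{0\}$, where $(b,a)$ is the Pythagorean pair associated with $1/\varphi\in N^+$.
   Context: $H^p$ are the Hardy spaces of the unit disk $\mathbb{D}$, $\mathbb{T}$ is the unit circle, $m$ its normalized Lebesgue measure. Here $1<p<\infty$. The Smirnov class $N^+$ consists of all holomorphic functions $g/h$ on $\mathbb{D}$ with $g,h\in H^\infty$ and $h$ outer; $\varphi\in N^+$ is a unit if $1/\varphi\in N^+$. For $\psi\in N^+$ and $1<p<\infty$, $T_\psi f=\psi f$ with domain $\mathrm{dom}_p(T_\psi)=\{f\in H^p:\psi f\in H^p\}$; it is densely defined on $H^p$. With $\frac1p+\frac1q=1$ and the duality $\langle f,h\rangle=\int_{\mathbb{T}}f\overline h\,dm$ between $H^p$ and $H^q$, the domain of the adjoint is $$\mathrm{dom}_q(T_\psi^* )=\{g\in H^q:\exists\,h\in H^q \text{ such that } \langle f,h\rangle=\langle\psi f,g\rangle\ \ \forall f\in\mathrm{dom}_p(T_\psi)\}.$$ For $\psi\in N^+$, the Pythagorean pair associated with $\psi$ is the pair $(b,a)$ in the closed unit ball of $H^\infty$ with $\psi=b/a$, $a$ outer,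 $a(0)>0$ and $|a|^2+|b|^2=1$ a.e. on $\mathbb{T}$. The de Branges-Rovnyak space $\mathcal{H}(b)$ is the image of $H^2$ under $(I-T_bT_{\overline b})^{1/2}$, where $T_b$ is multiplication by $b$ on $H^2$ and $T_{\overline b}$ is its Hilbert space adjoint. For $k\ge2$, $$h_k(z)=\frac{1}{1-z}\log\left(\frac{1+z+\dots+z^{k-1}}{k}\right),\quad z\in\mathbb{D},$$ with the holomorphic branch of the logarithm on $\mathbb{D}$ equal to $-\log k\in\mathbb{R}$ at $z=0$; each $h_k$ is known to belong to $H^2$. $\mathcal{N}$ is the linear span of $\{h_k:k\ge2\}$, and $\mathcal{N}^\perp$ is its orthogonal complement in $H^2$. The phrase "$\varphi\mathcal{N}$ is dense in $H^p$" means that $\varphi\mathcal{N}=\{\varphi f:f\in\mathcal{N}\}$ is a dense subset of $H^p$. *)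

theory Defs
  imports "HOL-Analysis.Analysis"
begin

text \<open>
  A function on the open unit disk is represented by its extension by zero to \<^typ>\<open>complex\<close>.
  Every function on the disk then has exactly one representative, so that equality of
  functions and of sets of functions is plain HOL equality. Boundary values on the unit circle
  are always taken as radial limits, never by evaluating the representative there.
\<close>

definition disk_holo :: "(complex \<Rightarrow> complex) set" where
  "disk_holo = {f. f holomorphic_on ball 0 1 \<and> (\<forall>z. z \<notin> ball 0 1 \<longrightarrow> f z = 0)}"

definition circle_measure :: "complex measure" where
  "circle_measure = distr (uniform_measure lborel {0..2 * pi}) borel cis"

definition bdry :: "(complex \<Rightarrow> complex) \<Rightarrow> complex \<Rightarrow> complex" where
  "bdry f \<zeta> = Lim (at_left 1) (\<lambda>r::real. f (of_real r * \<zeta>))"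

definition integral_mean :: "real \<Rightarrow> (complex \<Rightarrow> complex) \<Rightarrow> real \<Rightarrow> real" where
  "integral_mean p f r = (LINT \<zeta>|circle_measure. norm (f (of_real r * \<zeta>)) powr p)"

definition hardy :: "real \<Rightarrow> (complex \<Rightarrow> complex) set" where
  "hardy p = {f \<in> disk_holo. bdd_above (integral_mean p f ` {0..<1})}"

definition hardy_norm :: "real \<Rightarrow> (complex \<Rightarrow> complex) \<Rightarrow> real" where
  "hardy_norm p f = (SUP r\<in>{0..<1}. integral_mean p f r) powr (1 / p)"

definition hardy_inf :: "(complex \<Rightarrow> complex) set" where
  "hardy_inf = {f \<in> disk_holo. bounded (f ` ball 0 1)}"

definition pairing :: "(complex \<Rightarrow> complex) \<Rightarrow> (complex \<Rightarrow> complex) \<Rightarrow> complex" where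
  "pairing f g = (LINT \<zeta>|circle_measure. bdry f \<zeta> * cnj (bdry g \<zeta>))"

definition dense_in_hardy :: "real \<Rightarrow> (complex \<Rightarrow> complex) set \<Rightarrow> bool" where
  "dense_in_hardy p A \<longleftrightarrow> A \<subseteq> hardy p \<and>
     (\<forall>f\<in>hardy p. \<forall>e>0. \<exists>g\<in>A. hardy_norm p (\<lambda>z. f z - g z) < e)"

definition outer :: "(complex \<Rightarrow> complex) \<Rightarrow> bool" where
  "outer f \<longleftrightarrow> (\<exists>(c::complex) (w::complex \<Rightarrow> real).
     norm c = 1 \<and> w \<in> borel_measurable borel \<and> (\<forall>\<zeta>\<in>sphere 0 1. w \<zeta> > 0) \<and>
     integrable circle_measure (\<lambda>\<zeta>. ln (w \<zeta>)) \<and>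
     (\<forall>z\<in>ball 0 1. f z =
        c * exp (LINT \<zeta>|circle_measure. (\<zeta> + z) / (\<zeta> - z) * of_real (ln (w \<zeta>)))))"

definition smirnov :: "(complex \<Rightarrow> complex) set" where
  "smirnov = {f \<in> disk_holo. \<exists>g\<in>hardy_inf. \<exists>h\<in>hardy_inf. outer h \<and>
     (\<forall>z\<in>ball 0 1. f z = g z / h z)}"

text \<open>
  The non-vanishing condition is not redundant: since \<open>1 / 0 = 0\<close> in HOL, the zero function
  would otherwise qualify. Off the disk, \<open>1 / f z = 0\<close>, as the representation requires.
\<close>

definition smirnov_unit :: "(complex \<Rightarrow> complex) \<Rightarrow> bool" where
  "smirnov_unit f \<longleftrightarrow>
     f \<in> smirnov \<and> (\<forall>z\<in>ball 0 1. f z \<noteq> 0) \<and> (\<lambda>z. 1 / f z) \<in> smirnov"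

definition toeplitz :: "(complex \<Rightarrow> complex) \<Rightarrow> (complex \<Rightarrow> complex) \<Rightarrow> (complex \<Rightarrow> complex)" where
  "toeplitz \<psi> f = (\<lambda>z. \<psi> z * f z)"

definition toeplitz_dom :: "real \<Rightarrow> (complex \<Rightarrow> complex) \<Rightarrow> (complex \<Rightarrow> complex) set" where
  "toeplitz_dom p \<psi> = {f \<in> hardy p. toeplitz \<psi> f \<in> hardy p}"

text \<open>The exponents \<open>p\<close> and \<open>q\<close> are meant to be conjugate.\<close>

definition toeplitz_adj_dom ::
    "real \<Rightarrow> real \<Rightarrow> (complex \<Rightarrow> complex) \<Rightarrow> (complex \<Rightarrow> complex) set" where
  "toeplitz_adj_dom p q \<psi> = {g \<in> hardy q. \<exists>h\<in>hardy q. \<forall>f\<in>toeplitz_dom p \<psi>.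
     pairing f h = pairing (toeplitz \<psi> f) g}"

definition pythagorean_pair ::
    "(complex \<Rightarrow> complex) \<Rightarrow> (complex \<Rightarrow> complex) \<Rightarrow> (complex \<Rightarrow> complex) \<Rightarrow> bool" where
  "pythagorean_pair \<psi> b a \<longleftrightarrow>
     b \<in> hardy_inf \<and> (\<forall>z\<in>ball 0 1. norm (b z) \<le> 1) \<and>
     a \<in> hardy_inf \<and> (\<forall>z\<in>ball 0 1. norm (a z) \<le> 1) \<and>
     (\<forall>z\<in>ball 0 1. \<psi> z = b z / a z) \<and>
     outer a \<and> a 0 \<in> \<real> \<and> Re (a 0) > 0 \<and>
     (AE \<zeta> in circle_measure. (norm (bdry a \<zeta>))\<^sup>2 + (norm (bdry b \<zeta>))\<^sup>2 = 1)"

definition hilbert_adjoint ::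
    "((complex \<Rightarrow> complex) \<Rightarrow> (complex \<Rightarrow> complex)) \<Rightarrow> (complex \<Rightarrow> complex) \<Rightarrow> (complex \<Rightarrow> complex)"
  where
  "hilbert_adjoint T g =
     (THE h. h \<in> hardy 2 \<and> (\<forall>f\<in>hardy 2. pairing (T f) g = pairing f h))"

text \<open>\<open>S\<close> is a bounded positive operator on the Hardy space \<open>hardy 2\<close> with square \<open>T\<close>.\<close>

definition is_positive_sqrt ::
    "((complex \<Rightarrow> complex) \<Rightarrow> (complex \<Rightarrow> complex)) \<Rightarrow>
     ((complex \<Rightarrow> complex) \<Rightarrow> (complex \<Rightarrow> complex)) \<Rightarrow> bool" where
  "is_positive_sqrt T S \<longleftrightarrow>
     S ` hardy 2 \<subseteq> hardy 2 \<and>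
     (\<forall>f\<in>hardy 2. \<forall>g\<in>hardy 2. \<forall>c d.
        S (\<lambda>z. c * f z + d * g z) = (\<lambda>z. c * S f z + d * S g z)) \<and>
     (\<exists>C. \<forall>f\<in>hardy 2. hardy_norm 2 (S f) \<le> C * hardy_norm 2 f) \<and>
     (\<forall>f\<in>hardy 2. pairing (S f) f \<in> \<real>\<^sub>\<ge>\<^sub>0) \<and>
     (\<forall>f\<in>hardy 2. S (S f) = T f)"

text \<open>
  A positive square root is unique as an operator on \<open>hardy 2\<close>; the choice below only concerns
  irrelevant values outside that space.
\<close>

definition positive_sqrt ::
    "((complex \<Rightarrow> complex) \<Rightarrow> (complex \<Rightarrow> complex)) \<Rightarrow> (complex \<Rightarrow> complex) \<Rightarrow> (complex \<Rightarrow> complex)"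
  where
  "positive_sqrt T = (SOME S. is_positive_sqrt T S)"

definition de_branges_rovnyak :: "(complex \<Rightarrow> complex) \<Rightarrow> (complex \<Rightarrow> complex) set" where
  "de_branges_rovnyak b =
     positive_sqrt (\<lambda>f z. f z - toeplitz b (hilbert_adjoint (toeplitz b) f) z) ` hardy 2"

text \<open>
  The quotient below equals \<open>(1 - z\<^sup>k) / (k (1 - z))\<close>, a quotient of two numbers in the open right
  half-plane, and so it avoids the slit of the principal logarithm. Hence \<^const>\<open>Ln\<close> of it is
  the holomorphic branch on the disk with value \<open>- ln k\<close> at the origin, as the lemmas
  after the definition confirm.
\<close>

definition geom_mean :: "nat \<Rightarrow> complex \<Rightarrow> complex" where
  "geom_mean k z = (\<Sum>j<k. z ^ j) / of_nat k"

definition nyman_h :: "nat \<Rightarrow> complex \<Rightarrow> complex" where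
  "nyman_h k z = (if z \<in> ball 0 1 then 1 / (1 - z) * Ln (geom_mean k z) else 0)"

lemma geom_mean_notin_nonpos_Reals:
  assumes "k \<ge> 1" "z \<in> ball 0 1"
  shows "geom_mean k z \<notin> \<real>\<^sub>\<le>\<^sub>0"
proof
  assume "geom_mean k z \<in> \<real>\<^sub>\<le>\<^sub>0"
  then obtain t where t: "t \<le> 0" "geom_mean k z = of_real t"
    by (auto elim!: nonpos_Reals_cases)
  have z: "norm z < 1" using assms by simp
  have zk: "norm (z ^ k) < 1"
    using z assms by (simp add: norm_power power_less_one_iff)
  have "(\<Sum>j<k. z ^ j) = of_real (t * real k)"
    using t(2) assms by (simp add: geom_mean_def field_simps)
  then have "1 - z ^ k = (1 - z) * of_real (t * real k)"
    by (metis one_diff_power_eq)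
  then have "1 - Re (z ^ k) = (t * real k) * (1 - Re z)"
    by (metis Re_complex_of_real mult.commute minus_complex.sel(1) one_complex.sel(1)
        scaleR_complex.sel(1) scaleR_conv_of_real)
  moreover have "1 - Re (z ^ k) > 0" "1 - Re z > 0"
    using z zk abs_Re_le_cmod[of z] abs_Re_le_cmod[of "z ^ k"] by linarith+
  moreover have "(t * real k) * (1 - Re z) \<le> 0"
    using t(1) \<open>1 - Re z > 0\<close> by (simp add: mult_nonneg_nonpos mult_nonpos_nonneg)
  ultimately show False by linarith
qed

lemma Ln_geom_mean_holomorphic:
  assumes "k \<ge> 1"
  shows "(\<lambda>z. Ln (geom_mean k z)) holomorphic_on ball 0 1"
  using geom_mean_notin_nonpos_Reals[OF assms]
  by (intro holomorphic_on_Ln') (auto simp: geom_mean_def assms intro!: holomorphic_intros)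

lemma exp_Ln_geom_mean:
  assumes "k \<ge> 1" "z \<in> ball 0 1"
  shows "exp (Ln (geom_mean k z)) = geom_mean k z"
  using geom_mean_notin_nonpos_Reals[OF assms] by (intro exp_Ln) auto

lemma Ln_geom_mean_0:
  assumes "k \<ge> 1"
  shows "Ln (geom_mean k 0) = - of_real (ln (real k))"
proof -
  have "(\<Sum>j<k. (0::complex) ^ j) = 1"
    using assms by (cases k) (simp_all add: sum.lessThan_Suc_shift del: sum.lessThan_Suc)
  then have "geom_mean k 0 = of_real (1 / real k)"
    by (simp add: geom_mean_def)
  then show ?thesis
    using assms by (simp add: Ln_of_real ln_div del: of_real_divide)
qed

definition nyman_span :: "(complex \<Rightarrow> complex) set" where
  "nyman_span = {f. \<exists>(K::nat set) (c::nat \<Rightarrow> complex). finite K \<and> K \<subseteq> {2..} \<and>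
     f = (\<lambda>z. \<Sum>k\<in>K. c k * nyman_h k z)}"

definition nyman_perp :: "(complex \<Rightarrow> complex) set" where
  "nyman_perp = {g \<in> hardy 2. \<forall>f\<in>nyman_span. pairing f g = 0}"

end

theory Submission
  imports Defs "HOL-Complex_Analysis.Complex_Analysis" "HOL-Probability.Probability_Measure"
begin

text \<open>
  Write \<open>\<psi> = 1 / \<phi>\<close> and let \<open>g \<bottom> \<N>\<close>. If \<open>F \<mapsto> \<langle>\<psi> F, g\<rangle>\<close> is bounded in the \<open>H\<^sup>p\<close> norm on the
  domain of \<open>T\<^sub>\<psi>\<close>, then it vanishes there, because it vanishes on the dense set \<open>\<phi> \<N>\<close>. If \<open>h\<close> is
  the outer denominator of \<open>\<phi>\<close>, the domain is large enough for its image under \<open>T\<^sub>\<psi>\<close> to contain all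
  \<open>z\<^sup>m u\<^sub>n h\<close>, where \<open>u\<^sub>n\<close> is the outer function with modulus \<open>min (e\<^sup>n) (1 / \<bar>h\<bar>)\<close>. Since
  \<open>u\<^sub>n h\<close> tends to a unimodular constant in \<open>H\<^sup>2\<close>, all Taylor coefficients of \<open>g\<close> are zero.

  For \<open>g\<close> in the domain of the adjoint the functional is bounded by Hoelder's inequality. For
  \<open>g = S f\<close> with \<open>S = (I - T\<^sub>b T\<^sub>b\<^sup>*)\<^sup>1\<^sup>/\<^sup>2\<close>, every \<open>F\<close> in the domain of \<open>T\<^sub>\<psi>\<close> has the form \<open>a G\<close> with
  \<open>G \<in> H\<^sup>2\<close> and \<open>\<psi> F = b G\<close>, and \<open>\<parallel>S b G\<parallel> \<le> \<parallel>a G\<parallel>\<close> follows from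
  \<open>\<parallel>G\<parallel>\<^sup>2 = \<parallel>a G\<parallel>\<^sup>2 + \<parallel>b G\<parallel>\<^sup>2\<close>, so that \<open>\<bar>\<langle>\<psi> F, g\<rangle>\<bar> \<le> \<parallel>f\<parallel> \<parallel>F\<parallel>\<close>.

  The pairing is defined through radial limits, which exist almost everywhere on \<open>H\<^sup>p\<close>, \<open>p > 1\<close>, by
  a weak type estimate for the radial maximal function.
\<close>

section \<open>Circle means and the Poisson formula\<close>

text \<open>\<open>pairing\<close> sees a function only through boundary values, whose existence is
  itself to be proved, so the analysis starts from dilates at radii below 1, where power series
  integrate term by term. A maximal inequality gives limits almost everywhere only next to
  convergence in mean, and no boundary function is at hand to converge to. The uniform convexity of
  the bracket \<open>jap\<close> fills this gap: it shows that the dilates are Cauchy in L^1. The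
  vector g is orthogonal to the span in H^2 while density holds in H^p. The two fit together because
  \<open>pairing\<close> is one boundary integral for all exponents, and because every h_k lies in
  every H^p: for f in the span, phi f belongs to the domain of T_psi and is sent back to f. For H(b)
  the obstacle is that \<open>hilbert_adjoint\<close> and \<open>positive_sqrt\<close> are a
  \<open>THE\<close> and a \<open>SOME\<close>. The adjoint and a root have to be constructed before
  any property of them is available; both constructions rest on the Riesz representation in the
  space of square summable Taylor coefficients.\<close>

abbreviation "cm \<equiv> circle_measure"

lemma sets_cm [measurable_cong, simp]: "sets circle_measure = sets borel"
  by (simp add: circle_measure_def)

lemma measurable_cm [simp]: "measurable circle_measure N = measurable borel N"
  by (rule measurable_cong_sets) auto

lemma space_cm [simp]: "space circle_measure = UNIV"
  by (simp add: circle_measure_def)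

lemma cis_borel [measurable]: "cis \<in> borel_measurable borel"
  by (intro borel_measurable_continuous_onI continuous_intros)

lemma cnj_borel [measurable]: "cnj \<in> borel_measurable borel"
  by (intro borel_measurable_continuous_onI continuous_intros)

lemma prob_space_cm: "prob_space circle_measure"
proof -
  have "prob_space (uniform_measure lborel {0..2*pi})"
    by (rule prob_space_uniform_measure) auto
  then show ?thesis
    unfolding circle_measure_def by (intro prob_space.prob_space_distr) auto
qed

interpretation cm: prob_space circle_measure by (rule prob_space_cm)

lemma AE_cm_iff:
  assumes [measurable]: "Measurable.pred borel P"
  shows "(AE \<zeta> in cm. P \<zeta>) \<longleftrightarrow> (AE t in lborel. t \<in> {0..2*pi} \<longrightarrow> P (cis t))"
proof -
  have "(AE \<zeta> in cm. P \<zeta>) \<longleftrightarrow> (AE t in uniform_measure lborel {0..2*pi}. P (cis t))"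
    unfolding circle_measure_def by (subst AE_distr_iff) auto
  also have "\<dots> \<longleftrightarrow> (AE t in lborel. t \<in> {0..2*pi} \<longrightarrow> P (cis t))"
    by (subst AE_uniform_measure) auto
  finally show ?thesis .
qed

lemma AE_cm_norm: "AE \<zeta> in cm. norm \<zeta> = 1"
  by (subst AE_cm_iff) auto

lemma nn_integral_cm:
  assumes [measurable]: "f \<in> borel_measurable borel"
  shows "(\<integral>\<^sup>+\<zeta>. f \<zeta> \<partial>cm) = (\<integral>\<^sup>+t. f (cis t) * indicator {0..2*pi} t \<partial>lborel) / ennreal (2*pi)"
  unfolding circle_measure_def
  by (subst nn_integral_distr) (auto simp: nn_integral_uniform_measure)

lemma integral_cm:
  fixes f :: "complex \<Rightarrow> 'b::{banach, second_countable_topology}"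
  assumes [measurable]: "f \<in> borel_measurable borel"
  shows "(LINT \<zeta>|cm. f \<zeta>) = (1 / (2*pi)) *\<^sub>R (LINT t:{0..2*pi}|lborel. f (cis t))"
proof -
  have "(LINT \<zeta>|cm. f \<zeta>) = (LINT t|uniform_measure lborel {0..2*pi}. f (cis t))"
    unfolding circle_measure_def by (subst integral_distr) auto
  also have "uniform_measure lborel {0..2*pi} = density lborel (\<lambda>t. ennreal (indicator {0..2*pi} t
      / (2*pi)))"
    unfolding uniform_measure_def
    by (intro density_cong) (auto simp: indicator_def divide_ennreal[symmetric])
  also have "(LINT t|density lborel (\<lambda>t. ennreal (indicator {0..2*pi} t / (2*pi))). f (cis t)) =
     (LINT t|lborel. (indicator {0..2*pi} t / (2*pi)) *\<^sub>R f (cis t))"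
    by (subst integral_density) (auto simp: indicator_def)
  also have "\<dots> = (LINT t|lborel. (1 / (2*pi)) *\<^sub>R (indicator {0..2*pi} t *\<^sub>R f (cis t)))"
    by (intro Bochner_Integration.integral_cong) (auto simp: indicator_def)
  also have "\<dots> = (1 / (2*pi)) *\<^sub>R (LINT t:{0..2*pi}|lborel. f (cis t))"
    unfolding set_lebesgue_integral_def by (rule integral_scaleR_right)
  finally show ?thesis .
qed

lemma integrable_cm_bounded:
  fixes f :: "complex \<Rightarrow> 'b::{banach, second_countable_topology}"
  assumes "f \<in> borel_measurable borel" "\<And>\<zeta>. norm \<zeta> = 1 \<Longrightarrow> norm (f \<zeta>) \<le> B"
  shows "integrable cm f"
  using assms AE_cm_norm
  by (intro cm.integrable_const_bound[where B=B]) auto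

lemma integral_cm_cong:
  fixes f g :: "complex \<Rightarrow> 'b::{banach, second_countable_topology}"
  assumes "f \<in> borel_measurable borel" "g \<in> borel_measurable borel" "\<And>\<zeta>. norm \<zeta> = 1 \<Longrightarrow> f \<zeta> = g \<zeta>"
  shows "(LINT \<zeta>|cm. f \<zeta>) = (LINT \<zeta>|cm. g \<zeta>)"
proof (rule integral_cong_AE)
  show "AE \<zeta> in cm. f \<zeta> = g \<zeta>"
    using AE_cm_norm by eventually_elim (rule assms)
qed (use assms in auto)

lemma integral_cm_power:
  assumes "n > 0"
  shows "(LINT \<zeta>|cm. \<zeta> ^ n) = 0"
proof -
  have "(LINT t:{0..2*pi}|lborel. cis t ^ n) = 
      (cis (real n * (2*pi)) / (\<i> * of_nat n)) - cis (real n * 0) / (\<i> * of_nat n)"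
    unfolding set_lebesgue_integral_def
  proof (rule integral_FTC_atLeastAtMost)
    fix x :: real
    have "((\<lambda>z. exp (\<i> * of_nat n * z) / (\<i> * of_nat n)) has_field_derivative exp (\<i> * of_nat n *
        of_real x)) (at (of_real x))"
      using assms by (auto intro!: derivative_eq_intros)
    moreover have e: "cis (real n * x) = exp (\<i> * of_nat n * of_real x)" for x
      by (subst cis_conv_exp) (simp add: mult_ac)
    moreover have "cis x ^ n = exp (\<i> * of_nat n * of_real x)"
      unfolding e[symmetric] by (rule Complex.DeMoivre)
    ultimately show "((\<lambda>x. cis (real n * x) / (\<i> * of_nat n)) has_vector_derivative cis x ^ n) (at
        x within {0..2*pi})"
      by (simp only:) (rule has_vector_derivative_real_field, simp)
  qed (auto intro!: continuous_intros)
  also have "cis (real n * (2*pi)) = cis (real n * 0)"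
    using cis_multiple_2pi[of "real n"] by (simp add: mult_ac)
  also have "cis (real n * 0) / (\<i> * of_nat n) - cis (real n * 0) / (\<i> * of_nat n) = 0"
    by simp
  finally show ?thesis
    by (subst integral_cm) auto
qed

lemma integral_cm_cnj: "(LINT \<zeta>|cm. cnj (f \<zeta>)) = cnj (LINT \<zeta>|cm. f \<zeta>)"
  by (simp add: Bochner_Integration.integral_cnj)

lemma integral_cm_orth: "(LINT \<zeta>|cm. \<zeta> ^ m * cnj \<zeta> ^ n) = (if m = n then 1 else 0)"
proof -
  \<comment> \<open>On the circle \<open>cnj \<zeta>\<close> is the inverse of
    \<open>\<zeta>\<close>, so the product is a power of one of the two and
    \<open>integral_cm_power\<close> applies.\<close>
  have eq: "\<zeta> ^ m * cnj \<zeta> ^ n = (if m \<ge> n then \<zeta> ^ (m - n) else cnj (\<zeta> ^ (n - m)))"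
    if "norm \<zeta> = 1" for \<zeta> :: complex
  proof -
    have 1: "\<zeta> * cnj \<zeta> = 1"
      using that by (metis complex_norm_square of_real_1 one_power2)
    have 2: "\<zeta> ^ k * cnj \<zeta> ^ k = 1" for k
      using 1 by (metis power_mult_distrib power_one)
    show ?thesis
    proof (cases "m \<ge> n")
      case True
      then have "\<zeta> ^ m * cnj \<zeta> ^ n = \<zeta> ^ (m-n) * (\<zeta> ^ n * cnj \<zeta> ^ n)"
        by (simp flip: mult.assoc power_add)
      with True 2 show ?thesis by simp
    next
      case False
      then have "\<zeta> ^ m * cnj \<zeta> ^ n = cnj \<zeta> ^ (n-m) * (\<zeta> ^ m * cnj \<zeta> ^ m)"
        by (simp add: mult.left_commute flip: power_add) 
      with False 2 show ?thesis by simp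
    qed
  qed
  have "(LINT \<zeta>|cm. \<zeta> ^ m * cnj \<zeta> ^ n) = (LINT \<zeta>|cm. (if m \<ge> n then \<zeta> ^ (m - n) else cnj (\<zeta> ^ (n -
      m))))"
    by (rule integral_cm_cong, measurable) (auto simp: eq)
  also have "\<dots> = (if m = n then 1 else 0)"
    using integral_cm_power[of "m-n"] integral_cm_power[of "n-m"] cm.prob_space
    by (cases m n rule: linorder_cases) (simp_all add: integral_cm_cnj del: complex_cnj_power)
  finally show ?thesis .
qed

text \<open>The Weierstrass test for integrals over the circle. The bounds \<open>B n\<close> are
  asked for at norm one only, since \<open>circle_measure\<close> lives there.\<close>

lemma sums_integral_cm:
  fixes u :: "nat \<Rightarrow> complex \<Rightarrow> complex"
  assumes [measurable]: "\<And>n. u n \<in> borel_measurable borel"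
    and b: "\<And>n \<zeta>. norm \<zeta> = 1 \<Longrightarrow> norm (u n \<zeta>) \<le> B n" and "summable B"
  shows "(\<lambda>n. LINT \<zeta>|cm. u n \<zeta>) sums (LINT \<zeta>|cm. (\<Sum>n. u n \<zeta>))"
proof (rule sums_integral)
  show "integrable cm (u n)" for n
    by (rule integrable_cm_bounded[OF _ b]) auto
  show "AE \<zeta> in cm. summable (\<lambda>n. norm (u n \<zeta>))"
    using AE_cm_norm by eventually_elim (auto intro!: summable_comparison_test'[OF \<open>summable B\<close>] b)
  show "summable (\<lambda>n. LINT \<zeta>|cm. norm (u n \<zeta>))"
  proof (rule summable_comparison_test'[OF \<open>summable B\<close>])
    fix n :: nat
    have B0: "0 \<le> B n"
      using b[of 1 n] by (meson norm_ge_zero norm_one order_trans)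
    have "(LINT \<zeta>|cm. norm (u n \<zeta>)) \<le> (LINT \<zeta>|cm. B n)"
    proof (rule integral_mono_AE)
      show "integrable cm (\<lambda>\<zeta>. norm (u n \<zeta>))"
        by (rule integrable_cm_bounded[where B="B n"]) (auto simp: b)
      show "AE \<zeta> in cm. norm (u n \<zeta>) \<le> B n"
        using AE_cm_norm by eventually_elim (rule b)
    qed auto
    then show "norm (LINT \<zeta>|cm. norm (u n \<zeta>)) \<le> B n"
      using cm.prob_space by simp
  qed
qed

section \<open>Taylor coefficients and circle means of dilates\<close>

definition taylor :: "(complex \<Rightarrow> complex) \<Rightarrow> nat \<Rightarrow> complex" where
  "taylor f n = (deriv ^^ n) f 0 / fact n"

lemma taylor_sums:
  assumes "f holomorphic_on ball 0 1" "norm z < 1"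
  shows "(\<lambda>n. taylor f n * z ^ n) sums f z"
  using holomorphic_power_series[OF assms(1), of z] assms(2) by (simp add: taylor_def)

lemma taylor_abs_summable:
  assumes "f holomorphic_on ball 0 1" "0 \<le> r" "r < 1"
  shows "summable (\<lambda>n. norm (taylor f n) * r ^ n)"
proof -
  \<comment> \<open>An intermediate radius: convergence at (1 + r) / 2 < 1 forces absolute
    convergence at the smaller radius \<open>r\<close>.\<close>
  have "summable (\<lambda>n. taylor f n * of_real ((1 + r) / 2) ^ n)"
  proof (intro sums_summable[OF taylor_sums] assms)
    have "norm (complex_of_real ((1 + r) / 2)) = (1 + r) / 2"
      using assms by (subst norm_of_real) simp
    then have "norm (complex_of_real ((1 + r) / 2)) < 1" using assms(3)
      by (simp del: of_real_divide)
    then show "norm (complex_of_real ((1 + r) / 2)) < 1" .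
  qed
  moreover have "norm (complex_of_real r) < norm (complex_of_real ((1 + r) / 2))"
    using assms unfolding norm_of_real by simp
  ultimately have "summable (\<lambda>n. norm (taylor f n * of_real r ^ n))"
    by (rule powser_insidea)
  then show ?thesis
    using assms by (simp add: norm_mult norm_power)
qed

text \<open>Membership in \<open>disk_holo\<close> forces the value 0 off the disk, which constants,
  the identity and dilates \<open>f (c * z)\<close> violate. This larger class is closed under such
  operations and retains the Borel measurability that integration over \<open>circle_measure\<close>
  requires.\<close>

definition disk_map :: "(complex \<Rightarrow> complex) \<Rightarrow> bool" where
  "disk_map f \<longleftrightarrow> f holomorphic_on ball 0 1 \<and> f \<in> borel_measurable borel"

lemma disk_mapD: "disk_map f \<Longrightarrow> f holomorphic_on ball 0 1"
  and disk_map_borel [measurable_dest]: "disk_map f \<Longrightarrow> f \<in> borel_measurable borel"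
  by (auto simp: disk_map_def)

lemma disk_holo_disk_map:
  assumes "f \<in> disk_holo"
  shows "disk_map f"
proof -
  have "(\<lambda>z. if z \<in> ball 0 1 then f z else 0) \<in> borel_measurable borel"
    using assms
    by (intro borel_measurable_continuous_on_if holomorphic_on_imp_continuous_on
        continuous_on_const)
       (auto simp: disk_holo_def)
  moreover have "(\<lambda>z. if z \<in> ball 0 1 then f z else 0) = f"
    using assms by (auto simp: disk_holo_def)
  ultimately show ?thesis
    using assms by (auto simp: disk_map_def disk_holo_def)
qed

lemma disk_map_bounded_dilate:
  assumes "f holomorphic_on ball 0 1" "0 \<le> r" "r < 1"
  obtains B where "\<And>z. norm z \<le> r \<Longrightarrow> norm (f z) \<le> B"
proof -
  have "compact (f ` cball 0 r)"
    using assms by (intro compact_continuous_image holomorphic_on_imp_continuous_on)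
        (auto intro: holomorphic_on_subset)
  then have "bounded (f ` cball 0 r)" by (rule compact_imp_bounded)
  then obtain B where "\<forall>y\<in>f ` cball 0 r. norm y \<le> B" by (auto simp: bounded_iff)
  then show thesis by (intro that[of B]) auto
qed

text \<open>Termwise integration of the Taylor series at \<open>of_real r * \<zeta> ^ k\<close>. The
  exponent \<open>k\<close> serves the singularities of \<open>nyman_h k\<close> at k-th roots of
  unity; elsewhere it is 1.\<close>

lemma dilate_sums_pow:
  assumes f: "disk_map f" and r: "0 \<le> r" "r < 1"
    and u [measurable]: "u \<in> borel_measurable borel" and B: "\<And>\<zeta>. norm \<zeta> = 1 \<Longrightarrow> norm (u \<zeta>) \<le> B"
  shows "(\<lambda>n. taylor f n * of_real r ^ n * (LINT \<zeta>|cm. \<zeta> ^ (k * n) * u \<zeta>)) sums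
     (LINT \<zeta>|cm. f (of_real r * \<zeta> ^ k) * u \<zeta>)"
proof -
  note [measurable] = disk_map_borel[OF f]
  let ?w = "\<lambda>n \<zeta>. taylor f n * of_real r ^ n * (\<zeta> ^ (k * n) * u \<zeta>)"
  have sums: "(\<lambda>n. ?w n \<zeta>) sums (f (of_real r * \<zeta> ^ k) * u \<zeta>)" if "norm \<zeta> = 1" for \<zeta>
  proof -
    have "norm (of_real r * \<zeta> ^ k) < 1" using that r by (simp add: norm_mult norm_power)
    from sums_mult2[OF taylor_sums[OF disk_mapD[OF f] this], of "u \<zeta>"]
    show ?thesis by (simp add: power_mult_distrib power_mult[symmetric] mult_ac)
  qed
  have "(\<lambda>n. LINT \<zeta>|cm. ?w n \<zeta>) sums (LINT \<zeta>|cm. (\<Sum>n. ?w n \<zeta>))"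
  proof (rule sums_integral_cm)
    show "summable (\<lambda>n. (norm (taylor f n) * r ^ n) * B)"
      by (intro summable_mult2 taylor_abs_summable disk_mapD f r)
    show "norm (?w n \<zeta>) \<le> (norm (taylor f n) * r ^ n) * B" if "norm \<zeta> = 1" for n \<zeta>
      using that r B[OF that] by (auto simp: norm_mult norm_power intro!: mult_left_mono)
  qed measurable
  also have "(LINT \<zeta>|cm. (\<Sum>n. ?w n \<zeta>)) = (LINT \<zeta>|cm. f (of_real r * \<zeta> ^ k) * u \<zeta>)"
    by (rule integral_cm_cong, measurable) (use sums sums_unique in force)
  finally show ?thesis by simp
qed

lemma dilate_sums:
  assumes "disk_map f" "0 \<le> r" "r < 1"
    and "u \<in> borel_measurable borel" "\<And>\<zeta>. norm \<zeta> = 1 \<Longrightarrow> norm (u \<zeta>) \<le> B"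
  shows "(\<lambda>n. taylor f n * of_real r ^ n * (LINT \<zeta>|cm. \<zeta> ^ n * u \<zeta>)) sums
     (LINT \<zeta>|cm. f (of_real r * \<zeta>) * u \<zeta>)"
  using dilate_sums_pow[OF assms, of 1] by simp

lemma dilate_coeff_pow:
  assumes "disk_map f" "0 \<le> r" "r < 1" "k > 0"
  shows "(LINT \<zeta>|cm. f (of_real r * \<zeta> ^ k) * cnj \<zeta> ^ (k * n)) = taylor f n * of_real r ^ n"
proof -
  have "(\<lambda>m. taylor f m * of_real r ^ m * (LINT \<zeta>|cm. \<zeta> ^ (k * m) * cnj \<zeta> ^ (k * n))) sums
     (LINT \<zeta>|cm. f (of_real r * \<zeta> ^ k) * cnj \<zeta> ^ (k * n))"
    using assms by (intro dilate_sums_pow[where B=1]) (auto simp: norm_power)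
  moreover have "(\<lambda>m. taylor f m * of_real r ^ m * (LINT \<zeta>|cm. \<zeta> ^ (k * m) * cnj \<zeta> ^ (k * n))) =
     (\<lambda>m. if m = n then taylor f m * of_real r ^ m else 0)"
    using assms by (auto simp: integral_cm_orth)
  moreover have "(\<lambda>m. if m = n then taylor f m * of_real r ^ m else 0) sums
      (taylor f n * of_real r ^ n)"
    by (rule sums_single)
  ultimately show ?thesis
    by (simp only:) (rule sums_unique2)
qed

text \<open>Only \<open>f\<close> is expanded; \<open>g\<close> stays a bounded factor and enters
  through its coefficients, so no double series arises.\<close>

lemma dilate_parseval_pow:
  assumes f: "disk_map f" and g: "disk_map g" and r: "0 \<le> r" "r < 1" and k: "k > 0"
  shows "(\<lambda>n. taylor f n * cnj (taylor g n) * of_real r ^ (2 * n)) sums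
     (LINT \<zeta>|cm. f (of_real r * \<zeta> ^ k) * cnj (g (of_real r * \<zeta> ^ k)))"
proof -
  note [measurable] = disk_map_borel[OF f] disk_map_borel[OF g]
  obtain B where B: "\<And>z. norm z \<le> r \<Longrightarrow> norm (g z) \<le> B"
    using disk_map_bounded_dilate[OF disk_mapD[OF g] r] by blast
  have "(LINT \<zeta>|cm. \<zeta> ^ (k * n) * cnj (g (of_real r * \<zeta> ^ k))) =
     cnj (LINT \<zeta>|cm. g (of_real r * \<zeta> ^ k) * cnj \<zeta> ^ (k * n))" for n
    by (subst integral_cm_cnj[symmetric]) (simp add: mult.commute)
  then have "(LINT \<zeta>|cm. \<zeta> ^ (k * n) * cnj (g (of_real r * \<zeta> ^ k))) =
      cnj (taylor g n) * of_real r ^ n" for n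
    by (simp add: dilate_coeff_pow g r k)
  moreover have "(\<lambda>n. taylor f n * of_real r ^ n * (LINT \<zeta>|cm. \<zeta> ^ (k * n) * cnj (g (of_real r * \<zeta>
      ^ k)))) sums
     (LINT \<zeta>|cm. f (of_real r * \<zeta> ^ k) * cnj (g (of_real r * \<zeta> ^ k)))"
    by (rule dilate_sums_pow[OF f r, where B=B]) (use r in \<open>auto intro!: B simp: norm_mult
        norm_power\<close>)
  ultimately show ?thesis
    by (simp only: power_add mult_ac mult_2_right)
qed

section \<open>The Poisson kernel\<close>

definition poisson :: "complex \<Rightarrow> complex \<Rightarrow> real" where
  "poisson z \<zeta> = (1 - (norm z)\<^sup>2) / (norm (\<zeta> - z))\<^sup>2"

lemma poisson_borel [measurable]: "poisson z \<in> borel_measurable borel"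
  unfolding poisson_def by measurable

lemma poisson_nonneg: "norm z < 1 \<Longrightarrow> 0 \<le> poisson z \<zeta>"
  unfolding poisson_def by (auto intro!: divide_nonneg_nonneg simp: power_le_one)

lemma poisson_le:
  assumes "norm z < 1" "norm \<zeta> = 1"
  shows "poisson z \<zeta> \<le> 1 / (1 - norm z)\<^sup>2"
  unfolding poisson_def
proof (rule frac_le)
  have "1 - norm z \<le> norm (\<zeta> - z)" using assms norm_triangle_ineq2[of \<zeta> z] by simp
  then show "(1 - norm z)\<^sup>2 \<le> (norm (\<zeta> - z))\<^sup>2" using assms by (intro power_mono) auto
qed (use assms in auto)

text \<open>With \<open>w = z * cnj \<zeta>\<close> the kernel is 1 / (1 - w) + cnj w / (1 - cnj w),
  two geometric series. The conjugate one starts at exponent one, so that the constant term is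
  counted once.\<close>

lemma poisson_sums:
  assumes "norm z < 1" "norm \<zeta> = 1"
  shows "(\<lambda>j. z ^ j * cnj \<zeta> ^ j + cnj z ^ Suc j * \<zeta> ^ Suc j) sums of_real (poisson z \<zeta>)"
proof -
  define w where "w = z * cnj \<zeta>"
  have w: "norm w < 1" using assms by (simp add: w_def norm_mult)
  have zz: "\<zeta> * cnj \<zeta> = 1"
    using assms by (metis complex_norm_square of_real_1 one_power2)
  have "norm (1 - w) = norm (\<zeta> * (1 - w))" using assms by (simp add: norm_mult)
  also have "\<zeta> * (1 - w) = \<zeta> - z" using zz by (simp add: w_def algebra_simps)
  finally have nw: "norm (\<zeta> - z) = norm (1 - w)" by simp
  have nz: "norm z = norm w" using assms by (simp add: w_def norm_mult)
  have "w \<noteq> 1" using w by auto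
  then have "1 - w \<noteq> 0" "1 - cnj w \<noteq> 0" by (simp_all add: complex_eq_iff)
  have "(\<lambda>j. w ^ j + cnj w * cnj w ^ j) sums (1 / (1 - w) + cnj w * (1 / (1 - cnj w)))"
    using w by (intro sums_add sums_mult geometric_sums) auto
  also have "1 / (1 - w) + cnj w * (1 / (1 - cnj w)) = (1 - w * cnj w) / ((1 - w) * cnj (1 - w))"
    using \<open>1 - w \<noteq> 0\<close> \<open>1 - cnj w \<noteq> 0\<close> by (simp add: field_simps)
  also have "\<dots> = of_real (poisson z \<zeta>)"
    unfolding poisson_def nw nz complex_norm_square[symmetric] by simp
  finally show ?thesis
    by (simp add: w_def power_mult_distrib mult_ac)
qed

text \<open>Orthogonality leaves only the term \<open>j = n\<close> of the kernel series; the
  conjugate half contributes \<open>\<zeta> ^ (n + Suc j)\<close>, a positive power with mean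
  zero.\<close>

lemma integral_power_poisson:
  assumes z: "norm z < 1"
  shows "(LINT \<zeta>|cm. \<zeta> ^ n * of_real (poisson z \<zeta>)) = z ^ n"
proof -
  let ?u = "\<lambda>j \<zeta>. z ^ j * (\<zeta> ^ n * cnj \<zeta> ^ j) + cnj z ^ Suc j * (\<zeta> ^ (n + Suc j) * cnj \<zeta> ^ 0)"
  have "(\<lambda>j. LINT \<zeta>|cm. ?u j \<zeta>) sums (LINT \<zeta>|cm. (\<Sum>j. ?u j \<zeta>))"
  proof (rule sums_integral_cm)
    show "summable (\<lambda>j. norm z ^ j + norm z ^ Suc j)"
      using z by (intro summable_add) (auto simp: summable_mult)
    show "norm (?u j \<zeta>) \<le> norm z ^ j + norm z ^ Suc j" if "norm \<zeta> = 1" for j \<zeta>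
      using that by (intro order_trans[OF norm_triangle_ineq]) (simp add: norm_mult norm_power)
  qed measurable
  moreover have "(LINT \<zeta>|cm. ?u j \<zeta>) = (if j = n then z ^ j else 0)" for j
  proof -
    have "(LINT \<zeta>|cm. ?u j \<zeta>) = z ^ j * (LINT \<zeta>|cm. \<zeta> ^ n * cnj \<zeta> ^ j) 
        + cnj z ^ Suc j * (LINT \<zeta>|cm. \<zeta> ^ (n + Suc j) * cnj \<zeta> ^ 0)"
      by (subst Bochner_Integration.integral_add)
         (auto intro!: integrable_cm_bounded[where B=1] integrable_mult_right simp: norm_mult
             norm_power)
    then show ?thesis by (simp only: integral_cm_orth) auto
  qed
  moreover have "(LINT \<zeta>|cm. (\<Sum>j. ?u j \<zeta>)) = (LINT \<zeta>|cm. \<zeta> ^ n * of_real (poisson z \<zeta>))"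
  proof (rule integral_cm_cong, measurable)
    fix \<zeta> :: complex assume "norm \<zeta> = 1"
    from sums_mult[OF poisson_sums[OF z this], of "\<zeta> ^ n"]
    show "(\<Sum>j. ?u j \<zeta>) = \<zeta> ^ n * of_real (poisson z \<zeta>)"
      by (intro sums_unique[symmetric]) (simp add: algebra_simps power_add)
  qed
  ultimately have "(\<lambda>j. if j = n then z ^ j else 0) sums (LINT \<zeta>|cm. \<zeta> ^ n * of_real (poisson z \<zeta>))"
    by (simp only:)
  from sums_unique2[OF this sums_single[of n "\<lambda>j. z ^ j"]] show ?thesis .
qed

lemma integral_poisson:
  assumes "norm z < 1"
  shows "(LINT \<zeta>|cm. poisson z \<zeta>) = 1"
  using integral_power_poisson[OF assms, of 0] by (simp add: complex_eq_iff)

text \<open>At a radius \<open>r < 1\<close> this is a termwise computation without boundary values: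
  the kernel reproduces each power.\<close>

lemma poisson_formula:
  assumes f: "disk_map f" and r: "0 \<le> r" "r < 1" and z: "norm z < 1"
  shows "f (of_real r * z) = (LINT \<zeta>|cm. f (of_real r * \<zeta>) * of_real (poisson z \<zeta>))"
proof -
  have "(\<lambda>n. taylor f n * of_real r ^ n * (LINT \<zeta>|cm. \<zeta> ^ n * of_real (poisson z \<zeta>))) sums
     (LINT \<zeta>|cm. f (of_real r * \<zeta>) * of_real (poisson z \<zeta>))"
    using poisson_le[OF z] poisson_nonneg[OF z]
    by (intro dilate_sums[OF f r, where B="1 / (1 - norm z)\<^sup>2"]) auto
  then have "(\<lambda>n. taylor f n * (of_real r * z) ^ n) sums
     (LINT \<zeta>|cm. f (of_real r * \<zeta>) * of_real (poisson z \<zeta>))"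
    by (simp only: integral_power_poisson[OF z] power_mult_distrib mult_ac)
  moreover have "norm (of_real r * z) \<le> norm z"
    using r by (simp add: norm_mult mult_left_le_one_le)
  then have "(\<lambda>n. taylor f n * (of_real r * z) ^ n) sums f (of_real r * z)"
    using z by (intro taylor_sums disk_mapD f) linarith
  ultimately show ?thesis by (rule sums_unique2[symmetric])
qed

section \<open>The radial maximal function\<close>

text \<open>On [-pi, pi] one has |cis s - 1| = 2 |sin (s / 2)| >= |s| / 2. Replacing 1 by
  \<open>r\<close> costs a factor 2, because 1 - r is itself at most |cis s - r|.\<close>

lemma norm_cis_minus_of_real_ge:
  fixes r s :: real
  assumes r: "0 \<le> r" "r \<le> 1" and s: "\<bar>s\<bar> \<le> pi"
  shows "\<bar>s\<bar> / 4 \<le> norm (cis s - of_real r)"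
proof -
  define x where "x = \<bar>s\<bar> / 2"
  have x: "0 \<le> x" "x \<le> 2" using s pi_less_4 by (auto simp: x_def)
  have "x / 2 \<le> sin x"
  proof -
    have "x - x ^ 3 / 6 \<le> sin x"
      using Maclaurin_sin_bound[of x 3] x
        by (simp add: sin_coeff_def numeral_3_eq_3 fact_numeral field_simps) (smt (verit, best))
    \<comment> \<open>From x <= pi / 2 < 1.6 follows x^2 <= 3, hence the cubic Taylor term x^3 / 6
      takes away at most x / 2.\<close>
    moreover have "x * x\<^sup>2 \<le> x * 3"
    proof (rule mult_left_mono)
      have "x \<le> 1.6" using s pi_approx by (auto simp: x_def)
      then have "x\<^sup>2 \<le> 1.6\<^sup>2" using x by (intro power_mono) auto
      then show "x\<^sup>2 \<le> 3" by (simp add: power2_eq_square)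
    qed (use x in auto)
    ultimately show ?thesis by (simp add: power3_eq_cube power2_eq_square)
  qed
  moreover have "norm (cis s - 1) = 2 * \<bar>sin (s / 2)\<bar>"
    using dist_exp_i_1[of s] by (simp add: cis_conv_exp)
  moreover have "\<bar>sin (s / 2)\<bar> = sin x"
  proof -
    have "sin x \<ge> 0" using x s by (intro sin_ge_zero) (auto simp: x_def)
    then show ?thesis by (auto simp: x_def abs_if split: if_splits)
  qed
  ultimately have 1: "\<bar>s\<bar> / 2 \<le> norm (cis s - 1)" by (simp add: x_def)
  have "norm (cis s - 1) \<le> norm (cis s - of_real r) + norm (of_real r - 1 :: complex)"
    using norm_triangle_ineq[of "cis s - of_real r" "of_real r - 1"] by simp
  moreover have "norm (of_real r - 1 :: complex) = 1 - r"
    using r by (metis abs_minus_commute abs_of_nonneg diff_ge_0_iff_ge norm_of_real of_real_1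
        of_real_diff)
  moreover have "1 - r \<le> norm (cis s - of_real r)"
    using norm_triangle_ineq2[of "cis s" "of_real r"] r by simp
  ultimately show ?thesis using 1 by linarith
qed

text \<open>Dominating the kernel by indicators of intervals of dyadic radius lets interval averages
  control Poisson integrals. With d = 1 - r, beyond radius 2^(k-1) d the distance |cis s - r| is at
  least 2^k d / 8, and 2 d / (2^k d / 8)^2 = 128 / (4^k d).\<close>

lemma poisson_dyadic_bound:
  assumes r: "0 \<le> r" "r < 1" and s: "\<bar>s\<bar> \<le> pi" and K: "pi \<le> 2 ^ K * (1 - r)"
  shows "poisson (of_real r) (cis s) \<le>
    (\<Sum>k\<le>K. 128 / (4 ^ k * (1 - r)) * indicator {- (2 ^ k * (1 - r))..2 ^ k * (1 - r)} s)"
proof -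
  define d where "d = 1 - r"
  have d: "0 < d" "d \<le> 1" using r by (auto simp: d_def)
  let ?S = "\<Sum>k\<le>K. 128 / (4 ^ k * d) * indicator {- (2 ^ k * d)..2 ^ k * d} s"
  \<comment> \<open>The smallest of the intervals that contains \<open>s\<close>: its summand alone
    dominates the kernel, and the others are nonnegative.\<close>
  define k where "k = (LEAST k. \<bar>s\<bar> \<le> 2 ^ k * d)"
  have ex: "\<bar>s\<bar> \<le> 2 ^ K * d" using s K by (simp add: d_def)
  have k: "\<bar>s\<bar> \<le> 2 ^ k * d" "k \<le> K"
    unfolding k_def using ex by (rule LeastI, rule Least_le)
  have num: "1 - (norm (complex_of_real r))\<^sup>2 \<le> 2 * d"
  proof -
    have "1 - r\<^sup>2 = (1 + r) * d" by (simp add: d_def algebra_simps power2_eq_square)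
    also have "\<dots> \<le> 2 * d" using r d by (intro mult_right_mono) auto
    finally show ?thesis by simp
  qed
  have n1: "d \<le> norm (cis s - of_real r)"
    using norm_triangle_ineq2[of "cis s" "of_real r"] r by (simp add: d_def)
  have n2: "\<bar>s\<bar> / 4 \<le> norm (cis s - of_real r)"
    using norm_cis_minus_of_real_ge[of r s] r s by simp
  have "poisson (of_real r) (cis s) \<le> 128 / (4 ^ k * d)"
  proof (cases "k = 0")
    case True
    have "poisson (of_real r) (cis s) \<le> (2 * d) / d\<^sup>2"
      unfolding poisson_def using num n1 d by (intro frac_le power_mono) auto
    also have "\<dots> \<le> 128 / d" using d by (simp add: power2_eq_square field_simps)
    finally show ?thesis using True by simp
  next
    case False
    then have "\<not> \<bar>s\<bar> \<le> 2 ^ (k - 1) * d"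
      unfolding k_def using not_less_Least[of "k - 1" "\<lambda>k. \<bar>s\<bar> \<le> 2 ^ k * d"] by (simp add: k_def)
    then have "2 ^ (k - 1) * d / 4 \<le> norm (cis s - of_real r)" using n2 by linarith
    moreover have "(2::real) ^ k = 2 * 2 ^ (k - 1)" using False by (metis power_eq_if)
    then have "2 ^ k * d / 8 = 2 ^ (k - 1) * d / 4" by simp
    ultimately have n3: "2 ^ k * d / 8 \<le> norm (cis s - of_real r)" by linarith
    have "poisson (of_real r) (cis s) \<le> (2 * d) / (2 ^ k * d / 8)\<^sup>2"
      unfolding poisson_def using num n3 d by (intro frac_le power_mono) auto
    also have "\<dots> = 128 / ((2 ^ k)\<^sup>2 * d)" using d by (simp add: power2_eq_square field_simps)
    also have "((2::real) ^ k)\<^sup>2 = 4 ^ k" by (simp add: power2_eq_square flip: power_mult_distrib)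
    finally show ?thesis .
  qed
  also have "\<dots> = (\<Sum>j\<in>{k}. 128 / (4 ^ j * d) * indicator {- (2 ^ j * d)..2 ^ j * d} s)"
    using k by (auto simp: indicator_def abs_le_iff)
  also have "\<dots> \<le> ?S"
    using k d by (intro sum_mono2) auto
  finally show ?thesis by (simp add: d_def)
qed

lemma nn_integral_lborel_shift:
  fixes c :: real
  assumes [measurable]: "f \<in> borel_measurable borel"
  shows "(\<integral>\<^sup>+t. f (c + t) \<partial>lborel) = (\<integral>\<^sup>+t. f t \<partial>lborel)"
  using nn_integral_real_affine[of f 1 c] by simp

text \<open>Intervals of radius at most 2 pi centred at angles in [0, 2 pi] reach into
  [-2 pi, 4 pi], which is three periods. This is the factor 3 inside the constant of
  \<open>maximal_weak_type\<close>.\<close>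

lemma nn_integral_period_le:
  fixes g :: "complex \<Rightarrow> ennreal"
  assumes [measurable]: "g \<in> borel_measurable borel"
  shows "(\<integral>\<^sup>+t. g (cis t) * indicator {-2*pi..4*pi} t \<partial>lborel) \<le> 3 * (\<integral>\<^sup>+t. g (cis t) * indicator
      {0..2*pi} t \<partial>lborel)"
proof -
  let ?h = "\<lambda>t. g (cis t) * indicator {0..2*pi} t"
  have "(\<integral>\<^sup>+t. g (cis t) * indicator {-2*pi..4*pi} t \<partial>lborel) \<le> (\<integral>\<^sup>+t. (?h t + ?h (2*pi + t)) +
      ?h (-2*pi + t) \<partial>lborel)"
  proof (rule nn_integral_mono)
    fix t :: real
    have "cis (2*pi + t) = cis t" "cis (-2*pi + t) = cis t"
      by (simp_all add: cis_mult[symmetric] cis_divide[symmetric])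
    then show "g (cis t) * indicator {-2*pi..4*pi} t \<le> (?h t + ?h (2*pi + t)) + ?h (-2*pi + t)"
      by (auto simp: indicator_def add_increasing add_increasing2)
  qed
  also have "\<dots> = (\<integral>\<^sup>+t. ?h t \<partial>lborel) + (\<integral>\<^sup>+t. ?h (2*pi + t) \<partial>lborel) + (\<integral>\<^sup>+t. ?h (-2*pi +
      t) \<partial>lborel)"
    by (simp add: nn_integral_add)
  also have "(\<integral>\<^sup>+t. ?h (2*pi + t) \<partial>lborel) = (\<integral>\<^sup>+t. ?h t \<partial>lborel)"
    by (rule nn_integral_lborel_shift[of ?h]) measurable
  also have "(\<integral>\<^sup>+t. ?h (-2*pi + t) \<partial>lborel) = (\<integral>\<^sup>+t. ?h t \<partial>lborel)"
    by (rule nn_integral_lborel_shift[of ?h]) measurable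
  also have "(\<integral>\<^sup>+t. ?h t \<partial>lborel) + (\<integral>\<^sup>+t. ?h t \<partial>lborel) + (\<integral>\<^sup>+t. ?h t \<partial>lborel) =
      (1 + 1 + 1) * (\<integral>\<^sup>+t. ?h t \<partial>lborel)"
    by (simp only: distrib_right mult_1)
  also have "(1 + 1 + 1 :: ennreal) = 3" by simp
  finally show ?thesis .
qed

text \<open>The measure is set up on [0, 2 pi] while the kernel estimates need angles in [-pi, pi].
  Two translates of the latter cover the former; the crude factor 2 is absorbed later by pi >=
  2.\<close>

lemma nn_integral_half_period_le:
  fixes g :: "complex \<Rightarrow> ennreal"
  assumes [measurable]: "g \<in> borel_measurable borel"
  shows "(\<integral>\<^sup>+t. g (cis t) * indicator {0..2*pi} t \<partial>lborel) \<le> 2 * (\<integral>\<^sup>+t. g (cis t) * indicator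
      {-pi..pi} t \<partial>lborel)"
proof -
  let ?h = "\<lambda>t. g (cis t) * indicator {-pi..pi} t"
  have "(\<integral>\<^sup>+t. g (cis t) * indicator {0..2*pi} t \<partial>lborel) \<le> (\<integral>\<^sup>+t. ?h t + ?h (-2*pi + t) \<partial>lborel)"
  proof (rule nn_integral_mono)
    fix t :: real
    have "cis (-2*pi + t) = cis t"
      by (simp_all add: cis_mult[symmetric] cis_divide[symmetric])
    then show "g (cis t) * indicator {0..2*pi} t \<le> ?h t + ?h (-2*pi + t)"
      by (auto simp: indicator_def add_increasing add_increasing2)
  qed
  also have "\<dots> = (\<integral>\<^sup>+t. ?h t \<partial>lborel) + (\<integral>\<^sup>+t. ?h (-2*pi + t) \<partial>lborel)"
    by (simp add: nn_integral_add)
  also have "(\<integral>\<^sup>+t. ?h (-2*pi + t) \<partial>lborel) = (\<integral>\<^sup>+t. ?h t \<partial>lborel)"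
    by (rule nn_integral_lborel_shift[of ?h]) measurable
  also have "(\<integral>\<^sup>+t. ?h t \<partial>lborel) + (\<integral>\<^sup>+t. ?h t \<partial>lborel) = (1 + 1) * (\<integral>\<^sup>+t. ?h t \<partial>lborel)"
    by (simp only: distrib_right mult_1)
  also have "(1 + 1 :: ennreal) = 2" by simp
  finally show ?thesis .
qed

lemma norm_dilate_le_poisson:
  assumes f: "disk_map f" and R: "0 \<le> R" "R < 1" and z: "norm z < 1"
  shows "ennreal (norm (f (of_real R * z))) \<le> (\<integral>\<^sup>+\<zeta>. ennreal (norm (f (of_real R * \<zeta>)) * poisson z
      \<zeta>) \<partial>cm)"
proof -
  note [measurable] = disk_map_borel[OF f]
  obtain B where B: "\<And>z. norm z \<le> R \<Longrightarrow> norm (f z) \<le> B"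
    using disk_map_bounded_dilate[OF disk_mapD[OF f] R] by blast
  have "0 \<le> B" using R by (intro order_trans[OF norm_ge_zero B[of 0]]) simp
  have "ennreal (norm (LINT \<zeta>|cm. f (of_real R * \<zeta>) * of_real (poisson z \<zeta>))) \<le>
     (\<integral>\<^sup>+\<zeta>. ennreal (norm (f (of_real R * \<zeta>) * of_real (poisson z \<zeta>))) \<partial>cm)"
  proof (rule integral_norm_bound_ennreal, rule integrable_cm_bounded)
    fix \<zeta> :: complex assume "norm \<zeta> = 1"
    then show "norm (f (of_real R * \<zeta>) * of_real (poisson z \<zeta>)) \<le> B * (1 / (1 - norm z)\<^sup>2)"
      unfolding norm_mult using R \<open>0 \<le> B\<close> poisson_le[OF z, of \<zeta>] poisson_nonneg[OF z, of \<zeta>]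
      by (intro mult_mono B) (auto simp: norm_mult)
  qed measurable
  then show ?thesis
    using poisson_nonneg[OF z] by (simp add: poisson_formula[OF f R z] norm_mult abs_of_nonneg)
qed

lemma borel_measurable_dilate:
  "disk_map f \<Longrightarrow> (\<lambda>\<zeta>. f (c * \<zeta>)) \<in> borel_measurable borel"
  by (rule measurable_compose[OF _ disk_map_borel]) measurable

lemma disk_map_scale:
  assumes "disk_map f" "norm c \<le> 1"
  shows "disk_map (\<lambda>z. f (c * z))"
  unfolding disk_map_def
proof
  show "(\<lambda>z. f (c * z)) holomorphic_on ball 0 1"
  proof (rule holomorphic_on_compose_gen[of "\<lambda>z. c * z" "ball 0 1" f "ball 0 1", unfolded o_def])
    have "norm c * norm z < 1" if "norm z < 1" for z :: complex
      using mult_left_le_one_le[of "norm z" "norm c"] assms(2) that by simp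
    then show "(\<lambda>z. c * z) ` ball 0 1 \<subseteq> ball 0 1" by (auto simp: norm_mult)
  qed (auto intro!: holomorphic_intros disk_mapD assms)
  show "(\<lambda>z. f (c * z)) \<in> borel_measurable borel"
    by (rule borel_measurable_dilate[OF assms(1)])
qed

text \<open>After rotation to angle 0 the dyadic bound turns the Poisson integral into interval
  averages, the k-th contributing at most 128 A / 2^k. They add up to 256 A, the change of period
  doubles this, and division by 2 pi with pi >= 2 leaves 128 A.\<close>

lemma norm_le_averages:
  assumes f: "disk_map f" and R: "0 \<le> R" "R < 1" and r: "0 \<le> r" "r < 1" and A: "0 \<le> A"
    and avg: "\<And>\<rho>. 0 < \<rho> \<Longrightarrow> \<rho> \<le> 2 * pi \<Longrightarrow>
      (\<integral>\<^sup>+t. ennreal (norm (f (of_real R * cis t))) * indicator {\<theta> - \<rho>..\<theta> + \<rho>} t \<partial>lborel) \<le>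
          ennreal (A * \<rho>)"
  shows "norm (f (of_real R * (of_real r * cis \<theta>))) \<le> 128 * A"
proof -
  note [measurable] = disk_map_borel[OF f]
  define d where "d = 1 - r"
  have d: "0 < d" "d \<le> 1" using r by (auto simp: d_def)
  \<comment> \<open>The least \<open>K\<close> with pi <= 2^K d. Minimality also gives 2^K d <= 2
    pi, so all radii in use lie in the range covered by \<open>avg\<close>.\<close>
  obtain K where K: "pi \<le> 2 ^ K * d" "2 ^ K * d \<le> 2 * pi"
  proof -
    define K where "K = (LEAST K. pi \<le> 2 ^ K * d)"
    obtain n where "pi / d < 2 ^ n" using real_arch_pow[of 2 "pi / d"] by auto
    then have "pi \<le> 2 ^ n * d" using d by (simp add: field_simps)
    then have 1: "pi \<le> 2 ^ K * d" unfolding K_def by (rule LeastI)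
    have "K \<noteq> 0" using 1 d pi_gt3 by (intro notI) simp
    then have "\<not> pi \<le> 2 ^ (K - 1) * d"
      unfolding K_def by (intro not_less_Least) (simp add: K_def)
    moreover have "(2::real) ^ K = 2 * 2 ^ (K - 1)" using \<open>K \<noteq> 0\<close> by (metis power_eq_if)
    ultimately show thesis using 1 by (intro that[of K]) simp_all
  qed
  let ?g = "\<lambda>t. ennreal (norm (f (of_real R * cis t)))"
  let ?w = "\<lambda>k. 128 / (4 ^ k * d)"
  let ?I = "\<lambda>k t. indicator {- (2 ^ k * d)..2 ^ k * d} t"
  have "ennreal (norm (f (cis \<theta> * (of_real R * of_real r)))) \<le>
     (\<integral>\<^sup>+\<zeta>. ennreal (norm (f (cis \<theta> * (of_real R * \<zeta>))) * poisson (of_real r) \<zeta>) \<partial>cm)"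
    using norm_dilate_le_poisson[OF disk_map_scale[OF f, of "cis \<theta>"] R, of "of_real r"] r by simp
  also have "\<dots> = (\<integral>\<^sup>+t. ennreal (norm (f (cis \<theta> * (of_real R * cis t))) * poisson (of_real r) (cis
      t)) * indicator {0..2*pi} t \<partial>lborel) / ennreal (2 * pi)"
    by (rule nn_integral_cm) measurable
  also have "\<dots> \<le> (2 * (\<integral>\<^sup>+t. ennreal (norm (f (cis \<theta> * (of_real R * cis t))) * poisson (of_real r)
      (cis t)) * indicator {-pi..pi} t \<partial>lborel)) / ennreal (2 * pi)"
    by (intro divide_right_mono_ennreal nn_integral_half_period_le[of "\<lambda>\<zeta>. ennreal (norm (f (cis \<theta>
        * (of_real R * \<zeta>))) * poisson (of_real r) \<zeta>)"]) measurable
  also have "(\<integral>\<^sup>+t. ennreal (norm (f (cis \<theta> * (of_real R * cis t))) * poisson (of_real r) (cis t))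
      * indicator {-pi..pi} t \<partial>lborel)
    \<le> (\<integral>\<^sup>+t. (\<Sum>k\<le>K. ennreal (?w k) * (?g (\<theta> + t) * ?I k t)) \<partial>lborel)"
  proof (rule nn_integral_mono)
    fix t :: real
    have e: "cis \<theta> * (of_real R * cis t) = of_real R * cis (\<theta> + t)"
      by (simp flip: cis_mult add: mult_ac)
    have "(\<Sum>k\<le>K. ennreal (?w k) * (?g (\<theta> + t) * ?I k t)) =
        (\<Sum>k\<le>K. ennreal (norm (f (of_real R * cis (\<theta> + t))) * (?w k * ?I k t)))"
      using d by (intro sum.cong) (auto simp: indicator_def mult.commute simp flip: ennreal_mult)
    also have "\<dots> = ennreal (norm (f (of_real R * cis (\<theta> + t))) * (\<Sum>k\<le>K. ?w k * ?I k t))"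
      using d by (subst sum_ennreal) (auto simp: sum_distrib_left)
    finally have eq: "(\<Sum>k\<le>K. ennreal (?w k) * (?g (\<theta> + t) * ?I k t)) = \<dots>" .
    show "ennreal (norm (f (cis \<theta> * (of_real R * cis t))) * poisson (of_real r) (cis t)) *
        indicator {-pi..pi} t
        \<le> (\<Sum>k\<le>K. ennreal (?w k) * (?g (\<theta> + t) * ?I k t))"
    proof (cases "t \<in> {-pi..pi}")
      case True
      then have "poisson (of_real r) (cis t) \<le> (\<Sum>k\<le>K. ?w k * ?I k t)"
        using poisson_dyadic_bound[OF r, of t K] K(1) by (simp add: d_def abs_le_iff)
      then show ?thesis unfolding eq e using True
        by (auto intro!: ennreal_leI mult_left_mono)
    qed simp
  qed
  also have "\<dots> = (\<Sum>k\<le>K. ennreal (?w k) * (\<integral>\<^sup>+t. ?g (\<theta> + t) * ?I k t \<partial>lborel))"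
    by (simp add: nn_integral_sum nn_integral_cmult)
  also have "\<dots> \<le> (\<Sum>k\<le>K. ennreal (128 * A * (1/2) ^ k))"
  proof (rule sum_mono)
    fix k assume "k \<in> {..K}"
    then have "(2::real) ^ k \<le> 2 ^ K" by (intro power_increasing) auto
    then have "2 ^ k * d \<le> 2 ^ K * d" using d by (intro mult_right_mono) auto
    from order_trans[OF this K(2)] have k: "2 ^ k * d \<le> 2 * pi" "0 < 2 ^ k * d" using d by auto
    have "(\<integral>\<^sup>+t. ?g (\<theta> + t) * ?I k t \<partial>lborel) =
       (\<integral>\<^sup>+t. ?g (\<theta> + t) * indicator {\<theta> - 2 ^ k * d..\<theta> + 2 ^ k * d} (\<theta> + t) \<partial>lborel)"
      by (intro nn_integral_cong) (auto simp: indicator_def)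
    also have "\<dots> = (\<integral>\<^sup>+t. ?g t * indicator {\<theta> - 2 ^ k * d..\<theta> + 2 ^ k * d} t \<partial>lborel)"
      by (rule nn_integral_lborel_shift[of "\<lambda>t. ?g t * indicator {\<theta> - 2 ^ k * d..\<theta> + 2 ^ k * d}
          t"]) measurable
    also have "\<dots> \<le> ennreal (A * (2 ^ k * d))" by (rule avg) (use k in auto)
    finally have "ennreal (?w k) * (\<integral>\<^sup>+t. ?g (\<theta> + t) * ?I k t \<partial>lborel) \<le>
        ennreal (?w k) * ennreal (A * (2 ^ k * d))"
      by (rule mult_left_mono) simp
    also have "\<dots> = ennreal (?w k * (A * (2 ^ k * d)))"
      using d A by (simp flip: ennreal_mult)
    also have "?w k * (A * (2 ^ k * d)) = 128 * A * (1/2) ^ k"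
    proof -
      have "(4::real) ^ k = 2 ^ k * 2 ^ k" by (simp flip: power_mult_distrib)
      then show ?thesis using d by (simp add: field_simps)
    qed
    finally show "ennreal (?w k) * (\<integral>\<^sup>+t. ?g (\<theta> + t) * ?I k t \<partial>lborel) \<le>
        ennreal (128 * A * (1/2) ^ k)" .
  qed
  also have "\<dots> = ennreal (\<Sum>k\<le>K. 128 * A * (1/2) ^ k)"
    using A by (intro sum_ennreal) auto
  also have "\<dots> \<le> ennreal (256 * A)"
  proof (rule ennreal_leI)
    have "(\<Sum>k\<le>K. (1/2::real) ^ k) = 2 - (1/2) ^ K"
      by (induction K) auto
    then have "(\<Sum>k\<le>K. (1/2::real) ^ k) \<le> 2" by simp
    then have "128 * A * (\<Sum>k\<le>K. (1/2::real) ^ k) \<le> 128 * A * 2"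
      using A by (intro mult_left_mono) auto
    then show "(\<Sum>k\<le>K. 128 * A * (1/2::real) ^ k) \<le> 256 * A"
      by (simp only: sum_distrib_left)
  qed
  also have "2 * ennreal (256 * A) / ennreal (2 * pi) = ennreal (2 * (256 * A) / (2 * pi))"
    using A by (simp add: divide_ennreal ennreal_mult[symmetric] flip: ennreal_numeral)
  also have "\<dots> \<le> ennreal (128 * A)"
    using A pi_ge_two mult_left_mono[of 2 pi "128 * A"]
      by (intro ennreal_leI) (simp add: field_simps)
  finally have "ennreal (norm (f (cis \<theta> * (of_real R * of_real r)))) \<le> ennreal (128 * A)"
    by (simp add: divide_right_mono_ennreal mult_left_mono)
  then show ?thesis using A by (simp add: mult_ac)
qed

text \<open>
  Where the radial maximal function is large, some interval around the point has a large average,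
  and Vitali's covering lemma selects a disjoint family of such intervals.
\<close>

lemma maximal_weak_type:
  fixes f :: "complex \<Rightarrow> complex" and R \<kappa> :: real
  assumes f: "disk_map f" and R: "0 \<le> R" "R < 1" and \<kappa>: "0 < \<kappa>"
  defines "S \<equiv> {\<zeta> \<in> sphere 0 1. \<exists>r\<in>{0..<1}. \<kappa> < norm (f (of_real R * (of_real r * \<zeta>)))}"
  shows "S \<in> sets borel"
    and "emeasure cm S \<le> ennreal (7680 / \<kappa>) * (\<integral>\<^sup>+\<zeta>. ennreal (norm (f (of_real R * \<zeta>))) \<partial>cm)"
proof -
  note [measurable] = disk_map_borel[OF f]
  \<comment> \<open>The union over \<open>r\<close> is uncountable but consists of relatively open
    sets; this is how \<open>S\<close> is seen to be Borel.\<close>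
  have "openin (top_of_set (sphere 0 1)) (\<Union>r\<in>{0..<1::real}. {\<zeta> \<in> sphere 0 1. norm (f (of_real R *
      (of_real r * \<zeta>))) \<in> {\<kappa><..}})"
  proof (intro openin_Union ballI, elim imageE, hypsubst)
    fix r :: real assume r: "r \<in> {0..<1}"
    have "continuous_on (sphere 0 1) (\<lambda>\<zeta>. f (of_real R * (of_real r * \<zeta>)))"
    proof (rule continuous_on_compose2[OF holomorphic_on_imp_continuous_on[OF disk_mapD[OF f]]])
      have "R * r < 1" using R r by (smt (verit, best) atLeastLessThan_iff mult_left_le)
      then show "(\<lambda>\<zeta>. of_real R * (of_real r * \<zeta>)) ` sphere 0 (1::real) \<subseteq> ball (0::complex) 1"
        using R r by (auto simp: norm_mult)
    qed (intro continuous_intros)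
    then show "openin (top_of_set (sphere 0 1)) {\<zeta> \<in> sphere 0 1. norm (f (of_real R * (of_real r *
        \<zeta>))) \<in> {\<kappa><..}}"
      by (intro continuous_openin_preimage_gen[unfolded vimage_def Int_def, simplified]
          continuous_on_norm open_greaterThan)
  qed
  then have "openin (top_of_set (sphere 0 1)) S"
    by (rule back_subst[of "openin _"]) (auto simp: S_def)
  then obtain T where "open T" "S = sphere 0 1 \<inter> T" by (auto simp: openin_open)
  then show S [measurable]: "S \<in> sets borel" by auto
  \<comment> \<open>If all averages were at most \<open>A\<close>, \<open>norm_le_averages\<close>
    would bound the values by 128 A = \<kappa> / 2. So every angle in \<open>E\<close> has an
    interval with a larger average.\<close>
  define A where "A = \<kappa> / 256"
  have A: "0 < A" using \<kappa> by (simp add: A_def)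
  define g where "g = (\<lambda>t. ennreal (norm (f (of_real R * cis t))))"
  have [measurable]: "g \<in> borel_measurable borel" unfolding g_def by measurable
  define E where "E = {0..2*pi} \<inter> cis -` S"
  have [measurable]: "E \<in> sets borel"
    using measurable_sets_borel[OF cis_borel S] by (auto simp: E_def)
  have "\<exists>\<rho>. 0 < \<rho> \<and> \<rho> \<le> 2 * pi \<and> ennreal (A * \<rho>) < (\<integral>\<^sup>+t. g t * indicator {\<theta> - \<rho>..\<theta> + \<rho>} t \<partial>lborel)"
    if "\<theta> \<in> E" for \<theta>
  proof (rule ccontr)
    assume *: "\<not> ?thesis"
    from that have "cis \<theta> \<in> S" by (simp add: E_def)
    then obtain r where r: "r \<in> {0..<1}" "\<kappa> < norm (f (of_real R * (of_real r * cis \<theta>)))"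
      unfolding S_def by blast
    have "norm (f (of_real R * (of_real r * cis \<theta>))) \<le> 128 * A"
      by (rule norm_le_averages[OF f R]) (use r A * in \<open>auto simp: g_def not_less\<close>)
    with r \<kappa> show False by (simp add: A_def)
  qed
  then obtain \<rho> where \<rho>: "\<And>\<theta>. \<theta> \<in> E \<Longrightarrow> 0 < \<rho> \<theta> \<and> \<rho> \<theta> \<le> 2 * pi \<and>
      ennreal (A * \<rho> \<theta>) < (\<integral>\<^sup>+t. g t * indicator {\<theta> - \<rho> \<theta>..\<theta> + \<rho> \<theta>} t \<partial>lborel)"
    by metis
  have cover: "E \<subseteq> (\<Union>i\<in>E. cball (id i) (\<rho> i))"
    using \<rho> by (force simp: less_imp_le)
  obtain C where C: "countable C" "C \<subseteq> E"
      "pairwise (\<lambda>i j. disjnt (cball (id i) (\<rho> i)) (cball (id j) (\<rho> j))) C"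
      "E \<subseteq> (\<Union>i\<in>C. cball (id i) (5 * \<rho> i))"
    by (rule Vitali_covering_lemma_cballs[OF cover, of "2 * pi"]) (use \<rho> in auto)
  \<comment> \<open>The countable set \<open>C\<close> may be finite. It is numbered by the indices
    in \<open>N\<close>, and the remaining indices get the empty set, as countable subadditivity
    over all of \<open>nat\<close> wants it.\<close>
  define e where "e = from_nat_into C"
  define N where "N = to_nat_on C ` C"
  have e: "e n \<in> C" if "n \<in> N" for n
    using that C(1) by (auto simp: e_def N_def)
  have e_inj: "e m \<noteq> e n" if "m \<in> N" "n \<in> N" "m \<noteq> n" for m n
    using that C(1) by (auto simp: e_def N_def)
  define P where "P n = (if n \<in> N then cball (e n) (5 * \<rho> (e n)) else {})" for n
  define D where "D n = (if n \<in> N then cball (e n) (\<rho> (e n)) else {})" for n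
  have [measurable]: "P n \<in> sets borel" "D n \<in> sets borel" for n
    by (auto simp: P_def D_def)
  have "disjoint_family D"
    unfolding disjoint_family_on_def
  proof (intro ballI impI)
    fix m n :: nat assume "m \<noteq> n"
    then show "D m \<inter> D n = {}"
      using C(3) e e_inj unfolding D_def pairwise_def disjnt_def
        by (cases "m \<in> N"; cases "n \<in> N") auto
  qed
  have "E \<subseteq> (\<Union>n. P n)"
  proof
    fix t assume "t \<in> E"
    then obtain i where "i \<in> C" "t \<in> cball i (5 * \<rho> i)" using C(4) by auto
    then have "t \<in> P (to_nat_on C i)" using C(1) by (auto simp: P_def N_def e_def)
    then show "t \<in> (\<Union>n. P n)" by blast
  qed
  then have "emeasure lborel E \<le> emeasure lborel (\<Union>n. P n)"
    by (intro emeasure_mono) auto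
  also have "\<dots> \<le> (\<Sum>n. emeasure lborel (P n))"
    by (rule emeasure_subadditive_countably) auto
  \<comment> \<open>The enlarged interval has length 10 \<rho>, while the integral over the original
    one exceeds A \<rho>. With A = \<kappa> / 256 and three periods the constant becomes 3 times 10
    times 256, that is 7680.\<close>
  also have "\<dots> \<le> (\<Sum>n. ennreal (10 / A) * (\<integral>\<^sup>+t. g t * indicator (D n) t \<partial>lborel))"
  proof (rule suminf_le)
    fix n
    show "emeasure lborel (P n) \<le> ennreal (10 / A) * (\<integral>\<^sup>+t. g t * indicator (D n) t \<partial>lborel)"
    proof (cases "n \<in> N")
      case True
      then have "e n \<in> E" using e C(2) by auto
      note \<rho> = \<rho>[OF this]
      have "emeasure lborel (P n) = ennreal (10 / A * (A * \<rho> (e n)))"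
        using True \<rho> A by (simp add: P_def cball_eq_atLeastAtMost)
      also have "\<dots> = ennreal (10 / A) * ennreal (A * \<rho> (e n))"
        using \<rho> A by (intro ennreal_mult) auto
      also have "\<dots> \<le> ennreal (10 / A) * (\<integral>\<^sup>+t. g t * indicator (D n) t \<partial>lborel)"
        using True \<rho> by (intro mult_left_mono) (auto simp: D_def cball_eq_atLeastAtMost)
      finally show ?thesis .
    qed (simp add: P_def)
  qed auto
  also have "\<dots> = ennreal (10 / A) * (\<integral>\<^sup>+t. (\<Sum>n. g t * indicator (D n) t) \<partial>lborel)"
    by (subst nn_integral_suminf) (auto simp: ennreal_suminf_cmult)
  also have "(\<integral>\<^sup>+t. (\<Sum>n. g t * indicator (D n) t) \<partial>lborel) = (\<integral>\<^sup>+t. g t * indicator (\<Union>n. D n) t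
      \<partial>lborel)"
    using suminf_indicator[OF \<open>disjoint_family D\<close>] by (simp add: ennreal_suminf_cmult)
  also have "\<dots> \<le> (\<integral>\<^sup>+t. g t * indicator {-2*pi..4*pi} t \<partial>lborel)"
  proof (intro nn_integral_mono mult_left_mono)
    have "D n \<subseteq> {-2*pi..4*pi}" for n
    proof (cases "n \<in> N")
      case True
      then have "e n \<in> E" using e C(2) by auto
      with \<rho>[OF this] True show ?thesis
        by (auto simp: D_def E_def cball_eq_atLeastAtMost)
    qed (simp add: D_def)
    then have *: "(\<Union>n. D n) \<subseteq> {-2*pi..4*pi}" by blast
    show "indicator (\<Union>n. D n) t \<le> (indicator {-2*pi..4*pi} t :: ennreal)" for t
    proof (cases "t \<in> (\<Union>n. D n)")
      case True
      from subsetD[OF * this] show ?thesis by (simp add: indicator_def)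
    qed (simp add: indicator_def)
  qed simp
  also have "\<dots> \<le> 3 * (\<integral>\<^sup>+t. g t * indicator {0..2*pi} t \<partial>lborel)"
    unfolding g_def by (rule nn_integral_period_le[of "\<lambda>\<zeta>. ennreal (norm (f (of_real R * \<zeta>)))"])
        measurable
  finally have E: "emeasure lborel E \<le> ennreal (10 / A) * (3 * (\<integral>\<^sup>+t. g t * indicator {0..2*pi} t
      \<partial>lborel))"
    by (simp add: mult_left_mono)
  have "emeasure cm S = (\<integral>\<^sup>+\<zeta>. indicator S \<zeta> \<partial>cm)" by simp
  also have "\<dots> = (\<integral>\<^sup>+t. indicator S (cis t) * indicator {0..2*pi} t \<partial>lborel) / ennreal (2*pi)"
    by (rule nn_integral_cm) measurable
  also have "(\<integral>\<^sup>+t. indicator S (cis t) * indicator {0..2*pi} t \<partial>lborel) =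
      (\<integral>\<^sup>+t. indicator E t \<partial>lborel)"
    by (intro nn_integral_cong) (auto simp: E_def indicator_def)
  also have "\<dots> = emeasure lborel E" by simp
  also have "\<dots> / ennreal (2*pi) \<le> ennreal (10 / A) * (3 * (\<integral>\<^sup>+t. g t * indicator {0..2*pi} t
      \<partial>lborel)) / ennreal (2*pi)"
    by (intro divide_right_mono_ennreal E)
  also have "\<dots> = ennreal (10 / A) * 3 * ((\<integral>\<^sup>+t. g t * indicator {0..2*pi} t \<partial>lborel) / ennreal
      (2*pi))"
    by (simp add: ennreal_times_divide mult.assoc)
  also have "(\<integral>\<^sup>+t. g t * indicator {0..2*pi} t \<partial>lborel) / ennreal (2*pi) =
      (\<integral>\<^sup>+\<zeta>. ennreal (norm (f (of_real R * \<zeta>))) \<partial>cm)"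
    unfolding g_def by (rule nn_integral_cm[symmetric]) measurable
  also have "ennreal (10 / A) * 3 = ennreal (7680 / \<kappa>)"
    using \<kappa> by (simp add: A_def flip: ennreal_mult ennreal_numeral)
  finally show "emeasure cm S \<le> ennreal (7680 / \<kappa>) * (\<integral>\<^sup>+\<zeta>. ennreal (norm (f (of_real R * \<zeta>)))
      \<partial>cm)" .
qed

section \<open>Dilates form a Cauchy family in mean\<close>

text \<open>The Japanese bracket, the square root of 1 + |w|^2, written as a norm on a product space
  so that the triangle inequality and the norm bound for vector-valued integrals apply to it
  directly.\<close>

definition jap :: "complex \<Rightarrow> real" where
  "jap w = norm (1::real, w)"

lemma jap_borel [measurable]: "jap \<in> borel_measurable borel"
  unfolding jap_def by measurable

lemma jap_ge_1: "1 \<le> jap w" and jap_ge_norm: "norm w \<le> jap w" and jap_le: "jap w \<le> 1 + norm w"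
  using norm_fst_le[of "1::real" w] norm_snd_le[of w "1::real"] norm_Pair_le[of "1::real" w]
  by (auto simp: jap_def)

lemma jap_nonneg: "0 \<le> jap w"
  by (simp add: jap_def)

lemma jap_diff_le: "jap v - jap w \<le> norm (v - w)"
  using norm_triangle_ineq2[of "(1::real, v)" "(1, w)"] by (simp add: jap_def norm_Pair)

text \<open>Put x = (1, a), y = (1, b) and D = |x| |y| - <x, y>. Expanding and Cauchy-Schwarz give
  |a - b|^2 <= |x|^2 |y|^2 - <x, y>^2 <= 2 D |x| |y|, and 2 D = (|x| + |y|)^2 - |x + y|^2 is at most
  twice |x| + |y| times the defect |x| + |y| - |x + y|.\<close>

lemma jap_uniformly_convex:
  "(norm (a - b))\<^sup>2 / (2 * jap a * jap b * (jap a + jap b)) \<le> jap a + jap b - 2 * jap ((a + b) / 2)"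
proof -
  define x y where "x = (1::real, a)" and "y = (1::real, b)"
  have jx: "jap a = norm x" and jy: "jap b = norm y" by (simp_all add: jap_def x_def y_def)
  have pos: "0 < norm x" "0 < norm y"
    using jap_ge_1[of a] jap_ge_1[of b] unfolding jx jy by linarith+
  have "2 * jap ((a + b) / 2) = norm (2 *\<^sub>R (1::real, (a + b) / 2))"
    by (simp only: jap_def norm_scaleR)
  also have "2 *\<^sub>R (1::real, (a + b) / 2) = x + y"
    by (simp add: x_def y_def scaleR_conv_of_real)
  finally have j2: "2 * jap ((a + b) / 2) = norm (x + y)" .
  define D where "D = norm x * norm y - x \<bullet> y"
  have D0: "0 \<le> D" using norm_cauchy_schwarz[of x y] by (simp add: D_def)
  have "(norm (a - b))\<^sup>2 \<le> (norm x)\<^sup>2 * (norm y)\<^sup>2 - (x \<bullet> y)\<^sup>2"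
  proof -
    have "(norm x)\<^sup>2 = 1 + a \<bullet> a" "(norm y)\<^sup>2 = 1 + b \<bullet> b" "x \<bullet> y = 1 + a \<bullet> b"
      by (simp_all add: x_def y_def power2_norm_eq_inner)
    moreover have "(norm (a - b))\<^sup>2 = a \<bullet> a + b \<bullet> b - 2 * (a \<bullet> b)"
      by (simp add: power2_norm_eq_inner inner_diff_left inner_diff_right inner_commute)
    moreover have "(a \<bullet> b)\<^sup>2 \<le> (a \<bullet> a) * (b \<bullet> b)"
      by (rule Cauchy_Schwarz_ineq)
    ultimately show ?thesis by (simp add: algebra_simps power2_eq_square)
  qed
  also have "\<dots> = D * (norm x * norm y + x \<bullet> y)"
    by (simp add: D_def algebra_simps power2_eq_square)
  also have "\<dots> \<le> D * (2 * (norm x * norm y))"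
    using D0 norm_cauchy_schwarz[of x y] by (intro mult_left_mono) auto
  finally have 1: "(norm (a - b))\<^sup>2 \<le> D * (2 * (norm x * norm y))" .
  have "(norm x + norm y)\<^sup>2 - (norm (x + y))\<^sup>2 = 2 * D"
    by (simp add: D_def power2_norm_eq_inner inner_add_left inner_add_right inner_commute
        power2_sum)
  then have "2 * D = (norm x + norm y - norm (x + y)) * (norm x + norm y + norm (x + y))"
    by (simp add: algebra_simps power2_eq_square)
  also have "\<dots> \<le> (norm x + norm y - norm (x + y)) * (2 * (norm x + norm y))"
    using norm_triangle_ineq[of x y] by (intro mult_left_mono) auto
  also have "\<dots> = 2 * ((norm x + norm y - norm (x + y)) * (norm x + norm y))"
    by (rule mult.left_commute)
  finally have 2: "D \<le> (norm x + norm y - norm (x + y)) * (norm x + norm y)" by linarith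
  have "(norm (a - b))\<^sup>2 \<le> (norm x + norm y - norm (x + y)) * (norm x + norm y) * (2 * (norm x *
      norm y))"
    by (rule order_trans[OF 1 mult_right_mono[OF 2]]) (use pos in simp)
  moreover have "0 < 2 * norm x * norm y * (norm x + norm y)"
    using pos by (intro mult_pos_pos add_pos_pos) auto
  ultimately show ?thesis
    unfolding j2 jx jy by (simp only: pos_divide_le_eq mult_ac)
qed

text \<open>For moduli at most \<open>K\<close> the brackets are at most 1 + K, and uniform
  convexity combines with t <= \<eta> + t^2 / \<eta>. Otherwise the larger modulus m exceeds
  \<open>K\<close>, and m = m^(1-p) m^p is paid for by the p-th powers, with a factor that is small
  for large \<open>K\<close> because p > 1.\<close>

lemma norm_diff_le_jap_defect:
  assumes p: "1 < p" and \<eta>: "0 < \<eta>" and K: "0 < K"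
  shows "norm (a - b) \<le> \<eta> + 4 * (1 + K) ^ 3 / \<eta> * (jap a + jap b - 2 * jap ((a + b) / 2))
     + 2 * K powr (1 - p) * (norm a powr p + norm b powr p)"
proof -
  let ?d = "jap a + jap b - 2 * jap ((a + b) / 2)"
  have pos: "0 < 2 * jap a * jap b * (jap a + jap b)"
    using jap_ge_1[of a] jap_ge_1[of b] by (intro mult_pos_pos) auto
  have "0 \<le> (norm (a - b))\<^sup>2 / (2 * jap a * jap b * (jap a + jap b))"
    using pos by simp
  then have d0: "0 \<le> ?d" using jap_uniformly_convex[of a b] by linarith
  show ?thesis
  proof (cases "norm a \<le> K \<and> norm b \<le> K")
    case True
    have k: "jap a \<le> 1 + K" "jap b \<le> 1 + K" "0 \<le> jap a" "0 \<le> jap b"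
      using True jap_le[of a] jap_le[of b] jap_ge_1[of a] jap_ge_1[of b] by auto
    have "2 * jap a * jap b * (jap a + jap b) \<le> 2 * (1 + K) * (1 + K) * (2 * (1 + K))"
      using k K by (intro mult_mono) auto
    also have "2 * (1 + K) * (1 + K) * (2 * (1 + K)) = 4 * (1 + K) ^ 3"
      by (simp add: power3_eq_cube algebra_simps)
    finally have "?d * (2 * jap a * jap b * (jap a + jap b)) \<le> ?d * (4 * (1 + K) ^ 3)"
      using d0 by (rule mult_left_mono)
    moreover have "(norm (a - b))\<^sup>2 \<le> ?d * (2 * jap a * jap b * (jap a + jap b))"
      using jap_uniformly_convex[of a b] pos by (simp only: pos_divide_le_eq)
    ultimately have "(norm (a - b))\<^sup>2 \<le> ?d * (4 * (1 + K) ^ 3)" by linarith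
    then have 1: "(norm (a - b))\<^sup>2 / \<eta> \<le> 4 * (1 + K) ^ 3 / \<eta> * ?d"
      using \<eta> by (simp add: divide_right_mono mult.commute)
    have "norm (a - b) \<le> \<eta> + (norm (a - b))\<^sup>2 / \<eta>"
    proof (cases "norm (a - b) \<le> \<eta>")
      case True then show ?thesis using \<eta> by (simp add: add_increasing2)
    next
      case False
      then have "norm (a - b) * \<eta> \<le> (norm (a - b))\<^sup>2"
        by (auto simp: power2_eq_square intro!: mult_left_mono)
      then have "norm (a - b) \<le> (norm (a - b))\<^sup>2 / \<eta>" using \<eta> by (simp add: pos_le_divide_eq)
      then show ?thesis using \<eta> by linarith
    qed
    moreover have "0 \<le> 2 * K powr (1 - p) * (norm a powr p + norm b powr p)" by simp
    ultimately show ?thesis using 1 by linarith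
  next
    case False
    define m where "m = max (norm a) (norm b)"
    have m: "K < m" using False by (auto simp: m_def)
    have "norm (a - b) \<le> 2 * m"
      using norm_triangle_ineq4[of a b] by (auto simp: m_def)
    also have "m = m powr (1 - p) * m powr p"
      using m K by (simp flip: powr_add)
    also have "m powr (1 - p) \<le> K powr (1 - p)"
      using m K p by (intro powr_mono2') auto
    also have "m powr p \<le> norm a powr p + norm b powr p"
      by (auto simp: m_def max_def)
    finally have "norm (a - b) \<le> 2 * K powr (1 - p) * (norm a powr p + norm b powr p)"
      by (simp add: mult_left_mono mult_right_mono mult_mono)
    moreover have "0 \<le> 4 * (1 + K) ^ 3 / \<eta> * ?d"
      using d0 \<eta> K by (intro mult_nonneg_nonneg) auto
    ultimately show ?thesis using \<eta> by linarith
  qed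
qed

lemma integrable_dilate:
  fixes \<Phi> :: "complex \<Rightarrow> real"
  assumes f: "disk_map f" and R: "0 \<le> R" "R < 1" and "\<Phi> \<in> borel_measurable borel"
    and b: "\<And>C. \<exists>B. \<forall>w. norm w \<le> C \<longrightarrow> \<bar>\<Phi> w\<bar> \<le> B"
  shows "integrable cm (\<lambda>\<zeta>. \<Phi> (f (of_real R * \<zeta>)))"
proof -
  obtain C where C: "\<And>z. norm z \<le> R \<Longrightarrow> norm (f z) \<le> C"
    using disk_map_bounded_dilate[OF disk_mapD[OF f] R] by blast
  obtain B where "\<forall>w. norm w \<le> C \<longrightarrow> \<bar>\<Phi> w\<bar> \<le> B" using b by blast
  then show ?thesis
    using C R by (intro integrable_cm_bounded[where B=B] measurable_compose[OF
        borel_measurable_dilate[OF f] assms(4)])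
       (auto simp: norm_mult)
qed

lemma integrable_jap_dilate:
  assumes "disk_map f" "0 \<le> R" "R < 1"
  shows "integrable cm (\<lambda>\<zeta>. jap (f (of_real R * \<zeta>)))"
proof (rule integrable_dilate[OF assms])
  show "\<exists>B. \<forall>w. norm w \<le> C \<longrightarrow> \<bar>jap w\<bar> \<le> B" for C
    using jap_le jap_ge_1 by (intro exI[of _ "1 + C"]) (smt (verit))
qed measurable

lemma integrable_powr_dilate:
  assumes "disk_map f" "0 \<le> R" "R < 1" "0 \<le> p"
  shows "integrable cm (\<lambda>\<zeta>. norm (f (of_real R * \<zeta>)) powr p)"
proof (rule integrable_dilate[OF assms(1-3)])
  show "\<exists>B. \<forall>w::complex. norm w \<le> C \<longrightarrow> \<bar>norm w powr p\<bar> \<le> B" for C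
    using assms(4) by (intro exI[of _ "C powr p"]) (auto intro!: powr_mono2)
qed measurable

text \<open>Jensen's inequality for \<open>jap\<close>: the pair (1, f) is averaged against the
  Poisson kernel. The first component stays 1 because the kernel has mass one, and the norm of an
  integral is at most the integral of the norm.\<close>

lemma jap_dilate_le_poisson:
  assumes f: "disk_map f" and R: "0 \<le> R" "R < 1" and z: "norm z < 1"
  shows "ennreal (jap (f (of_real R * z))) \<le> (\<integral>\<^sup>+\<zeta>. ennreal (jap (f (of_real R * \<zeta>)) * poisson z
      \<zeta>) \<partial>cm)"
proof -
  note [measurable] = borel_measurable_dilate[OF f]
  obtain B where B: "\<And>z. norm z \<le> R \<Longrightarrow> norm (f z) \<le> B"
    using disk_map_bounded_dilate[OF disk_mapD[OF f] R] by blast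
  have B0: "0 \<le> B" using R by (intro order_trans[OF norm_ge_zero B[of 0]]) simp
  let ?h = "\<lambda>\<zeta>. poisson z \<zeta> *\<^sub>R (1::real, f (of_real R * \<zeta>))"
  have int: "integrable cm ?h"
  proof (rule integrable_cm_bounded)
    fix \<zeta> :: complex assume \<zeta>: "norm \<zeta> = 1"
    have "norm (?h \<zeta>) = poisson z \<zeta> * jap (f (of_real R * \<zeta>))"
      using poisson_nonneg[OF z, of \<zeta>] by (simp only: jap_def norm_scaleR abs_of_nonneg)
    also have "\<dots> \<le> (1 / (1 - norm z)\<^sup>2) * (1 + B)"
    proof (rule mult_mono)
      show "jap (f (of_real R * \<zeta>)) \<le> 1 + B"
        using jap_le[of "f (of_real R * \<zeta>)"] B[of "of_real R * \<zeta>"] \<zeta> R by (simp add: norm_mult)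
      show "0 \<le> jap (f (of_real R * \<zeta>))" using jap_ge_1[of "f (of_real R * \<zeta>)"] by linarith
    qed (use poisson_le[OF z \<zeta>] in auto)
    finally show "norm (?h \<zeta>) \<le> (1 / (1 - norm z)\<^sup>2) * (1 + B)" .
  qed measurable
  have "(LINT \<zeta>|cm. ?h \<zeta>) = (1, f (of_real R * z))"
  proof (rule prod_eqI)
    have "fst (LINT \<zeta>|cm. ?h \<zeta>) = (LINT \<zeta>|cm. fst (?h \<zeta>))"
      by (rule integral_bounded_linear[OF bounded_linear_fst int, symmetric])
    then show "fst (LINT \<zeta>|cm. ?h \<zeta>) = fst (1, f (of_real R * z))"
      by (simp add: integral_poisson[OF z])
    have "snd (LINT \<zeta>|cm. ?h \<zeta>) = (LINT \<zeta>|cm. snd (?h \<zeta>))"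
      by (rule integral_bounded_linear[OF bounded_linear_snd int, symmetric])
    also have "\<dots> = (LINT \<zeta>|cm. f (of_real R * \<zeta>) * of_real (poisson z \<zeta>))"
      by (intro Bochner_Integration.integral_cong) (simp_all add: scaleR_conv_of_real mult.commute)
    finally show "snd (LINT \<zeta>|cm. ?h \<zeta>) = snd (1, f (of_real R * z))"
      by (simp only: snd_conv poisson_formula[OF f R z])
  qed
  then have "ennreal (jap (f (of_real R * z))) = ennreal (norm (LINT \<zeta>|cm. ?h \<zeta>))"
    by (simp add: jap_def)
  also have "\<dots> \<le> (\<integral>\<^sup>+\<zeta>. ennreal (norm (?h \<zeta>)) \<partial>cm)"
    by (rule integral_norm_bound_ennreal[OF int])
  also have "\<dots> = (\<integral>\<^sup>+\<zeta>. ennreal (jap (f (of_real R * \<zeta>)) * poisson z \<zeta>) \<partial>cm)"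
  proof (intro nn_integral_cong arg_cong[of _ _ ennreal])
    show "norm (?h \<zeta>) = jap (f (of_real R * \<zeta>)) * poisson z \<zeta>" for \<zeta>
      using poisson_nonneg[OF z, of \<zeta>] by (simp only: jap_def norm_scaleR) simp
  qed
  finally show ?thesis .
qed

text \<open>After Fubini the kernel is integrated over the direction of its pole; the symmetry
  reduces this to the mass of the kernel in its boundary variable.\<close>

lemma poisson_commute:
  assumes "norm \<omega> = 1" "norm \<zeta> = 1"
  shows "poisson (of_real s * \<omega>) \<zeta> = poisson (of_real s * \<zeta>) \<omega>"
proof -
  have "(norm (\<zeta> - of_real s * \<omega>))\<^sup>2 = (norm (\<omega> - of_real s * \<zeta>))\<^sup>2"
  proof -
    have 1: "\<omega> \<bullet> \<omega> = 1" "\<zeta> \<bullet> \<zeta> = 1"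
      using assms by (simp_all add: dot_square_norm)
    have "of_real s * \<omega> = s *\<^sub>R \<omega>" "of_real s * \<zeta> = s *\<^sub>R \<zeta>" by (simp_all add: scaleR_conv_of_real)
    then show ?thesis
      by (simp add: power2_norm_eq_inner inner_diff_left inner_diff_right 1 inner_commute)
  qed
  then show ?thesis using assms by (simp add: poisson_def norm_mult)
qed

lemma nn_integral_poisson:
  assumes "norm z < 1"
  shows "(\<integral>\<^sup>+\<zeta>. ennreal (poisson z \<zeta>) \<partial>cm) = 1"
proof -
  have "integrable cm (poisson z)"
    by (rule integrable_cm_bounded[where B="1 / (1 - norm z)\<^sup>2"])
       (use poisson_le[OF assms] poisson_nonneg[OF assms] in auto)
  then show ?thesis
    using assms by (subst nn_integral_eq_integral) (auto simp: integral_poisson poisson_nonneg)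
qed

text \<open>With s = r / R the pointwise Jensen bound is integrated over the circle; Fubini and the
  symmetry of the kernel then leave total mass one.\<close>

lemma integral_jap_dilate_mono:
  assumes f: "disk_map f" and r: "0 \<le> r" "r \<le> R" "R < 1"
  shows "(LINT \<zeta>|cm. jap (f (of_real r * \<zeta>))) \<le> (LINT \<zeta>|cm. jap (f (of_real R * \<zeta>)))"
proof (cases "r = R")
  case False
  note [measurable] = borel_measurable_dilate[OF f]
  define s where "s = r / R"
  have s: "0 \<le> s" "s < 1" "R * s = r" "0 < R" using r False by (auto simp: s_def)
  have nn: "(LINT \<zeta>|cm. jap (f (of_real t * \<zeta>))) = enn2real (\<integral>\<^sup>+\<zeta>. ennreal (jap (f (of_real t *
      \<zeta>))) \<partial>cm)" for t
    by (intro integral_eq_nn_integral) (auto simp: jap_nonneg)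
  have P: "norm (of_real s * \<zeta>) < 1" if "norm \<zeta> = 1" for \<zeta> :: complex
    using that s by (simp add: norm_mult)
  have "(\<integral>\<^sup>+\<omega>. ennreal (jap (f (of_real r * \<omega>))) \<partial>cm) \<le>
    (\<integral>\<^sup>+\<omega>. (\<integral>\<^sup>+\<zeta>. ennreal (jap (f (of_real R * \<zeta>)) * poisson (of_real s * \<omega>) \<zeta>) \<partial>cm) \<partial>cm)"
  proof (rule nn_integral_mono_AE)
    show "AE \<omega> in cm. ennreal (jap (f (of_real r * \<omega>))) \<le> (\<integral>\<^sup>+\<zeta>. ennreal (jap (f (of_real R * \<zeta>))
        * poisson (of_real s * \<omega>) \<zeta>) \<partial>cm)"
      using AE_cm_norm
    proof eventually_elim
      case (elim \<omega>)
      have e: "of_real r * \<omega> = of_real R * (of_real s * \<omega>)"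
        by (simp flip: s(3) add: mult.assoc)
      show ?case
        unfolding e using r s P[OF elim] by (intro jap_dilate_le_poisson[OF f]) auto
    qed
  qed
  also have "\<dots> = (\<integral>\<^sup>+\<zeta>. (\<integral>\<^sup>+\<omega>. ennreal (jap (f (of_real R * \<zeta>)) * poisson (of_real s * \<omega>) \<zeta>) \<partial>cm)
      \<partial>cm)"
  proof (rule pair_sigma_finite.Fubini'[of cm cm "\<lambda>\<omega> \<zeta>. ennreal (jap (f (of_real R * \<zeta>)) * poisson
      (of_real s * \<omega>) \<zeta>)", symmetric])
    show "pair_sigma_finite cm cm" ..
    have "(\<lambda>x::complex \<times> complex. ennreal (jap (f (of_real R * snd x)) * poisson (of_real s * fst
        x) (snd x))) \<in> borel_measurable (borel \<Otimes>\<^sub>M borel)"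
      unfolding poisson_def by measurable
    then show "case_prod (\<lambda>\<omega> \<zeta>. ennreal (jap (f (of_real R * \<zeta>)) * poisson (of_real s * \<omega>) \<zeta>)) \<in>
        borel_measurable (cm \<Otimes>\<^sub>M cm)"
      by (simp add: case_prod_beta cong: measurable_cong_sets sets_pair_measure_cong)
  qed
  also have "\<dots> = (\<integral>\<^sup>+\<zeta>. ennreal (jap (f (of_real R * \<zeta>))) \<partial>cm)"
  proof (rule nn_integral_cong_AE)
    show "AE \<zeta> in cm. (\<integral>\<^sup>+\<omega>. ennreal (jap (f (of_real R * \<zeta>)) * poisson (of_real s * \<omega>) \<zeta>) \<partial>cm) =
        ennreal (jap (f (of_real R * \<zeta>)))"
      using AE_cm_norm
    proof eventually_elim
      case (elim \<zeta>)
      have j0: "0 \<le> jap w" for w using jap_ge_1[of w] by linarith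
      have "(\<integral>\<^sup>+\<omega>. ennreal (jap (f (of_real R * \<zeta>)) * poisson (of_real s * \<omega>) \<zeta>) \<partial>cm) =
        (\<integral>\<^sup>+\<omega>. ennreal (jap (f (of_real R * \<zeta>))) * ennreal (poisson (of_real s * \<zeta>) \<omega>) \<partial>cm)"
      proof (rule nn_integral_cong_AE)
        show "AE \<omega> in cm. ennreal (jap (f (of_real R * \<zeta>)) * poisson (of_real s * \<omega>) \<zeta>) =
            ennreal (jap (f (of_real R * \<zeta>))) * ennreal (poisson (of_real s * \<zeta>) \<omega>)"
          using AE_cm_norm
          by eventually_elim (use elim P[OF elim] j0 in \<open>simp add: poisson_commute ennreal_mult
              poisson_nonneg P\<close>)
      qed
      also have "\<dots> = ennreal (jap (f (of_real R * \<zeta>)))"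
        by (simp add: nn_integral_cmult nn_integral_poisson[OF P[OF elim]])
      finally show ?case .
    qed
  qed
  finally have le: "(\<integral>\<^sup>+\<omega>. ennreal (jap (f (of_real r * \<omega>))) \<partial>cm) \<le>
      (\<integral>\<^sup>+\<zeta>. ennreal (jap (f (of_real R * \<zeta>))) \<partial>cm)" .
  moreover have "(\<integral>\<^sup>+\<zeta>. ennreal (jap (f (of_real R * \<zeta>))) \<partial>cm) < top"
  proof -
    have "integrable cm (\<lambda>\<zeta>. jap (f (of_real R * \<zeta>)))"
      using r s by (intro integrable_jap_dilate f) auto
    then have "(\<integral>\<^sup>+\<zeta>. ennreal (norm (jap (f (of_real R * \<zeta>)))) \<partial>cm) < top"
      by (simp add: integrable_iff_bounded infinity_ennreal_def)
    moreover have "norm (jap w) = jap w" for w using jap_ge_1[of w] by simp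
    ultimately show ?thesis by simp
  qed
  ultimately show ?thesis unfolding nn by (rule enn2real_mono)
qed simp

lemma disk_map_intros:
  "disk_map (\<lambda>z. c)"
  "disk_map (\<lambda>z. z)"
  "disk_map f \<Longrightarrow> disk_map g \<Longrightarrow> disk_map (\<lambda>z. f z + g z)"
  "disk_map f \<Longrightarrow> disk_map g \<Longrightarrow> disk_map (\<lambda>z. f z - g z)"
  "disk_map f \<Longrightarrow> disk_map g \<Longrightarrow> disk_map (\<lambda>z. f z * g z)"
  by (auto simp: disk_map_def intro!: holomorphic_intros)

text \<open>
  The bracket \<^const>\<open>jap\<close> is a strictly convex substitute for the norm: integral means of
  \<open>jap \<circ> f\<close> increase to a finite limit, so the defect of uniform convexity between two dilates
  of \<open>f\<close> tends to zero.
\<close>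

lemma dilates_Cauchy_L1:
  assumes f: "disk_map f" and p: "1 < p"
    and M: "\<And>r. 0 \<le> r \<Longrightarrow> r < 1 \<Longrightarrow> (LINT \<zeta>|cm. norm (f (of_real r * \<zeta>)) powr p) \<le> M"
    and \<epsilon>: "0 < \<epsilon>"
  obtains r0 where "0 \<le> r0" "r0 < 1"
    "\<And>s t. r0 \<le> s \<Longrightarrow> s < 1 \<Longrightarrow> r0 \<le> t \<Longrightarrow> t < 1 \<Longrightarrow>
      (LINT \<zeta>|cm. norm (f (of_real s * \<zeta>) - f (of_real t * \<zeta>))) \<le> \<epsilon>"
proof -
  define I where "I g r = (LINT \<zeta>|cm. jap (g (of_real r * \<zeta>)))" for g and r :: real
  have M0: "0 \<le> M" using M[of 0] by (auto intro: order_trans[rotated] integral_nonneg)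
  have I_le: "I f r \<le> 2 + M" if r: "0 \<le> r" "r < 1" for r
  proof -
    have "I f r \<le> (LINT \<zeta>|cm. 2 + norm (f (of_real r * \<zeta>)) powr p)"
      unfolding I_def
    proof (rule integral_mono)
      show "integrable cm (\<lambda>\<zeta>. jap (f (of_real r * \<zeta>)))" by (rule integrable_jap_dilate[OF f r])
      show "integrable cm (\<lambda>\<zeta>. 2 + norm (f (of_real r * \<zeta>)) powr p)"
        using p by (intro Bochner_Integration.integrable_add integrable_powr_dilate[OF f r]) auto
      fix \<zeta> :: complex
      let ?x = "norm (f (of_real r * \<zeta>))"
      have "?x \<le> 1 + ?x powr p"
      proof (cases "?x \<le> 1")
        case True then show ?thesis by (simp add: add_increasing2)
      next
        case False
        then have "?x powr 1 \<le> ?x powr p" using p by (intro powr_mono) auto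
        then show ?thesis using False by simp
      qed
      then show "jap (f (of_real r * \<zeta>)) \<le> 2 + ?x powr p"
        using jap_le[of "f (of_real r * \<zeta>)"] by linarith
    qed
    also have "\<dots> = 2 + (LINT \<zeta>|cm. norm (f (of_real r * \<zeta>)) powr p)"
      using p cm.prob_space by (subst Bochner_Integration.integral_add)
          (auto intro!: integrable_powr_dilate[OF f r])
    also have "\<dots> \<le> 2 + M" using M[OF r] by simp
    finally show ?thesis .
  qed
  define \<eta> where "\<eta> = \<epsilon> / 3"
  have \<eta>: "0 < \<eta>" using \<epsilon> by (simp add: \<eta>_def)
  \<comment> \<open>Chosen so that K^(1-p) = \<epsilon> / (12 (M + 1)), whence the tail term 2
    K^(1-p) (2 M) is at most \<epsilon> / 3. The choices of \<open>\<eta>\<close> and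
    \<open>\<kappa>\<close> account for the other two thirds.\<close>
  define K where "K = (12 * (M + 1) / \<epsilon>) powr (1 / (p - 1))"
  have K: "0 < K" using M0 \<epsilon> by (simp add: K_def)
  have "K powr (1 - p) = (12 * (M + 1) / \<epsilon>) powr (-1)"
  proof -
    have e: "1 / (p - 1) * (1 - p) = -1" using p by (simp add: field_simps)
    show ?thesis unfolding K_def powr_powr e ..
  qed
  also have "\<dots> = \<epsilon> / (12 * (M + 1))" using M0 \<epsilon> by (simp add: powr_minus field_simps)
  finally have "2 * K powr (1 - p) * (2 * M) = 4 * M * (\<epsilon> / (12 * (M + 1)))" by simp
  also have "\<dots> \<le> \<epsilon> / 3" using M0 \<epsilon> by (simp add: field_simps)
  finally have KM: "2 * K powr (1 - p) * (2 * M) \<le> \<epsilon> / 3" .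
  define c where "c = 4 * (1 + K) ^ 3 / \<eta>"
  have c: "0 < c" using K \<eta> by (simp add: c_def)
  define \<kappa> where "\<kappa> = \<epsilon> / (3 * c)"
  have \<kappa>: "0 < \<kappa>" "c * \<kappa> = \<epsilon> / 3" using c \<epsilon> by (simp_all add: \<kappa>_def)
  define L where "L = (SUP r\<in>{0..<1}. I f r)"
  have bdd: "bdd_above (I f ` {0..<1})" using I_le by (auto intro!: bdd_aboveI[of _ "2 + M"])
  have L: "I f r \<le> L" if "0 \<le> r" "r < 1" for r
    unfolding L_def by (rule cSUP_upper[OF _ bdd]) (use that in auto)
  have "\<exists>r\<in>{0..<1}. L - \<kappa> / 4 < I f r"
    using less_cSUP_iff[OF _ bdd, of "L - \<kappa> / 4"] \<kappa> by (simp add: L_def)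
  then obtain r1 where r1: "0 \<le> r1" "r1 < 1" "L - \<kappa> / 4 < I f r1" by auto
  have "uniformly_continuous_on (cball 0 r1) f"
    using r1 by (intro compact_uniformly_continuous holomorphic_on_imp_continuous_on
      holomorphic_on_subset[OF disk_mapD[OF f]]) auto
  then obtain \<delta> where \<delta>: "0 < \<delta>" "\<And>z w. norm z \<le> r1 \<Longrightarrow> norm w \<le> r1 \<Longrightarrow> dist w z < \<delta> \<Longrightarrow>
      dist (f w) (f z) < \<kappa> / 4"
    using \<kappa> unfolding uniformly_continuous_on_def
      by (metis mem_cball_0 divide_pos_pos zero_less_numeral)
  \<comment> \<open>For u >= \<open>r0\<close>, multiplication by u moves points of norm
    \<open>r1\<close> by less than \<open>\<delta>\<close>, hence changes \<open>f\<close> there by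
    less than \<kappa> / 4.\<close>
  define r0 where "r0 = max 0 (1 - \<delta> / 2)"
  show thesis
  proof (rule that[of r0])
    show "0 \<le> r0" "r0 < 1" using \<delta> by (auto simp: r0_def)
    fix s t assume st: "r0 \<le> s" "s < 1" "r0 \<le> t" "t < 1"
    have st0: "0 \<le> s" "0 \<le> t" using st by (auto simp: r0_def)
    \<comment> \<open>A common radius between \<open>s\<close>, \<open>t\<close> and 1. Since s / R
      and t / R are at most 1, \<open>h\<close> is again a map of the disk, and at radius
      \<open>R\<close> it is the midpoint of the two dilates.\<close>
    define R where "R = (max s t + 1) / 2"
    have R: "0 < R" "R < 1" "s \<le> R" "t \<le> R" using st st0 by (auto simp: R_def)
    define h where "h z = (f (of_real (s / R) * z) + f (of_real (t / R) * z)) * (1 / 2)" for z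
    have h: "disk_map h"
      unfolding h_def[abs_def] using R st0
      by (intro disk_map_intros disk_map_scale f) (simp_all del: of_real_divide)
    have hR: "h (of_real (u * R) * \<zeta>) = (f (of_real (s * u) * \<zeta>) + f (of_real (t * u) * \<zeta>)) / 2"
        for u \<zeta>
      using R by (simp add: h_def mult_ac)
    have close: "norm (f (of_real (u * r1) * \<zeta>) - f (of_real r1 * \<zeta>)) \<le> \<kappa> / 4"
      if u: "r0 \<le> u" "u < 1" and \<zeta>: "norm \<zeta> = 1" for u \<zeta>
    proof -
      have u0: "0 \<le> u" using u by (auto simp: r0_def)
      have "dist (of_real (u * r1) * \<zeta>) (of_real r1 * \<zeta>) = norm (of_real ((1 - u) * r1) * \<zeta>)"
        by (subst dist_commute) (simp add: dist_norm algebra_simps)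
      also have "\<dots> = (1 - u) * r1" using u r1 \<zeta> unfolding norm_mult norm_of_real
        by (simp add: abs_mult)
      also have "\<dots> \<le> (1 - u) * 1" using u r1 by (intro mult_left_mono) auto
      also have "\<dots> < \<delta>" using u \<delta> by (auto simp: r0_def)
      finally have "dist (of_real (u * r1) * \<zeta>) (of_real r1 * \<zeta>) < \<delta>" .
      moreover have "norm (of_real (u * r1) * \<zeta>) \<le> r1"
        using u u0 r1 \<zeta> by (simp add: norm_mult mult_left_le_one_le)
      moreover have "norm (of_real r1 * \<zeta>) \<le> r1" using r1 \<zeta> by (simp add: norm_mult)
      ultimately show ?thesis using \<delta>(2) by (force simp: dist_norm)
    qed
    \<comment> \<open>At radius r1 R the function \<open>h\<close> averages f(s r1 \<zeta>) and f(t
      r1 \<zeta>), both near f(r1 \<zeta>), so its mean is nearly \<open>L\<close>. Monotonicity of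
      the means carries this lower bound to radius \<open>R\<close>.\<close>
    have "I f r1 - \<kappa> / 4 \<le> I h (r1 * R)"
    proof -
      have "I f r1 \<le> (LINT \<zeta>|cm. \<kappa> / 4 + jap (h (of_real (r1 * R) * \<zeta>)))"
        unfolding I_def
      proof (rule integral_mono_AE)
        show "integrable cm (\<lambda>\<zeta>. jap (f (of_real r1 * \<zeta>)))"
          using r1 by (intro integrable_jap_dilate f)
        have "r1 * R < 1" using r1 R by (smt (verit, best) mult_left_le)
        then show "integrable cm (\<lambda>\<zeta>. \<kappa> / 4 + jap (h (of_real (r1 * R) * \<zeta>)))"
          using r1 R by (intro Bochner_Integration.integrable_add integrable_jap_dilate h) auto
        show "AE \<zeta> in cm. jap (f (of_real r1 * \<zeta>)) \<le> \<kappa> / 4 + jap (h (of_real (r1 * R) * \<zeta>))"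
          using AE_cm_norm
        proof eventually_elim
          case (elim \<zeta>)
          have "f (of_real r1 * \<zeta>) - h (of_real (r1 * R) * \<zeta>) =
              - ((f (of_real (s * r1) * \<zeta>) - f (of_real r1 * \<zeta>)) + (f (of_real (t * r1) * \<zeta>) - f
                  (of_real r1 * \<zeta>))) / 2"
            unfolding hR by (simp add: field_simps)
          also have "norm \<dots> \<le> (\<kappa> / 4 + \<kappa> / 4) / 2"
            using norm_triangle_mono[OF close[OF st(1,2) elim] close[OF st(3,4) elim]]
              by (simp add: norm_divide norm_minus_commute)
          finally show ?case
            using jap_diff_le[of "f (of_real r1 * \<zeta>)" "h (of_real (r1 * R) * \<zeta>)"] by simp
        qed
      qed
      also have "\<dots> = \<kappa> / 4 + I h (r1 * R)"
      proof -
        have "r1 * R < 1" using r1 R by (smt (verit, best) mult_left_le)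
        then show ?thesis
          using r1 R cm.prob_space unfolding I_def
          by (subst Bochner_Integration.integral_add) (auto intro!: integrable_jap_dilate h simp
              del: of_real_mult)
      qed
      finally show ?thesis by simp
    qed
    also have "I h (r1 * R) \<le> I h R"
      unfolding I_def using r1 R by (intro integral_jap_dilate_mono h)
          (auto intro: mult_left_le_one_le)
    finally have IR: "L - \<kappa> / 2 \<le> I h R" using r1(3) by simp
    let ?a = "\<lambda>\<zeta>. f (of_real s * \<zeta>)" and ?b = "\<lambda>\<zeta>. f (of_real t * \<zeta>)"
    let ?j = "\<lambda>\<zeta>. jap (?a \<zeta>) + jap (?b \<zeta>) - 2 * jap (h (of_real R * \<zeta>))"
    have ia: "integrable cm (\<lambda>\<zeta>. jap (?a \<zeta>))" "integrable cm (\<lambda>\<zeta>. norm (?a \<zeta>) powr p)"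
      and ib: "integrable cm (\<lambda>\<zeta>. jap (?b \<zeta>))" "integrable cm (\<lambda>\<zeta>. norm (?b \<zeta>) powr p)"
      and ih: "integrable cm (\<lambda>\<zeta>. jap (h (of_real R * \<zeta>)))"
      using st st0 R p by (auto intro!: integrable_jap_dilate integrable_powr_dilate f h)
    have ij: "integrable cm ?j" using ia ib ih by auto
    \<comment> \<open>The means of the two dilates are at most \<open>L\<close> and that of their
      midpoint is at least L - \<kappa> / 2, so the integrated defect is at most \<kappa>.\<close>
    have "(LINT \<zeta>|cm. ?j \<zeta>) = I f s + I f t - 2 * I h R"
      using ia ib ih by (simp add: I_def)
    also have "\<dots> \<le> \<kappa>" using L[of s] L[of t] IR st st0 by simp
    finally have defect: "(LINT \<zeta>|cm. ?j \<zeta>) \<le> \<kappa>" .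
    have bound: "norm (?a \<zeta> - ?b \<zeta>) \<le> \<eta> + c * ?j \<zeta> + 2 * K powr (1 - p) * (norm (?a \<zeta>) powr p +
        norm (?b \<zeta>) powr p)" for \<zeta>
    proof -
      have e: "(?a \<zeta> + ?b \<zeta>) / 2 = h (of_real R * \<zeta>)" using hR[of 1 \<zeta>] by simp
      show ?thesis
        using norm_diff_le_jap_defect[OF p \<eta> K, of "?a \<zeta>" "?b \<zeta>"] unfolding e c_def .
    qed
    have "(LINT \<zeta>|cm. norm (?a \<zeta> - ?b \<zeta>)) \<le>
      (LINT \<zeta>|cm. \<eta> + c * ?j \<zeta> + 2 * K powr (1 - p) * (norm (?a \<zeta>) powr p + norm (?b \<zeta>) powr p))"
    proof (rule integral_mono')
      show "integrable cm (\<lambda>\<zeta>. \<eta> + c * ?j \<zeta> + 2 * K powr (1 - p) * (norm (?a \<zeta>) powr p +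
          norm (?b \<zeta>) powr p))"
        using ia ib ij by (intro Bochner_Integration.integrable_add integrable_mult_right) auto
    qed (rule bound order_trans[OF norm_ge_zero bound])+
    also have "\<dots> = \<eta> + c * (LINT \<zeta>|cm. ?j \<zeta>) + 2 * K powr (1 - p) * ((LINT \<zeta>|cm. norm (?a \<zeta>) powr
        p) + (LINT \<zeta>|cm. norm (?b \<zeta>) powr p))"
      using ia ib ij cm.prob_space by (subst Bochner_Integration.integral_add | simp)+
    also have "\<dots> \<le> \<eta> + c * \<kappa> + 2 * K powr (1 - p) * (2 * M)"
      using defect c M[of s] M[of t] st st0 by (intro add_mono mult_left_mono) auto
    also have "\<dots> \<le> \<epsilon>" using KM \<kappa>(2) by (simp add: \<eta>_def)
    finally show "(LINT \<zeta>|cm. norm (?a \<zeta> - ?b \<zeta>)) \<le> \<epsilon>" .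
  qed
qed

section \<open>Radial limits\<close>

definition rad :: "nat \<Rightarrow> real" where "rad n = 1 - 1 / (real n + 1)"

lemma rad: "0 \<le> rad n" "rad n < 1"
  by (auto simp: rad_def)

lemma incseq_rad: "incseq rad"
  by (auto simp: incseq_def rad_def frac_le)

lemma rad_tendsto: "rad \<longlonglongrightarrow> 1"
  unfolding rad_def by real_asymp

lemma rad_at_left: "filterlim rad (at_left 1) sequentially"
  using rad_tendsto by (auto simp: filterlim_at rad less_imp_neq intro!: always_eventually)

lemma rad_large:
  assumes "b < 1"
  obtains n where "b < rad n"
  using order_tendstoD(1)[OF rad_tendsto assms] eventually_happens
    by (metis trivial_limit_sequentially)

lemma rad_large_mono: "b < rad n \<Longrightarrow> n \<le> m \<Longrightarrow> b < rad m"
  using incseq_rad by (auto simp: incseq_def intro: less_le_trans)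

text \<open>The two leading quantifiers range over natural numbers, so that the set of points with a
  radial limit becomes a countable combination of sets that are easily seen to be Borel.\<close>

lemma left_limit_iff_Cauchy:
  fixes g :: "real \<Rightarrow> complex"
  shows "(\<exists>l. (g \<longlongrightarrow> l) (at_left 1)) \<longleftrightarrow>
    (\<forall>m::nat. \<exists>n. \<forall>r\<in>{rad n..<1}. \<forall>t\<in>{rad n..<1}. norm (g r - g t) \<le> 1 / (real m + 1))"
    (is "?L \<longleftrightarrow> ?R")
proof
  assume ?L
  then obtain l where l: "(g \<longlongrightarrow> l) (at_left 1)" by blast
  show ?R
  proof
    fix m :: nat
    define e where "e = 1 / (real m + 1)"
    have e: "0 < e" by (simp add: e_def)
    have "eventually (\<lambda>r. dist (g r) l < e / 2) (at_left 1)"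
      using l by (rule tendstoD) (use e in auto)
    then obtain b where b: "b < 1" "\<And>r. b < r \<Longrightarrow> r < 1 \<Longrightarrow> dist (g r) l < e / 2"
      by (subst (asm) eventually_at_left[of "0::real" 1]) auto
    obtain n where n: "b < rad n" using rad_large[OF b(1)] .
    have "norm (g r - g t) \<le> 1 / (real m + 1)" if "r \<in> {rad n..<1}" "t \<in> {rad n..<1}" for r t
    proof -
      have "dist (g r) l < e / 2" "dist (g t) l < e / 2"
        using b(2) n that by auto
      moreover have "norm (g r - g t) \<le> dist (g r) l + dist (g t) l"
        using dist_triangle2[of "g r" "g t" l] by (simp add: dist_norm)
      ultimately show ?thesis unfolding e_def[symmetric] by linarith
    qed
    then show "\<exists>n. \<forall>r\<in>{rad n..<1}. \<forall>t\<in>{rad n..<1}. norm (g r - g t) \<le> 1 / (real m + 1)" by blast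
  qed
next
  assume R: ?R
  have small: "\<exists>m::nat. 1 / (real m + 1) < e" if "e > 0" for e :: real
    using nat_approx_posE[OF that] by (metis of_nat_Suc add.commute)
  have "Cauchy (\<lambda>n. g (rad n))"
  proof (rule metric_CauchyI)
    fix e :: real assume "0 < e"
    then obtain m :: nat where m: "1 / (real m + 1) < e" using small by blast
    obtain n where n: "\<forall>r\<in>{rad n..<1}. \<forall>t\<in>{rad n..<1}. norm (g r - g t) \<le> 1 / (real m + 1)"
      using R by blast
    show "\<exists>M. \<forall>k\<ge>M. \<forall>j\<ge>M. dist (g (rad k)) (g (rad j)) < e"
    proof (intro exI[of _ n] allI impI)
      fix k j assume "n \<le> k" "n \<le> j"
      then have "rad n \<le> rad k" "rad n \<le> rad j" by (simp_all add: incseqD[OF incseq_rad])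
      then have "norm (g (rad k) - g (rad j)) \<le> 1 / (real m + 1)" using n rad(2) by simp
      then show "dist (g (rad k)) (g (rad j)) < e" using m by (simp add: dist_norm)
    qed
  qed
  then obtain l where l: "(\<lambda>n. g (rad n)) \<longlonglongrightarrow> l"
    using Cauchy_convergent convergent_def by blast
  have "(g \<longlongrightarrow> l) (at_left 1)"
  proof (rule tendstoI)
    fix e :: real assume "0 < e"
    then obtain m :: nat where m: "1 / (real m + 1) < e" using small by blast
    obtain n where n: "\<And>r t. r \<in> {rad n..<1} \<Longrightarrow> t \<in> {rad n..<1} \<Longrightarrow> norm (g r - g t) \<le>
        1 / (real m + 1)" using R by blast
    have "dist (g r) l < e" if r: "rad n < r" "r < 1" for r
    proof -
      have "(\<lambda>k. norm (g r - g (rad k))) \<longlonglongrightarrow> norm (g r - l)"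
        by (intro tendsto_intros l)
      moreover have "eventually (\<lambda>k. norm (g r - g (rad k)) \<le> 1 / (real m + 1)) sequentially"
        using eventually_ge_at_top[of n]
        by eventually_elim (use r rad in \<open>auto intro!: n incseqD[OF incseq_rad]\<close>)
      ultimately have "norm (g r - l) \<le> 1 / (real m + 1)"
        by (intro tendsto_upperbound[OF _ _ sequentially_bot])
      then show ?thesis using m by (simp add: dist_norm)
    qed
    then show "eventually (\<lambda>r. dist (g r) l < e) (at_left 1)"
      using rad(2)[of n] by (subst eventually_at_left[of "0::real" 1]) auto
  qed
  then show ?L by blast
qed

lemma tendsto_bdry:
  assumes "((\<lambda>r::real. f (of_real r * \<zeta>)) \<longlongrightarrow> l) (at_left 1)"
  shows "bdry f \<zeta> = l"
  unfolding bdry_def by (rule tendsto_Lim[OF _ assms]) simp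

lemma continuous_on_sphere_dilate:
  assumes "disk_map f" "norm c < 1"
  shows "continuous_on (sphere 0 1) (\<lambda>\<zeta>. f (c * \<zeta>))"
proof (rule continuous_on_compose2[OF holomorphic_on_imp_continuous_on[OF disk_mapD[OF assms(1)]]])
  show "(\<lambda>\<zeta>. c * \<zeta>) ` sphere 0 1 \<subseteq> ball 0 1"
    using assms by (auto simp: norm_mult)
qed (intro continuous_intros)

text \<open>
  Measurability is needed on the nose, because \<^const>\<open>circle_measure\<close> is not complete. Where there
  is no radial limit, \<^const>\<open>Lim\<close> is \<open>THE\<close> of an empty predicate, hence one fixed value.
\<close>

lemma bdry_borel:
  assumes f: "f \<in> disk_holo"
  shows "bdry f \<in> borel_measurable borel"
proof -
  note dm = disk_holo_disk_map[OF f]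
  define G where "G = {\<zeta>. \<exists>l. ((\<lambda>r::real. f (of_real r * \<zeta>)) \<longlongrightarrow> l) (at_left 1)}"
  \<comment> \<open>Off the circle the limit always exists: inside by continuity, outside because
    the representative vanishes there. The Cauchy criterion is left for points of the
    circle.\<close>
  have "\<exists>l. ((\<lambda>r::real. f (of_real r * \<zeta>)) \<longlongrightarrow> l) (at_left 1)" if "norm \<zeta> \<noteq> 1" for \<zeta>
  proof (cases "norm \<zeta> < 1")
    case True
    have "isCont f \<zeta>"
      using holomorphic_on_imp_continuous_on[OF disk_mapD[OF dm]] True
      by (simp add: continuous_on_eq_continuous_at)
    moreover have "((\<lambda>r::real. of_real r * \<zeta>) \<longlongrightarrow> of_real 1 * \<zeta>) (at_left 1)"
      by (intro tendsto_intros)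
    ultimately have "((\<lambda>r::real. f (of_real r * \<zeta>)) \<longlongrightarrow> f \<zeta>) (at_left 1)"
      by (intro isCont_tendsto_compose[of \<zeta> f]) auto
    then show ?thesis by blast
  next
    case False
    with that have gt: "1 < norm \<zeta>" by simp
    then have lt: "1 / norm \<zeta> < 1" by (subst pos_divide_less_eq) auto
    have "((\<lambda>r::real. f (of_real r * \<zeta>)) \<longlongrightarrow> 0) (at_left 1)"
    proof (rule tendsto_eventually)
      have "f (of_real r * \<zeta>) = 0" if r: "1 / norm \<zeta> < r" "r < 1" for r
      proof -
        have "0 < 1 / norm \<zeta>" using gt by (intro divide_pos_pos) auto
        then have "0 < r" using r by linarith
        moreover have "1 < r * norm \<zeta>" using r gt by (simp add: divide_simps split: if_splits)
        ultimately show ?thesis using f by (auto simp: disk_holo_def norm_mult)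
      qed
      then show "eventually (\<lambda>r. f (of_real r * \<zeta>) = 0) (at_left 1)"
        using lt by (subst eventually_at_left[of "0::real" 1]) (auto intro!: exI[of _ "1 / norm \<zeta>"])
    qed
    then show ?thesis by blast
  qed
  then have out: "\<zeta> \<in> G" if "norm \<zeta> \<noteq> 1" for \<zeta>
    using that by (simp add: G_def)
  define Q where "Q m n = {\<zeta> \<in> sphere 0 1. \<forall>r\<in>{rad n..<1}. \<forall>t\<in>{rad n..<1}.
      norm (f (of_real r * \<zeta>) - f (of_real t * \<zeta>)) \<le> 1 / (real m + 1)}" for m n :: nat
  have G_eq: "G = - sphere 0 1 \<union> (\<Inter>m. \<Union>n. Q m n)"
  proof (rule set_eqI)
    fix \<zeta>
    show "\<zeta> \<in> G \<longleftrightarrow> \<zeta> \<in> - sphere 0 1 \<union> (\<Inter>m. \<Union>n. Q m n)"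
    proof (cases "norm \<zeta> = 1")
      case True
      then have "\<zeta> \<in> G \<longleftrightarrow> (\<forall>m. \<exists>n. \<zeta> \<in> Q m n)"
        by (simp add: G_def left_limit_iff_Cauchy Q_def)
      with True show ?thesis by simp
    qed (use out in simp)
  qed
  \<comment> \<open>The radii range over an uncountable set, but each single condition is closed in
    \<open>\<zeta>\<close>, and closed sets are stable under arbitrary intersections.\<close>
  have "closed (Q m n)" for m n
  proof -
    have "Q m n = sphere 0 1 \<inter> (\<Inter>r\<in>{rad n..<1}. \<Inter>t\<in>{rad n..<1}.
      {\<zeta> \<in> sphere 0 1. norm (f (of_real r * \<zeta>) - f (of_real t * \<zeta>)) \<le> 1 / (real m + 1)})"
      by (auto simp: Q_def)
    also have "closed \<dots>"
    proof (intro closed_Int closed_INT ballI)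
      fix r t assume "r \<in> {rad n..<1}" "t \<in> {rad n..<1}"
      then have "norm (complex_of_real r) < 1" "norm (complex_of_real t) < 1"
        using rad(1)[of n] by auto
      then show "closed {\<zeta> \<in> sphere 0 1. norm (f (of_real r * \<zeta>) - f (of_real t * \<zeta>)) \<le>
          1 / (real m + 1)}"
        by (intro continuous_on_closed_Collect_le continuous_on_norm continuous_on_diff
              continuous_on_const continuous_on_sphere_dilate dm) auto
    qed auto
    finally show ?thesis .
  qed
  then have [measurable]: "G \<in> sets borel"
    unfolding G_eq by (intro sets.Un borel_comp borel_closed sets.countable_INT''
        sets.countable_UN'' sets.countable_INT sets.countable_UN) auto
  have [measurable]: "(\<lambda>\<zeta>. f (c * \<zeta>)) \<in> borel_measurable borel" for c
    by (rule borel_measurable_dilate[OF dm])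
  have "(\<lambda>\<zeta>. if \<zeta> \<in> G then lim (\<lambda>n. f (of_real (rad n) * \<zeta>)) else (THE l::complex. False)) \<in>
      borel_measurable borel"
    by measurable
  also have "(\<lambda>\<zeta>. if \<zeta> \<in> G then lim (\<lambda>n. f (of_real (rad n) * \<zeta>)) else (THE l::complex. False)) =
      bdry f"
  proof
    fix \<zeta>
    show "(if \<zeta> \<in> G then lim (\<lambda>n. f (of_real (rad n) * \<zeta>)) else (THE l::complex. False)) = bdry f \<zeta>"
    proof (cases "\<zeta> \<in> G")
      case True
      then obtain l where l: "((\<lambda>r::real. f (of_real r * \<zeta>)) \<longlongrightarrow> l) (at_left 1)" by (auto simp: G_def)
      then have "(\<lambda>n. f (of_real (rad n) * \<zeta>)) \<longlonglongrightarrow> l"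
        by (rule filterlim_compose[OF _ rad_at_left])
      then show ?thesis using True tendsto_bdry[OF l] by (simp add: limI)
    next
      case False
      then have "(THE l. ((\<lambda>r::real. f (of_real r * \<zeta>)) \<longlongrightarrow> l) (at_left 1)) = (THE l::complex. False)"
        by (intro arg_cong[of _ _ The] ext) (auto simp: G_def)
      with False show ?thesis by (simp add: bdry_def t2_space_class.Lim_def)
    qed
  qed
  finally show ?thesis .
qed

section \<open>Almost everywhere existence of radial limits\<close>

lemma integral_norm_eq_nn_integral:
  fixes f :: "complex \<Rightarrow> 'b::{banach, second_countable_topology}"
  assumes "integrable cm f"
  shows "(\<integral>\<^sup>+\<zeta>. ennreal (norm (f \<zeta>)) \<partial>cm) = ennreal (LINT \<zeta>|cm. norm (f \<zeta>))"
  using assms by (intro nn_integral_eq_integral) auto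

lemma integrable_dilate_complex:
  assumes "disk_map f" "0 \<le> R" "R < 1"
  shows "integrable cm (\<lambda>\<zeta>. f (of_real R * \<zeta>))"
proof -
  obtain C where "\<And>z. norm z \<le> R \<Longrightarrow> norm (f z) \<le> C"
    using disk_map_bounded_dilate[OF disk_mapD[OF assms(1)] assms(2,3)] by blast
  then show ?thesis
    using assms by (intro integrable_cm_bounded[where B=C] borel_measurable_dilate)
        (auto simp: norm_mult)
qed

text \<open>The weak type estimate is applied to h(z) = f(z) - f(s z), whose means near the boundary
  are at most \<epsilon> \<kappa> / 7680 by the Cauchy property of dilates. Since that estimate
  works at a fixed radius below 1, the exceptional set is exhausted along the radii
  \<open>rad (n + n0)\<close>.\<close>

lemma oscillation_set_small:
  assumes f: "disk_map f" and p: "1 < p"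
    and M: "\<And>r. 0 \<le> r \<Longrightarrow> r < 1 \<Longrightarrow> (LINT \<zeta>|cm. norm (f (of_real r * \<zeta>)) powr p) \<le> M"
    and \<epsilon>: "0 < \<epsilon>" and \<kappa>: "0 < \<kappa>"
  obtains s N where "0 \<le> s" "s < 1" "N \<in> sets borel" "emeasure cm N \<le> ennreal \<epsilon>"
    "\<And>\<zeta> r. norm \<zeta> = 1 \<Longrightarrow> \<zeta> \<notin> N \<Longrightarrow> 0 \<le> r \<Longrightarrow> r < 1 \<Longrightarrow>
      norm (f (of_real r * \<zeta>) - f (of_real (s * r) * \<zeta>)) \<le> \<kappa>"
proof -
  define e where "e = \<epsilon> * \<kappa> / 7680"
  have e: "0 < e" using \<epsilon> \<kappa> by (simp add: e_def)
  obtain r0 where r0: "0 \<le> r0" "r0 < 1"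
    "\<And>s t. r0 \<le> s \<Longrightarrow> s < 1 \<Longrightarrow> r0 \<le> t \<Longrightarrow> t < 1 \<Longrightarrow>
      (LINT \<zeta>|cm. norm (f (of_real s * \<zeta>) - f (of_real t * \<zeta>))) \<le> e"
    using dilates_Cauchy_L1[OF f p M e] by blast
  define s where "s = (1 + r0) / 2"
  have s: "0 < s" "s < 1" "r0 < s" using r0 by (auto simp: s_def)
  \<comment> \<open>The shift by \<open>n0\<close> ensures s R >= r0 for every radius R in use, so
    that both dilates in \<open>h\<close> fall into the range of the Cauchy estimate.\<close>
  have "r0 / s < 1" using s r0 by (simp add: divide_less_eq)
  then obtain n0 where n0: "r0 / s < rad n0" using rad_large by blast
  define h where "h z = f z - f (of_real s * z)" for z
  have h: "disk_map h"
    unfolding h_def[abs_def] using s by (intro disk_map_intros disk_map_scale f) auto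
  define S where "S n = {\<zeta> \<in> sphere 0 1. \<exists>r\<in>{0..<1}. \<kappa> < norm (h (of_real (rad (n +
      n0)) * (of_real r * \<zeta>)))}" for n
  have S_sets: "S n \<in> sets borel" for n
    unfolding S_def by (rule maximal_weak_type(1)[OF h rad \<kappa>])
  have S_small: "emeasure cm (S n) \<le> ennreal \<epsilon>" for n
  proof -
    define R where "R = rad (n + n0)"
    have "r0 / s < R" unfolding R_def using n0 by (rule rad_large_mono) simp
    then have R1: "r0 \<le> s * R" using s by (simp add: field_simps)
    have R0: "0 \<le> R" "R < 1" by (auto simp: R_def rad)
    have sR: "s * R < 1" "s * R \<le> R" using s R0
      by (auto intro: mult_left_le_one_le) (smt (verit, best) mult_left_le)
    have "emeasure cm (S n) \<le> ennreal (7680 / \<kappa>) * (\<integral>\<^sup>+\<zeta>. ennreal (norm (h (of_real R * \<zeta>))) \<partial>cm)"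
      unfolding S_def R_def by (rule maximal_weak_type(2)[OF h rad \<kappa>])
    also have "(\<integral>\<^sup>+\<zeta>. ennreal (norm (h (of_real R * \<zeta>))) \<partial>cm) =
        ennreal (LINT \<zeta>|cm. norm (h (of_real R * \<zeta>)))"
      by (intro integral_norm_eq_nn_integral integrable_dilate_complex h R0)
    also have "(LINT \<zeta>|cm. norm (h (of_real R * \<zeta>))) \<le> e"
      using r0(3)[of R "s * R"] R0 R1 sR by (simp add: h_def mult.assoc)
    also have "ennreal (7680 / \<kappa>) * ennreal e = ennreal \<epsilon>"
      using \<kappa> e by (simp add: e_def flip: ennreal_mult)
    finally show ?thesis by (simp add: mult_left_mono ennreal_leI)
  qed
  \<comment> \<open>A larger radius R' reaches the same point of the disk with r replaced by (R /
    R') r, which is still below 1.\<close>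
  have "incseq S"
  proof (rule incseq_SucI, rule subsetI)
    fix n \<zeta> assume "\<zeta> \<in> S n"
    then obtain r where r: "norm \<zeta> = 1" "0 \<le> r" "r < 1" "\<kappa> < norm (h (of_real (rad (n +
        n0)) * (of_real r * \<zeta>)))"
      by (auto simp: S_def)
    define R R' where "R = rad (n + n0)" and "R' = rad (Suc n + n0)"
    have R: "0 \<le> R" "R \<le> R'" "R' < 1" "0 < R'"
      using rad incseqD[OF incseq_rad, of "n + n0" "Suc n + n0"]
        by (auto simp: R_def R'_def) (simp add: rad_def)
    have "of_real R * (of_real r * \<zeta>) = of_real R' * (of_real (R / R' * r) * \<zeta>)"
      using R by (simp add: field_simps)
    then have "\<kappa> < norm (h (of_real R' * (of_real (R / R' * r) * \<zeta>)))"
      using r(4) unfolding R_def[symmetric] by (simp only:)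
    moreover have "0 \<le> R / R' * r" using R r by simp
    moreover have "R / R' * r < 1" 
      using R r by (smt (verit, best) divide_le_eq_1_pos divide_nonneg_pos mult_left_le_one_le)
    ultimately show "\<zeta> \<in> S (Suc n)"
      using r(1) unfolding S_def R'_def[symmetric] mem_Collect_eq mem_sphere_0
      by (intro conjI bexI[of _ "R / R' * r"]) (simp_all only: atLeastLessThan_iff simp_thms)
  qed
  show thesis
  proof (rule that[of s "\<Union>n. S n"])
    show "0 \<le> s" "s < 1" using s by auto
    show "(\<Union>n. S n) \<in> sets borel" using S_sets by auto
    have "emeasure cm (\<Union>n. S n) = (SUP n. emeasure cm (S n))"
      using \<open>incseq S\<close> S_sets by (intro SUP_emeasure_incseq[symmetric]) auto
    also have "\<dots> \<le> ennreal \<epsilon>" using S_small by (intro SUP_least) auto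
    finally show "emeasure cm (\<Union>n. S n) \<le> ennreal \<epsilon>" .
    fix \<zeta> r assume *: "norm \<zeta> = 1" "\<zeta> \<notin> (\<Union>n. S n)" "0 \<le> (r::real)" "r < 1"
    obtain n where n: "r < rad n" using rad_large[OF *(4)] .
    then have n: "r < rad (n + n0)" by (rule rad_large_mono) simp
    define R where "R = rad (n + n0)"
    have "of_real R * (of_real (r / R) * \<zeta>) = of_real r * \<zeta>" "0 \<le> r / R" "r / R < 1"
      using n * by (auto simp: R_def)
    moreover have "\<zeta> \<notin> S n" using * by blast
    ultimately have "\<not> \<kappa> < norm (h (of_real r * \<zeta>))"
      using * unfolding S_def R_def[symmetric]
        by (metis (mono_tags, lifting) atLeastLessThan_iff mem_Collect_eq mem_sphere_0)
    then show "norm (f (of_real r * \<zeta>) - f (of_real (s * r) * \<zeta>)) \<le> \<kappa>"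
      by (simp add: h_def mult.assoc)
  qed
qed

text \<open>Exceptional sets of measure at most 1 / (n + 1) intersect in a null set. The dilation
  factor \<open>s\<close> may depend on the point, which is harmless for the existence of
  limits.\<close>

lemma AE_small_oscillation:
  assumes f: "disk_map f" and p: "1 < p"
    and M: "\<And>r. 0 \<le> r \<Longrightarrow> r < 1 \<Longrightarrow> (LINT \<zeta>|cm. norm (f (of_real r * \<zeta>)) powr p) \<le> M"
    and \<kappa>: "0 < \<kappa>"
  shows "AE \<zeta> in cm. \<exists>s. 0 \<le> s \<and> s < 1 \<and>
    (\<forall>r. 0 \<le> r \<longrightarrow> r < 1 \<longrightarrow> norm (f (of_real r * \<zeta>) - f (of_real (s * r) * \<zeta>)) \<le> \<kappa>)"
proof -
  have "\<exists>s N. 0 \<le> s \<and> s < 1 \<and> N \<in> sets borel \<and> emeasure cm N \<le> ennreal (1 / (real n + 1)) \<and>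
    (\<forall>\<zeta> r. norm \<zeta> = 1 \<longrightarrow> \<zeta> \<notin> N \<longrightarrow> 0 \<le> r \<longrightarrow> r < 1 \<longrightarrow>
      norm (f (of_real r * \<zeta>) - f (of_real (s * r) * \<zeta>)) \<le> \<kappa>)" for n
    using oscillation_set_small[OF f p M _ \<kappa>, of "1 / (real n + 1)"]
    by (metis (no_types, lifting) divide_pos_pos of_nat_0_le_iff add_nonneg_pos zero_less_one)
  then obtain s N where sN: "\<And>n. 0 \<le> s n \<and> s n < 1 \<and> N n \<in> sets borel \<and> emeasure cm (N n) \<le>
      ennreal (1 / (real n + 1)) \<and>
    (\<forall>\<zeta> r. norm \<zeta> = 1 \<longrightarrow> \<zeta> \<notin> N n \<longrightarrow> 0 \<le> r \<longrightarrow> r < 1 \<longrightarrow>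
      norm (f (of_real r * \<zeta>) - f (of_real (s n * r) * \<zeta>)) \<le> \<kappa>)"
    by metis
  have N: "(\<Inter>n. N n) \<in> sets borel" using sN by auto
  have "emeasure cm (\<Inter>n. N n) \<le> ennreal (1 / (real n + 1))" for n
    using sN[of n] by (intro order_trans[OF emeasure_mono[of "\<Inter>n. N n" "N n"]]) auto
  moreover have "(\<lambda>n. ennreal (1 / (real n + 1))) \<longlonglongrightarrow> ennreal 0"
    by (intro tendsto_ennrealI) real_asymp
  ultimately have "emeasure cm (\<Inter>n. N n) \<le> ennreal 0"
    by (intro tendsto_lowerbound[of "\<lambda>n. ennreal (1 / (real n + 1))"]) auto
  then have "(\<Inter>n. N n) \<in> null_sets cm" using N by (intro null_setsI) auto
  then have "AE \<zeta> in cm. \<zeta> \<notin> (\<Inter>n. N n)" by (rule AE_not_in)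
  then show ?thesis using AE_cm_norm
  proof eventually_elim
    case (elim \<zeta>)
    then obtain n where "\<zeta> \<notin> N n" by blast
    then show ?case using sN[of n] elim by blast
  qed
qed

text \<open>For fixed s < 1 the values f(s r \<zeta>) converge as r -> 1 by continuity inside the
  disk. As f(r \<zeta>) stays within e of them, its oscillation near r = 1 is at most 3 e, and e is
  arbitrary.\<close>

theorem Fatou_radial_limit:
  assumes f: "disk_map f" and p: "1 < p"
    and M: "\<And>r. 0 \<le> r \<Longrightarrow> r < 1 \<Longrightarrow> (LINT \<zeta>|cm. norm (f (of_real r * \<zeta>)) powr p) \<le> M"
  shows "AE \<zeta> in cm. ((\<lambda>r::real. f (of_real r * \<zeta>)) \<longlongrightarrow> bdry f \<zeta>) (at_left 1)"
proof -
  have "AE \<zeta> in cm. \<forall>m. \<exists>s. 0 \<le> s \<and> s < 1 \<and>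
    (\<forall>r. 0 \<le> r \<longrightarrow> r < 1 \<longrightarrow> norm (f (of_real r * \<zeta>) - f (of_real (s * r) * \<zeta>)) \<le>
        1 / (3 * (real m + 1)))"
    using AE_small_oscillation[OF f p M] by (subst AE_all_countable) (auto simp: add_nonneg_pos)
  then show ?thesis using AE_cm_norm
  proof eventually_elim
    case (elim \<zeta>)
    let ?g = "\<lambda>r::real. f (of_real r * \<zeta>)"
    have "\<exists>l. (?g \<longlongrightarrow> l) (at_left 1)"
      unfolding left_limit_iff_Cauchy
    proof
      fix m :: nat
      define e where "e = 1 / (3 * (real m + 1))"
      have e: "0 < e" by (simp add: e_def)
      obtain s where s: "0 \<le> s" "s < 1" "\<And>r. 0 \<le> r \<Longrightarrow> r < 1 \<Longrightarrow> norm (?g r - ?g (s * r)) \<le> e"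
        using elim unfolding e_def by blast
      have "isCont f (of_real s * \<zeta>)"
        using holomorphic_on_imp_continuous_on[OF disk_mapD[OF f]] s elim
        by (simp add: continuous_on_eq_continuous_at norm_mult)
      moreover have "((\<lambda>r::real. of_real (s * r) * \<zeta>) \<longlongrightarrow> of_real (s * 1) * \<zeta>) (at_left 1)"
        by (intro tendsto_intros)
      ultimately have "((\<lambda>r. ?g (s * r)) \<longlongrightarrow> ?g s) (at_left 1)"
        by (intro isCont_tendsto_compose[of "of_real s * \<zeta>" f]) auto
      then have "eventually (\<lambda>r. dist (?g (s * r)) (?g s) < e / 2) (at_left 1)"
        by (rule tendstoD) (use e in auto)
      then obtain b where b: "b < 1" "\<And>r. b < r \<Longrightarrow> r < 1 \<Longrightarrow> dist (?g (s * r)) (?g s) < e / 2"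
        by (subst (asm) eventually_at_left[of "0::real" 1]) auto
      obtain n where n: "b < rad n" using rad_large[OF b(1)] .
      have "norm (?g r - ?g t) \<le> 1 / (real m + 1)" if rt: "r \<in> {rad n..<1}"
          "t \<in> {rad n..<1}" for r t
      proof -
        have r0: "0 \<le> r" "0 \<le> t" "b < r" "b < t" "r < 1" "t < 1" using rt n rad(1)[of n] by auto
        have "norm (?g r - ?g t) = norm ((?g r - ?g (s * r)) + (?g (s * r) - ?g s) - (?g (s * t) -
            ?g s) - (?g t - ?g (s * t)))"
          by (simp add: algebra_simps)
        also have "\<dots> \<le> norm (?g r - ?g (s * r)) + norm (?g (s * r) - ?g s) + norm (?g (s * t) - ?g
            s) + norm (?g t - ?g (s * t))"
          by (intro order_trans[OF norm_triangle_ineq4] add_mono norm_triangle_ineq order_refl)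
        also have "\<dots> \<le> e + e / 2 + e / 2 + e"
          using s(3)[of r] s(3)[of t] b(2)[of r] b(2)[of t] r0
            by (intro add_mono) (auto simp: dist_norm)
        also have "\<dots> = 3 * e" by simp
        also have "\<dots> = 1 / (real m + 1)" by (simp add: e_def divide_simps)
        finally show ?thesis .
      qed
      then show "\<exists>n. \<forall>r\<in>{rad n..<1}. \<forall>t\<in>{rad n..<1}. norm (?g r - ?g t) \<le> 1 / (real m + 1)" by blast
    qed
    then obtain l where l: "(?g \<longlongrightarrow> l) (at_left 1)" by blast
    with tendsto_bdry[OF l] show ?case by simp
  qed
qed

section \<open>Boundary values of Hardy functions and the pairing\<close>

lemma hardyD:
  assumes "f \<in> hardy p"
  shows "f \<in> disk_holo" "disk_map f" "\<And>z. 1 \<le> norm z \<Longrightarrow> f z = 0"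
  using assms disk_holo_disk_map by (auto simp: hardy_def disk_holo_def)

lemma hardyI:
  assumes "f \<in> disk_holo" "\<And>r. 0 \<le> r \<Longrightarrow> r < 1 \<Longrightarrow> integral_mean p f r \<le> M"
  shows "f \<in> hardy p"
  using assms by (auto simp: hardy_def intro!: bdd_aboveI[of _ M])

lemma integral_mean_nonneg: "0 \<le> integral_mean p f r"
  unfolding integral_mean_def by (rule Bochner_Integration.integral_nonneg) simp

lemma hardy_norm_nonneg: "0 \<le> hardy_norm p f"
  by (simp add: hardy_norm_def)

lemma hardy_norm_powr:
  assumes f: "f \<in> hardy p" and p: "0 < p"
  shows "hardy_norm p f powr p = (SUP r\<in>{0..<1}. integral_mean p f r)"
proof -
  have "integral_mean p f 0 \<le> (SUP r\<in>{0..<1}. integral_mean p f r)"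
    using f by (intro cSUP_upper) (auto simp: hardy_def)
  then have "0 \<le> (SUP r\<in>{0..<1}. integral_mean p f r)"
    using integral_mean_nonneg order_trans by blast
  then show ?thesis using p by (simp add: hardy_norm_def powr_powr)
qed

lemma integral_mean_le_hardy_norm:
  assumes f: "f \<in> hardy p" and p: "0 < p" and r: "0 \<le> r" "r < 1"
  shows "integral_mean p f r \<le> hardy_norm p f powr p"
  unfolding hardy_norm_powr[OF f p] using f r by (intro cSUP_upper) (auto simp: hardy_def)

lemma hardy_norm_leI:
  assumes p: "0 < p" and M: "0 \<le> M" "\<And>r. 0 \<le> r \<Longrightarrow> r < 1 \<Longrightarrow> integral_mean p f r \<le> M powr p"
  shows "hardy_norm p f \<le> M"
proof -
  have le: "(SUP r\<in>{0..<1}. integral_mean p f r) \<le> M powr p"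
    using M by (intro cSUP_least) auto
  have "bdd_above (integral_mean p f ` {0..<1})"
    using M by (auto intro!: bdd_aboveI[of _ "M powr p"])
  then have "integral_mean p f 0 \<le> (SUP r\<in>{0..<1}. integral_mean p f r)"
    by (intro cSUP_upper) auto
  then have "0 \<le> (SUP r\<in>{0..<1}. integral_mean p f r)"
    using integral_mean_nonneg order_trans by blast
  then have "hardy_norm p f \<le> (M powr p) powr (1 / p)"
    unfolding hardy_norm_def using le p by (intro powr_mono2) auto
  also have "\<dots> = M" using p M by (simp add: powr_powr)
  finally show ?thesis .
qed

text \<open>Since a + b is at most twice the maximum. This crude bound is what closure of
  \<open>hardy p\<close> under linear combinations rests on.\<close>

lemma powr_add_le:
  fixes a b p :: real
  assumes "0 \<le> a" "0 \<le> b" "0 \<le> p"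
  shows "(a + b) powr p \<le> 2 powr p * (a powr p + b powr p)"
proof -
  have "(a + b) powr p \<le> (2 * max a b) powr p"
    using assms by (intro powr_mono2) auto
  also have "\<dots> = 2 powr p * max a b powr p" using assms by (simp add: powr_mult)
  also have "\<dots> \<le> 2 powr p * (a powr p + b powr p)"
    by (intro mult_left_mono) (auto simp: max_def)
  finally show ?thesis .
qed

lemma disk_holo_lincomb:
  assumes "f \<in> disk_holo" "g \<in> disk_holo"
  shows "(\<lambda>z. c * f z + d * g z) \<in> disk_holo"
  using assms by (auto simp: disk_holo_def intro!: holomorphic_intros)

lemma disk_holo_mult:
  assumes "f \<in> disk_holo" "g \<in> disk_holo"
  shows "(\<lambda>z. f z * g z) \<in> disk_holo"
  using assms by (auto simp: disk_holo_def intro!: holomorphic_intros)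

lemma hardy_lincomb:
  assumes f: "f \<in> hardy p" and g: "g \<in> hardy p" and p: "0 < p"
  shows "(\<lambda>z. c * f z + d * g z) \<in> hardy p"
proof (rule hardyI)
  show "(\<lambda>z. c * f z + d * g z) \<in> disk_holo"
    by (intro disk_holo_lincomb hardyD(1)[OF f] hardyD(1)[OF g])
  fix r :: real assume r: "0 \<le> r" "r < 1"
  let ?a = "\<lambda>\<zeta>. norm (f (of_real r * \<zeta>)) powr p" and ?b = "\<lambda>\<zeta>. norm (g (of_real r * \<zeta>)) powr p"
  have i: "integrable cm ?a" "integrable cm ?b"
    using f g p r by (auto intro!: integrable_powr_dilate hardyD)
  have "integral_mean p (\<lambda>z. c * f z + d * g z) r \<le>
    (LINT \<zeta>|cm. 2 powr p * (norm c powr p * ?a \<zeta> + norm d powr p * ?b \<zeta>))"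
    unfolding integral_mean_def
  proof (rule integral_mono')
    show "integrable cm (\<lambda>\<zeta>. 2 powr p * (norm c powr p * ?a \<zeta> + norm d powr p * ?b \<zeta>))"
      using i by auto
    fix \<zeta>
    have "norm (c * f (of_real r * \<zeta>) + d * g (of_real r * \<zeta>)) powr p
      \<le> (norm c * norm (f (of_real r * \<zeta>)) + norm d * norm (g (of_real r * \<zeta>))) powr p"
      using p by (intro powr_mono2) (auto simp flip: norm_mult intro: norm_triangle_ineq)
    also have "\<dots> \<le> 2 powr p * ((norm c * norm (f (of_real r * \<zeta>))) powr p + (norm d * norm (g
        (of_real r * \<zeta>))) powr p)"
      using p by (intro powr_add_le) auto
    finally show "norm (c * f (of_real r * \<zeta>) + d * g (of_real r * \<zeta>)) powr p \<le>
        2 powr p * (norm c powr p * ?a \<zeta> + norm d powr p * ?b \<zeta>)"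
      by (simp add: powr_mult)
  qed simp
  also have "\<dots> = 2 powr p * (norm c powr p * integral_mean p f r + norm d powr p * integral_mean p
      g r)"
    using i by (simp add: integral_mean_def)
  also have "\<dots> \<le> 2 powr p * (norm c powr p * hardy_norm p f powr p + norm d powr p * hardy_norm p
      g powr p)"
    using f g p r by (intro mult_left_mono add_mono integral_mean_le_hardy_norm) auto
  finally show "integral_mean p (\<lambda>z. c * f z + d * g z) r \<le> \<dots>" .
qed

lemma hardy_diff:
  assumes "f \<in> hardy p" "g \<in> hardy p" "0 < p"
  shows "(\<lambda>z. f z - g z) \<in> hardy p"
  using hardy_lincomb[OF assms, of 1 "-1"] by simp

lemma hardy_sum:
  assumes "finite K" "\<And>k. k \<in> K \<Longrightarrow> f k \<in> hardy p" "0 < p"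
  shows "(\<lambda>z. \<Sum>k\<in>K. c k * f k z) \<in> hardy p"
  using assms(1,2)
proof (induction K)
  case empty
  show ?case using assms(3)
    by (auto intro!: hardyI[where M=0] simp: disk_holo_def integral_mean_def)
next
  case (insert k K)
  then show ?case
    using hardy_lincomb[of "f k" p "\<lambda>z. \<Sum>k\<in>K. c k * f k z" "c k" 1] assms(3) by simp
qed

lemma hardy_bounded_mult:
  assumes u: "u \<in> disk_holo" "\<And>z. norm z < 1 \<Longrightarrow> norm (u z) \<le> B" and f: "f \<in> hardy p" and p: "0 < p"
  shows "(\<lambda>z. u z * f z) \<in> hardy p" "hardy_norm p (\<lambda>z. u z * f z) \<le> B * hardy_norm p f"
proof -
  have B: "0 \<le> B" using u(2)[of 0] by (intro order_trans[OF norm_ge_zero]) auto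
  have le: "integral_mean p (\<lambda>z. u z * f z) r \<le> (B * hardy_norm p f) powr p" if r: "0 \<le>
      r" "r < 1" for r
  proof -
    have "integral_mean p (\<lambda>z. u z * f z) r \<le> (LINT \<zeta>|cm. B powr p * norm (f (of_real r * \<zeta>)) powr
        p)"
      unfolding integral_mean_def
    proof (rule integral_mono_AE)
      show "integrable cm (\<lambda>\<zeta>. B powr p * norm (f (of_real r * \<zeta>)) powr p)"
        using r p by (intro integrable_mult_right integrable_powr_dilate hardyD(2)[OF f]) auto
      show "integrable cm (\<lambda>\<zeta>. norm (u (of_real r * \<zeta>) * f (of_real r * \<zeta>)) powr p)"
        using r p by (intro integrable_powr_dilate[of "\<lambda>z. u z * f z"] disk_map_intros
            hardyD(2)[OF f] disk_holo_disk_map u) auto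
      show "AE \<zeta> in cm. norm (u (of_real r * \<zeta>) * f (of_real r * \<zeta>)) powr p \<le>
          B powr p * norm (f (of_real r * \<zeta>)) powr p"
        using AE_cm_norm
      proof eventually_elim
        case (elim \<zeta>)
        then have "norm (u (of_real r * \<zeta>)) \<le> B" using r by (intro u) (simp add: norm_mult)
        then have "norm (u (of_real r * \<zeta>) * f (of_real r * \<zeta>)) powr p \<le>
            (B * norm (f (of_real r * \<zeta>))) powr p"
          using p by (intro powr_mono2) (auto simp: norm_mult mult_right_mono)
        then show ?case using B by (simp add: powr_mult)
      qed
    qed
    also have "\<dots> = B powr p * integral_mean p f r"
      by (simp add: integral_mean_def)
    also have "\<dots> \<le> B powr p * hardy_norm p f powr p"
      using f p r by (intro mult_left_mono integral_mean_le_hardy_norm) auto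
    also have "\<dots> = (B * hardy_norm p f) powr p"
      using B by (simp add: powr_mult hardy_norm_nonneg)
    finally show ?thesis .
  qed
  show "(\<lambda>z. u z * f z) \<in> hardy p"
    by (rule hardyI[OF disk_holo_mult[OF u(1) hardyD(1)[OF f]] le])
  show "hardy_norm p (\<lambda>z. u z * f z) \<le> B * hardy_norm p f"
    by (rule hardy_norm_leI[OF p _ le]) (simp_all add: B hardy_norm_nonneg)
qed

lemma hardy_bounded:
  assumes u: "u \<in> disk_holo" "\<And>z. norm z < 1 \<Longrightarrow> norm (u z) \<le> B" and p: "0 < p"
  shows "u \<in> hardy p"
proof -
  \<comment> \<open>The representative of the constant 1, which has to vanish off the disk.\<close>
  let ?i = "\<lambda>z. if z \<in> ball 0 1 then 1 else 0 :: complex"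
  have "?i holomorphic_on ball 0 1"
    by (rule holomorphic_transform[OF holomorphic_on_const[of 1]]) auto
  then have i: "?i \<in> disk_holo" by (auto simp: disk_holo_def)
  have "?i \<in> hardy p"
  proof (rule hardyI[OF i])
    fix r :: real assume r: "0 \<le> r" "r < 1"
    have "integral_mean p ?i r \<le> (LINT \<zeta>|cm. 1)"
      unfolding integral_mean_def by (rule integral_mono') auto
    then show "integral_mean p ?i r \<le> 1" using cm.prob_space by simp
  qed
  from hardy_bounded_mult(1)[OF u this p] have "(\<lambda>z. u z * ?i z) \<in> hardy p" .
  also have "(\<lambda>z. u z * ?i z) = u" using u(1) by (auto simp: disk_holo_def)
  finally show ?thesis .
qed

lemma hardy_radial_limit:
  assumes f: "f \<in> hardy p" and p: "1 < p"
  shows "AE \<zeta> in cm. ((\<lambda>r::real. f (of_real r * \<zeta>)) \<longlongrightarrow> bdry f \<zeta>) (at_left 1)"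
proof (rule Fatou_radial_limit[OF hardyD(2)[OF f] p])
  fix r :: real assume "0 \<le> r" "r < 1"
  then show "(LINT \<zeta>|cm. norm (f (of_real r * \<zeta>)) powr p) \<le> hardy_norm p f powr p"
    using integral_mean_le_hardy_norm[OF f] p by (simp add: integral_mean_def)
qed

lemma hardy_bdry_borel [measurable_dest]:
  "f \<in> hardy p \<Longrightarrow> bdry f \<in> borel_measurable borel"
  by (rule bdry_borel[OF hardyD(1)])

text \<open>Fatou's lemma along the radii \<open>rad n\<close>, the integrands converging almost
  everywhere by \<open>hardy_radial_limit\<close>.\<close>

lemma hardy_bdry_norm:
  assumes f: "f \<in> hardy p" and p: "1 < p"
  shows "integrable cm (\<lambda>\<zeta>. norm (bdry f \<zeta>) powr p)"
    and "(LINT \<zeta>|cm. norm (bdry f \<zeta>) powr p) \<le> hardy_norm p f powr p"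
proof -
  note [measurable] = hardy_bdry_borel[OF f] borel_measurable_dilate[OF hardyD(2)[OF f]]
  let ?u = "\<lambda>n \<zeta>. ennreal (norm (f (of_real (rad n) * \<zeta>)) powr p)"
  have "(\<integral>\<^sup>+\<zeta>. ennreal (norm (bdry f \<zeta>) powr p) \<partial>cm) = (\<integral>\<^sup>+\<zeta>. liminf (\<lambda>n. ?u n \<zeta>) \<partial>cm)"
  proof (rule nn_integral_cong_AE)
    show "AE \<zeta> in cm. ennreal (norm (bdry f \<zeta>) powr p) = liminf (\<lambda>n. ?u n \<zeta>)"
      using hardy_radial_limit[OF f p]
    proof eventually_elim
      case (elim \<zeta>)
      then have "(\<lambda>n. f (of_real (rad n) * \<zeta>)) \<longlonglongrightarrow> bdry f \<zeta>"
        by (rule filterlim_compose[OF _ rad_at_left])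
      then have "(\<lambda>n. ?u n \<zeta>) \<longlonglongrightarrow> ennreal (norm (bdry f \<zeta>) powr p)"
        using p by (intro tendsto_ennrealI tendsto_powr' tendsto_norm tendsto_const) auto
      then show ?case using lim_imp_Liminf[of sequentially] by force
    qed
  qed
  also have "\<dots> \<le> liminf (\<lambda>n. \<integral>\<^sup>+\<zeta>. ?u n \<zeta> \<partial>cm)"
    by (rule nn_integral_liminf) measurable
  also have "\<dots> \<le> ennreal (hardy_norm p f powr p)"
  proof (rule order_trans[OF Liminf_mono[of _ "\<lambda>_. ennreal (hardy_norm p f powr p)"]])
    have "(\<integral>\<^sup>+\<zeta>. ?u n \<zeta> \<partial>cm) \<le> ennreal (hardy_norm p f powr p)" for n
      using integral_mean_le_hardy_norm[OF f, of "rad n"] p rad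
      by (subst nn_integral_eq_integral) (auto simp: integral_mean_def intro!: ennreal_leI
          integrable_powr_dilate hardyD[OF f])
    then show "eventually (\<lambda>n. (\<integral>\<^sup>+\<zeta>. ?u n \<zeta> \<partial>cm) \<le> ennreal (hardy_norm p f powr p)) sequentially"
      by simp
  qed (simp add: Liminf_const)
  finally have le: "(\<integral>\<^sup>+\<zeta>. ennreal (norm (bdry f \<zeta>) powr p) \<partial>cm) \<le>
      ennreal (hardy_norm p f powr p)" .
  then show int: "integrable cm (\<lambda>\<zeta>. norm (bdry f \<zeta>) powr p)"
    by (intro integrableI_nonneg) (auto simp: le_less_trans[OF le])
  show "(LINT \<zeta>|cm. norm (bdry f \<zeta>) powr p) \<le> hardy_norm p f powr p"
    using le by (subst (asm) nn_integral_eq_integral[OF int]) auto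
qed

section \<open>Hoelder's inequality and sesquilinearity of the pairing\<close>

lemma conjugate_exponent_gt_1:
  fixes p q :: real
  assumes "1 < p" "1 / p + 1 / q = 1"
  shows "1 < q"
proof -
  have "1 / p < 1" "0 < 1 / p" using assms(1) by auto
  then have "0 < 1 / q" "1 / q < 1" using assms(2) by linarith+
  then show ?thesis by (simp add: divide_less_eq split: if_splits)
qed

text \<open>Young's inequality is applied to the boundary moduli divided by a and b. These are the
  Hardy norms enlarged by e > 0, so that a vanishing norm causes no division by zero; then e ->
  0.\<close>

lemma pairing_Hoelder:
  assumes f: "f \<in> hardy p" and g: "g \<in> hardy q" and p: "1 < p" "1 / p + 1 / q = 1"
  shows "integrable cm (\<lambda>\<zeta>. bdry f \<zeta> * cnj (bdry g \<zeta>))"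
    and "norm (pairing f g) \<le> hardy_norm p f * hardy_norm q g"
proof -
  note q = conjugate_exponent_gt_1[OF p]
  note [measurable] = hardy_bdry_borel[OF f] hardy_bdry_borel[OF g]
  note F = hardy_bdry_norm[OF f p(1)] and G = hardy_bdry_norm[OF g q]
  have bound: "norm (bdry f \<zeta> * cnj (bdry g \<zeta>)) \<le> a * b *
      ((1 / (p * a powr p)) * norm (bdry f \<zeta>) powr p + (1 / (q * b powr q)) * norm (bdry g \<zeta>) powr
          q)"
    if "0 < a" "0 < b" for a b \<zeta>
  proof -
    have "norm (bdry f \<zeta>) / a * (norm (bdry g \<zeta>) / b) \<le>
       (norm (bdry f \<zeta>) / a) powr p / p + (norm (bdry g \<zeta>) / b) powr q / q"
      using p q that by (intro Youngs_inequality) auto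
    then have "a * b * (norm (bdry f \<zeta>) / a * (norm (bdry g \<zeta>) / b)) \<le>
       a * b * ((norm (bdry f \<zeta>) / a) powr p / p + (norm (bdry g \<zeta>) / b) powr q / q)"
      using that by (intro mult_left_mono) auto
    then show ?thesis using that by (simp add: norm_mult powr_divide mult_ac)
  qed
  have ir: "integrable cm (\<lambda>\<zeta>. a * b *
      ((1 / (p * a powr p)) * norm (bdry f \<zeta>) powr p + (1 / (q * b powr q)) * norm (bdry g \<zeta>) powr
          q))" for a b
    using F(1) G(1) by auto
  show int: "integrable cm (\<lambda>\<zeta>. bdry f \<zeta> * cnj (bdry g \<zeta>))"
    by (rule Bochner_Integration.integrable_bound[OF ir[of 1 1]]) (use bound[of 1 1] in \<open>auto
        intro: order_trans[OF _ abs_ge_self]\<close>)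
  let ?A = "hardy_norm p f" and ?B = "hardy_norm q g"
  have le: "norm (pairing f g) \<le> (?A + e) * (?B + e)" if e: "0 < e" for e
  proof -
    let ?a = "?A + e" and ?b = "?B + e"
    have ab: "0 < ?a" "0 < ?b" using e hardy_norm_nonneg[of p f] hardy_norm_nonneg[of q g] by auto
    have "norm (pairing f g) \<le> (LINT \<zeta>|cm. norm (bdry f \<zeta> * cnj (bdry g \<zeta>)))"
      unfolding pairing_def by (rule integral_norm_bound)
    also have "\<dots> \<le> (LINT \<zeta>|cm. ?a * ?b *
      ((1 / (p * ?a powr p)) * norm (bdry f \<zeta>) powr p + (1 / (q * ?b powr q)) * norm (bdry g \<zeta>)
          powr q))"
      by (rule integral_mono[OF _ ir bound[OF ab]]) (use int in auto)
    also have "\<dots> = ?a * ?b * ((1 / (p * ?a powr p)) * (LINT \<zeta>|cm. norm (bdry f \<zeta>) powr p) +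
        (1 / (q * ?b powr q)) * (LINT \<zeta>|cm. norm (bdry g \<zeta>) powr q))"
      using F(1) G(1) by simp
    also have "\<dots> \<le> ?a * ?b * ((1 / (p * ?a powr p)) * ?a powr p + (1 / (q * ?b powr q)) * ?b powr
        q)"
    proof (intro mult_left_mono add_mono)
      show "(LINT \<zeta>|cm. norm (bdry f \<zeta>) powr p) \<le> ?a powr p"
        by (rule order_trans[OF F(2) powr_mono2]) (use e p hardy_norm_nonneg in auto)
      show "(LINT \<zeta>|cm. norm (bdry g \<zeta>) powr q) \<le> ?b powr q"
        by (rule order_trans[OF G(2) powr_mono2]) (use e q hardy_norm_nonneg in auto)
    qed (use p q ab in auto)
    also have "\<dots> = ?a * ?b * (1 / p + 1 / q)" using ab p q by simp
    finally show ?thesis using p by simp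
  qed
  have "((\<lambda>e. (?A + e) * (?B + e)) \<longlongrightarrow> (?A + 0) * (?B + 0)) (at_right 0)"
    by (intro tendsto_intros)
  moreover have "eventually (\<lambda>e. norm (pairing f g) \<le> (?A + e) * (?B + e)) (at_right 0)"
    using le by (auto simp: eventually_at_filter)
  ultimately show "norm (pairing f g) \<le> ?A * ?B"
    by (intro tendsto_lowerbound[of "\<lambda>e. (?A + e) * (?B + e)" _ "at_right 0"]) auto
qed

lemma bdry_lincomb:
  assumes "f \<in> hardy p" "g \<in> hardy p" "1 < p"
  shows "AE \<zeta> in cm. bdry (\<lambda>z. c * f z + d * g z) \<zeta> = c * bdry f \<zeta> + d * bdry g \<zeta>"
  using hardy_radial_limit[OF assms(1,3)] hardy_radial_limit[OF assms(2,3)]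
  by eventually_elim (rule tendsto_bdry, intro tendsto_intros)

lemma bdry_mult:
  assumes "f \<in> hardy p" "g \<in> hardy q" "1 < p" "1 < q"
  shows "AE \<zeta> in cm. bdry (\<lambda>z. f z * g z) \<zeta> = bdry f \<zeta> * bdry g \<zeta>"
  using hardy_radial_limit[OF assms(1,3)] hardy_radial_limit[OF assms(2,4)]
  by eventually_elim (rule tendsto_bdry, intro tendsto_intros)

lemma pairing_lincomb_left:
  assumes f: "f \<in> hardy p" and g: "g \<in> hardy p" and h: "h \<in> hardy q" and p: "1 < p"
      "1 / p + 1 / q = 1"
  shows "pairing (\<lambda>z. c * f z + d * g z) h = c * pairing f h + d * pairing g h"
proof -
  have p0: "0 < p" using p by simp
  note [measurable] = hardy_bdry_borel[OF f] hardy_bdry_borel[OF g] hardy_bdry_borel[OF h]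
    hardy_bdry_borel[OF hardy_lincomb[OF f g p0, of c d]]
  have "pairing (\<lambda>z. c * f z + d * g z) h =
      (LINT \<zeta>|cm. c * (bdry f \<zeta> * cnj (bdry h \<zeta>)) + d * (bdry g \<zeta> * cnj (bdry h \<zeta>)))"
    unfolding pairing_def
  proof (rule integral_cong_AE)
    show "AE \<zeta> in cm. bdry (\<lambda>z. c * f z + d * g z) \<zeta> * cnj (bdry h \<zeta>) =
       c * (bdry f \<zeta> * cnj (bdry h \<zeta>)) + d * (bdry g \<zeta> * cnj (bdry h \<zeta>))"
      using bdry_lincomb[OF f g p(1), of c d] by eventually_elim (simp add: algebra_simps)
  qed measurable
  also have "\<dots> = c * pairing f h + d * pairing g h"
    using pairing_Hoelder(1)[OF f h p] pairing_Hoelder(1)[OF g h p] by (simp add: pairing_def)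
  finally show ?thesis .
qed

lemma pairing_commute: "pairing g f = cnj (pairing f g)"
  unfolding pairing_def by (subst integral_cm_cnj[symmetric]) (simp add: mult.commute)

lemma pairing_diff_left:
  assumes "f \<in> hardy p" "g \<in> hardy p" "h \<in> hardy q" "1 < p" "1 / p + 1 / q = 1"
  shows "pairing (\<lambda>z. f z - g z) h = pairing f h - pairing g h"
  using pairing_lincomb_left[OF assms, of 1 "-1"] by simp

text \<open>The dilates converge to the boundary function in L^1: they are Cauchy in mean, and
  Fatou's lemma lets one of the two radii tend to 1. The n-th Fourier coefficient of the dilate by r
  is r^n times the Taylor coefficient.\<close>

lemma hardy_bdry_coeff:
  assumes f: "f \<in> hardy p" and p: "1 < p"
  shows "(LINT \<zeta>|cm. bdry f \<zeta> * cnj \<zeta> ^ n) = taylor f n"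
proof -
  note [measurable] = hardy_bdry_borel[OF f] borel_measurable_dilate[OF hardyD(2)[OF f]]
  note dm = hardyD(2)[OF f]
  have M: "(LINT \<zeta>|cm. norm (f (of_real r * \<zeta>)) powr p) \<le> hardy_norm p f powr p" if "0 \<le>
      r" "r < 1" for r
    using integral_mean_le_hardy_norm[OF f] p that by (simp add: integral_mean_def)
  have ib: "integrable cm (bdry f)"
  proof (rule Bochner_Integration.integrable_bound[of _ "\<lambda>\<zeta>. 1 + norm (bdry f \<zeta>) powr p"])
    show "integrable cm (\<lambda>\<zeta>. 1 + norm (bdry f \<zeta>) powr p)"
      using hardy_bdry_norm(1)[OF f p] by auto
    have "x \<le> 1 + x powr p" if "0 \<le> x" for x :: real
    proof (cases "x \<le> 1")
      case False
      then have "x powr 1 \<le> x powr p" using p by (intro powr_mono) auto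
      then show ?thesis using False by simp
    qed (simp add: add_increasing2)
    then show "AE \<zeta> in cm. norm (bdry f \<zeta>) \<le> norm (1 + norm (bdry f \<zeta>) powr p)" by auto
  qed measurable
  have ir: "integrable cm (\<lambda>\<zeta>. f (of_real r * \<zeta>))" if "0 \<le> r" "r < 1" for r
    by (rule integrable_dilate_complex[OF dm that])
  have close: "norm ((LINT \<zeta>|cm. bdry f \<zeta> * cnj \<zeta> ^ n) - taylor f n * of_real (rad k) ^ n) \<le>
      (LINT \<zeta>|cm. norm (f (of_real (rad k) * \<zeta>) - bdry f \<zeta>))" for k
  proof -
    have c: "integrable cm (\<lambda>\<zeta>. u \<zeta> * cnj \<zeta> ^ n)" if "integrable cm u" for u :: "complex \<Rightarrow> complex"
    proof (rule Bochner_Integration.integrable_bound[OF that])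
      show "AE \<zeta> in cm. norm (u \<zeta> * cnj \<zeta> ^ n) \<le> norm (u \<zeta>)"
        using AE_cm_norm by eventually_elim (simp add: norm_mult norm_power)
    qed (use that in measurable)
    have "(LINT \<zeta>|cm. bdry f \<zeta> * cnj \<zeta> ^ n) - taylor f n * of_real (rad k) ^ n =
       (LINT \<zeta>|cm. bdry f \<zeta> * cnj \<zeta> ^ n) - (LINT \<zeta>|cm. f (of_real (rad k) * \<zeta>) * cnj \<zeta> ^ n)"
      using dilate_coeff_pow[OF dm rad[of k], of 1 n] by simp
    also have "\<dots> = (LINT \<zeta>|cm. bdry f \<zeta> * cnj \<zeta> ^ n - f (of_real (rad k) * \<zeta>) * cnj \<zeta> ^ n)"
      using c[OF ib] c[OF ir[OF rad[of k]]] by simp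
    also have "norm \<dots> \<le> (LINT \<zeta>|cm. norm (bdry f \<zeta> * cnj \<zeta> ^ n - f (of_real (rad k) * \<zeta>) * cnj \<zeta> ^
        n))"
      by (rule integral_norm_bound)
    also have "\<dots> = (LINT \<zeta>|cm. norm (f (of_real (rad k) * \<zeta>) - bdry f \<zeta>))"
    proof (rule integral_cm_cong)
      fix \<zeta> :: complex assume "norm \<zeta> = 1"
      moreover have "bdry f \<zeta> * cnj \<zeta> ^ n - f (of_real (rad k) * \<zeta>) * cnj \<zeta> ^ n =
          (bdry f \<zeta> - f (of_real (rad k) * \<zeta>)) * cnj \<zeta> ^ n"
        by (simp add: algebra_simps)
      ultimately show "norm (bdry f \<zeta> * cnj \<zeta> ^ n - f (of_real (rad k) * \<zeta>) * cnj \<zeta> ^ n) =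
          norm (f (of_real (rad k) * \<zeta>) - bdry f \<zeta>)"
        by (simp only: norm_mult norm_power complex_mod_cnj power_one mult_1_right
            norm_minus_commute)
    qed measurable
    finally show ?thesis .
  qed
  have lim: "(\<lambda>k. LINT \<zeta>|cm. norm (f (of_real (rad k) * \<zeta>) - bdry f \<zeta>)) \<longlonglongrightarrow> 0"
  proof (rule LIMSEQ_I)
    fix e :: real assume e: "0 < e"
    obtain r0 where r0: "0 \<le> r0" "r0 < 1"
      "\<And>s t. r0 \<le> s \<Longrightarrow> s < 1 \<Longrightarrow> r0 \<le> t \<Longrightarrow> t < 1 \<Longrightarrow>
        (LINT \<zeta>|cm. norm (f (of_real s * \<zeta>) - f (of_real t * \<zeta>))) \<le> e / 2"
      using dilates_Cauchy_L1[OF dm p M, of "e / 2"] e by auto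
    obtain m where m: "r0 < rad m" using rad_large[OF r0(2)] .
    have "(LINT \<zeta>|cm. norm (f (of_real (rad k) * \<zeta>) - bdry f \<zeta>)) \<le> e / 2" if k: "m \<le> k" for k
    proof -
      let ?u = "\<lambda>j \<zeta>. ennreal (norm (f (of_real (rad k) * \<zeta>) - f (of_real (rad j) * \<zeta>)))"
      have id: "integrable cm (\<lambda>\<zeta>. f (of_real (rad k) * \<zeta>) - f (of_real (rad j) * \<zeta>))" for j
        using ir[OF rad[of k]] ir[OF rad[of j]] by simp
      have "ennreal (LINT \<zeta>|cm. norm (f (of_real (rad k) * \<zeta>) - bdry f \<zeta>)) =
          (\<integral>\<^sup>+\<zeta>. ennreal (norm (f (of_real (rad k) * \<zeta>) - bdry f \<zeta>)) \<partial>cm)"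
        using ir[OF rad[of k]] ib by (subst integral_norm_eq_nn_integral) auto
      also have "\<dots> = (\<integral>\<^sup>+\<zeta>. liminf (\<lambda>j. ?u j \<zeta>) \<partial>cm)"
      proof (rule nn_integral_cong_AE)
        show "AE \<zeta> in cm. ennreal (norm (f (of_real (rad k) * \<zeta>) - bdry f \<zeta>)) = liminf (\<lambda>j. ?u j \<zeta>)"
          using hardy_radial_limit[OF f p]
        proof eventually_elim
          case (elim \<zeta>)
          then have "(\<lambda>n. f (of_real (rad n) * \<zeta>)) \<longlonglongrightarrow> bdry f \<zeta>"
            by (rule filterlim_compose[OF _ rad_at_left])
          then have "(\<lambda>j. ?u j \<zeta>) \<longlonglongrightarrow> ennreal (norm (f (of_real (rad k) * \<zeta>) - bdry f \<zeta>))"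
            by (intro tendsto_ennrealI tendsto_norm tendsto_diff tendsto_const)
          then show ?case using lim_imp_Liminf[of sequentially] by force
        qed
      qed
      also have "\<dots> \<le> liminf (\<lambda>j. \<integral>\<^sup>+\<zeta>. ?u j \<zeta> \<partial>cm)"
        by (rule nn_integral_liminf) measurable
      also have "\<dots> \<le> ennreal (e / 2)"
      proof (rule order_trans[OF Liminf_mono[of _ "\<lambda>_. ennreal (e / 2)"]])
        show "eventually (\<lambda>j. (\<integral>\<^sup>+\<zeta>. ?u j \<zeta> \<partial>cm) \<le> ennreal (e / 2)) sequentially"
          using eventually_ge_at_top[of m]
        proof eventually_elim
          case (elim j)
          have "(\<integral>\<^sup>+\<zeta>. ?u j \<zeta> \<partial>cm) = ennreal (LINT \<zeta>|cm. norm (f (of_real (rad k) * \<zeta>) - f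
              (of_real (rad j) * \<zeta>)))"
            by (rule integral_norm_eq_nn_integral[OF id])
          also have "\<dots> \<le> ennreal (e / 2)"
            using rad_large_mono[OF m k] rad_large_mono[OF m elim] rad
              by (intro ennreal_leI r0) auto
          finally show ?case .
        qed
      qed (simp add: Liminf_const)
      finally show ?thesis using e by (subst (asm) ennreal_le_iff) auto
    qed
    then have "norm ((LINT \<zeta>|cm. norm (f (of_real (rad k) * \<zeta>) - bdry f \<zeta>)) - 0) < e" if k: "m \<le>
        k" for k
      using that e by (force intro: le_less_trans)
    then show "\<exists>m. \<forall>k\<ge>m. norm ((LINT \<zeta>|cm. norm (f (of_real (rad k) * \<zeta>) - bdry f \<zeta>)) - 0) < e"
      by blast
  qed
  have "(\<lambda>k. (LINT \<zeta>|cm. bdry f \<zeta> * cnj \<zeta> ^ n) - taylor f n * of_real (rad k) ^ n) \<longlonglongrightarrow> 0"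
    by (rule Lim_null_comparison[OF always_eventually[OF allI[OF close]] lim])
  moreover have "(\<lambda>k. (LINT \<zeta>|cm. bdry f \<zeta> * cnj \<zeta> ^ n) - taylor f n * of_real (rad k) ^ n) \<longlonglongrightarrow>
      (LINT \<zeta>|cm. bdry f \<zeta> * cnj \<zeta> ^ n) - taylor f n * of_real 1 ^ n"
    by (intro tendsto_intros rad_tendsto)
  ultimately have "0 = (LINT \<zeta>|cm. bdry f \<zeta> * cnj \<zeta> ^ n) - taylor f n * of_real 1 ^ n"
    by (rule LIMSEQ_unique)
  then show ?thesis by simp
qed

section \<open>The space of square summable Taylor coefficients\<close>

lemma taylor_unique:
  assumes f: "disk_map f" and c: "\<And>z. norm z < 1 \<Longrightarrow> (\<lambda>n. c n * z ^ n) sums f z"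
  shows "taylor f m = c m"
proof -
  note [measurable] = borel_measurable_dilate[OF f]
  \<comment> \<open>Convergence at 3/4 gives absolute convergence on the circle of radius 1/2, from
    which orthogonality extracts the coefficients.\<close>
  have "summable (\<lambda>n. c n * (3/4) ^ n)"
    using c[of "3/4"] by (intro sums_summable) simp
  then have abs_s: "summable (\<lambda>n. norm (c n * (1/2) ^ n))"
    by (rule powser_insidea) simp
  let ?u = "\<lambda>n \<zeta>. c n * (1/2) ^ n * (\<zeta> ^ n * cnj \<zeta> ^ m)"
  have "(\<lambda>n. LINT \<zeta>|cm. ?u n \<zeta>) sums (LINT \<zeta>|cm. (\<Sum>n. ?u n \<zeta>))"
    by (rule sums_integral_cm[OF _ _ abs_s]) (auto simp: norm_mult norm_power)
  also have "(LINT \<zeta>|cm. (\<Sum>n. ?u n \<zeta>)) = (LINT \<zeta>|cm. f (of_real (1/2) * \<zeta> ^ 1) * cnj \<zeta> ^ (1 * m))"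
  proof (rule integral_cm_cong)
    fix \<zeta> :: complex assume "norm \<zeta> = 1"
    then have "(\<lambda>n. c n * (1/2 * \<zeta>) ^ n * cnj \<zeta> ^ m) sums (f (1/2 * \<zeta>) * cnj \<zeta> ^ m)"
      by (intro sums_mult2 c) (simp add: norm_mult)
    then have "(\<lambda>n. ?u n \<zeta>) sums (f (1/2 * \<zeta>) * cnj \<zeta> ^ m)"
      by (simp only: power_mult_distrib mult_ac)
    then show "(\<Sum>n. ?u n \<zeta>) = f (of_real (1/2) * \<zeta> ^ 1) * cnj \<zeta> ^ (1 * m)"
      by (intro sums_unique[symmetric]) simp
  qed measurable
  also have "\<dots> = taylor f m * of_real (1/2) ^ m"
    by (rule dilate_coeff_pow[OF f]) auto
  also have "(\<lambda>n. LINT \<zeta>|cm. ?u n \<zeta>) = (\<lambda>n. if n = m then c n * (1/2) ^ n else 0)"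
    by (auto simp: integral_cm_orth)
  finally have "(\<lambda>n. if n = m then c n * (1/2) ^ n else 0) sums (taylor f m * of_real (1/2) ^ m)" .
  from sums_unique2[OF this sums_single] show ?thesis by simp
qed

lemma taylor_lincomb:
  assumes "disk_map f" "disk_map g"
  shows "taylor (\<lambda>z. c * f z + d * g z) n = c * taylor f n + d * taylor g n"
proof (rule taylor_unique)
  show "disk_map (\<lambda>z. c * f z + d * g z)" by (intro disk_map_intros assms)
  fix z :: complex assume z: "norm z < 1"
  have "(\<lambda>n. c * (taylor f n * z ^ n) + d * (taylor g n * z ^ n)) sums (c * f z + d * g z)"
    by (intro sums_add sums_mult taylor_sums disk_mapD assms z)
  then show "(\<lambda>n. (c * taylor f n + d * taylor g n) * z ^ n) sums (c * f z + d * g z)"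
    by (simp add: algebra_simps)
qed

lemma taylor_zero_imp:
  assumes "f \<in> disk_holo" "\<And>n. taylor f n = 0"
  shows "f = (\<lambda>z. 0)"
proof
  fix z show "f z = 0"
  proof (cases "norm z < 1")
    case True
    have "(\<lambda>n. 0) sums f z"
      using taylor_sums[OF disk_mapD[OF disk_holo_disk_map[OF assms(1)]] True] by (simp add: assms)
    then show ?thesis by (simp add: sums_unique2[OF _ sums_zero])
  qed (use assms(1) in \<open>auto simp: disk_holo_def\<close>)
qed

lemma integral_mean_2_sums:
  assumes f: "disk_map f" and r: "0 \<le> r" "r < 1"
  shows "(\<lambda>n. (norm (taylor f n))\<^sup>2 * r ^ (2 * n)) sums integral_mean 2 f r"
proof -
  have "(\<lambda>n. taylor f n * cnj (taylor f n) * of_real r ^ (2 * n)) sums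
      (LINT \<zeta>|cm. f (of_real r * \<zeta> ^ 1) * cnj (f (of_real r * \<zeta> ^ 1)))"
    by (rule dilate_parseval_pow[OF f f r]) simp
  also have "(\<lambda>n. taylor f n * cnj (taylor f n) * of_real r ^ (2 * n)) =
      (\<lambda>n. of_real ((norm (taylor f n))\<^sup>2 * r ^ (2 * n)))"
    by (simp add: complex_norm_square[symmetric])
  also have "(LINT \<zeta>|cm. f (of_real r * \<zeta> ^ 1) * cnj (f (of_real r * \<zeta> ^ 1))) =
      (LINT \<zeta>|cm. of_real ((norm (f (of_real r * \<zeta>)))\<^sup>2))"
    by (intro Bochner_Integration.integral_cong) (simp_all add: complex_norm_square[symmetric])
  also have "\<dots> = of_real (integral_mean 2 f r)"
    unfolding integral_mean_def integral_complex_of_real by (simp add: powr_numeral)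
  finally show ?thesis by (simp only: sums_of_real_iff)
qed

text \<open>Parseval on circles of radius r -> 1. That the series is at most the squared norm
  follows from its finite partial sums, the converse from r^(2n) <= 1.\<close>

lemma hardy_2_taylor:
  assumes f: "f \<in> hardy 2"
  shows "summable (\<lambda>n. (norm (taylor f n))\<^sup>2)"
    and "(\<Sum>n. (norm (taylor f n))\<^sup>2) = (hardy_norm 2 f)\<^sup>2"
proof -
  note dm = hardyD(2)[OF f]
  let ?a = "\<lambda>n. (norm (taylor f n))\<^sup>2"
  have le: "(\<Sum>n<K. ?a n) \<le> (hardy_norm 2 f)\<^sup>2" for K
  proof -
    have "(\<lambda>j. \<Sum>n<K. ?a n * rad j ^ (2 * n)) \<longlonglongrightarrow> (\<Sum>n<K. ?a n * 1 ^ (2 * n))"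
      by (intro tendsto_intros rad_tendsto)
    moreover have "(\<Sum>n<K. ?a n * rad j ^ (2 * n)) \<le> (hardy_norm 2 f)\<^sup>2" for j
    proof -
      have "(\<Sum>n<K. ?a n * rad j ^ (2 * n)) \<le> integral_mean 2 f (rad j)"
        unfolding sums_unique[OF integral_mean_2_sums[OF dm rad[of j]]]
        using rad(1)[of j] by (intro sum_le_suminf sums_summable[OF integral_mean_2_sums[OF dm
            rad[of j]]]) auto
      also have "\<dots> \<le> (hardy_norm 2 f)\<^sup>2"
        using integral_mean_le_hardy_norm[OF f _ rad[of j]]
          by (simp add: powr_numeral hardy_norm_nonneg)
      finally show ?thesis .
    qed
    ultimately show ?thesis
      by (intro tendsto_upperbound[of "\<lambda>j. \<Sum>n<K. ?a n * rad j ^ (2 * n)"]) auto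
  qed
  show s: "summable ?a"
    by (rule bounded_imp_summable[of _ "(hardy_norm 2 f)\<^sup>2"]) (use le[of
        "Suc _"] in \<open>auto simp: lessThan_Suc_atMost\<close>)
  have "(\<Sum>n. ?a n) \<le> (hardy_norm 2 f)\<^sup>2"
    by (rule suminf_le_const[OF s le])
  moreover have "hardy_norm 2 f \<le> sqrt (\<Sum>n. ?a n)"
  proof (rule hardy_norm_leI)
    fix r :: real assume r: "0 \<le> r" "r < 1"
    have "integral_mean 2 f r \<le> (\<Sum>n. ?a n)"
      using r by (intro sums_le[OF _ integral_mean_2_sums[OF dm r] summable_sums[OF s]])
          (auto intro!: mult_right_le_one_le power_le_one)
    then show "integral_mean 2 f r \<le> sqrt (\<Sum>n. ?a n) powr 2"
      using s by (simp add: powr_numeral suminf_nonneg)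
  qed (use s in \<open>auto simp: suminf_nonneg\<close>)
  then have "(hardy_norm 2 f)\<^sup>2 \<le> (sqrt (\<Sum>n. ?a n))\<^sup>2"
    by (intro power_mono hardy_norm_nonneg)
  ultimately show "(\<Sum>n. ?a n) = (hardy_norm 2 f)\<^sup>2"
    using s by (simp add: suminf_nonneg)
qed

lemma hardy_2I:
  assumes f: "f \<in> disk_holo" and s: "summable (\<lambda>n. (norm (taylor f n))\<^sup>2)"
  shows "f \<in> hardy 2"
proof (rule hardyI[OF f])
  fix r :: real assume r: "0 \<le> r" "r < 1"
  show "integral_mean 2 f r \<le> (\<Sum>n. (norm (taylor f n))\<^sup>2)"
    using r by (intro sums_le[OF _ integral_mean_2_sums[OF disk_holo_disk_map[OF f] r]
        summable_sums[OF s]])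
      (auto intro!: mult_right_le_one_le power_le_one)
qed

text \<open>Monomials in the representation by zero off the disk, as membership in
  \<open>hardy p\<close> demands; \<open>zpow 0\<close> plays the constant 1.\<close>

definition zpow :: "nat \<Rightarrow> complex \<Rightarrow> complex" where
  "zpow n z = (if norm z < 1 then z ^ n else 0)"

lemma zpow_disk_holo: "zpow n \<in> disk_holo"
proof -
  have "zpow n holomorphic_on ball 0 1"
    by (rule holomorphic_transform[of "\<lambda>z. z ^ n"]) (auto simp: zpow_def intro!: holomorphic_intros)
  then show ?thesis by (simp add: disk_holo_def zpow_def)
qed

lemma norm_zpow_le: "norm (zpow n z) \<le> 1"
  by (auto simp: zpow_def norm_power power_le_one)

lemma zpow_hardy: "0 < p \<Longrightarrow> zpow n \<in> hardy p"
  by (rule hardy_bounded[OF zpow_disk_holo norm_zpow_le])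

lemma taylor_zpow: "taylor (zpow n) m = (if m = n then 1 else 0)"
proof (rule taylor_unique[OF disk_holo_disk_map[OF zpow_disk_holo]])
  fix z :: complex assume z: "norm z < 1"
  have "(\<lambda>m. if m = n then z ^ m else 0) sums z ^ n" by (rule sums_single)
  also have "(\<lambda>m. if m = n then z ^ m else 0) = (\<lambda>m. (if m = n then 1 else 0) * z ^ m)" by auto
  finally show "(\<lambda>m. (if m = n then 1 else 0) * z ^ m) sums zpow n z"
    using z by (simp add: zpow_def)
qed

lemma bdry_zpow:
  assumes "norm \<zeta> = 1"
  shows "bdry (zpow n) \<zeta> = \<zeta> ^ n"
proof (rule tendsto_bdry)
  have "((\<lambda>r::real. (of_real r * \<zeta>) ^ n) \<longlongrightarrow> (of_real 1 * \<zeta>) ^ n) (at_left 1)"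
    by (intro tendsto_intros)
  moreover have "eventually (\<lambda>r::real. (of_real r * \<zeta>) ^ n = zpow n (of_real r * \<zeta>)) (at_left 1)"
    using assms by (subst eventually_at_left[of "0::real" 1]) (auto simp: zpow_def norm_mult
        intro!: exI[of _ 0])
  ultimately show "((\<lambda>r::real. zpow n (of_real r * \<zeta>)) \<longlongrightarrow> \<zeta> ^ n) (at_left 1)"
    by (simp add: filterlim_cong)
qed

lemma pairing_zpow_left:
  assumes g: "g \<in> hardy q" and q: "1 < q"
  shows "pairing (zpow n) g = cnj (taylor g n)"
proof -
  note [measurable] = hardy_bdry_borel[OF g] bdry_borel[OF zpow_disk_holo]
  have "pairing (zpow n) g = (LINT \<zeta>|cm. cnj (bdry g \<zeta> * cnj \<zeta> ^ n))"
    unfolding pairing_def by (rule integral_cm_cong) (auto simp: bdry_zpow mult.commute)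
  also have "\<dots> = cnj (LINT \<zeta>|cm. bdry g \<zeta> * cnj \<zeta> ^ n)" by (rule integral_cm_cnj)
  also have "\<dots> = cnj (taylor g n)" by (simp only: hardy_bdry_coeff[OF g q])
  finally show ?thesis .
qed

lemma pairing_sum_left:
  assumes "finite K" "\<And>k. k \<in> K \<Longrightarrow> f k \<in> hardy p" "h \<in> hardy q" "1 < p" "1 / p + 1 / q = 1"
  shows "pairing (\<lambda>z. \<Sum>k\<in>K. c k * f k z) h = (\<Sum>k\<in>K. c k * pairing (f k) h)"
  using assms(1,2)
proof (induction K)
  case empty
  have "bdry (\<lambda>z. 0) \<zeta> = 0" for \<zeta> by (rule tendsto_bdry) simp
  then show ?case by (simp add: pairing_def)
next
  case (insert k K)
  have "pairing (\<lambda>z. c k * f k z + 1 * (\<Sum>k\<in>K. c k * f k z)) h =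
     c k * pairing (f k) h + 1 * pairing (\<lambda>z. \<Sum>k\<in>K. c k * f k z) h"
    using insert assms by (intro pairing_lincomb_left[where p=p and q=q] hardy_sum) auto
  then show ?case using insert by simp
qed

lemma disk_holo_powser:
  assumes "\<And>z. norm z < 1 \<Longrightarrow> (\<lambda>n. c n * z ^ n) sums f z" "\<And>z. 1 \<le> norm z \<Longrightarrow> f z = 0"
  shows "f \<in> disk_holo" "taylor f n = c n"
proof -
  have "f holomorphic_on ball 0 1"
    using assms(1) by (intro power_series_holomorphic[of 0 1 c f]) simp
  then show "f \<in> disk_holo" using assms(2) by (auto simp: disk_holo_def)
  then show "taylor f n = c n" by (intro taylor_unique disk_holo_disk_map assms)
qed

text \<open>The Riesz-Fischer theorem in coefficient form. The series converges in the disk because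
  2 |c_n| |z|^n <= |c_n|^2 + |z|^(2n).\<close>

lemma hardy_2_of_coeffs:
  fixes c :: "nat \<Rightarrow> complex"
  assumes s: "summable (\<lambda>n. (norm (c n))\<^sup>2)"
  obtains f where "f \<in> hardy 2" "\<And>n. taylor f n = c n"
proof -
  define f where "f z = (if norm z < 1 then (\<Sum>n. c n * z ^ n) else 0)" for z
  have sums: "(\<lambda>n. c n * z ^ n) sums f z" if z: "norm z < 1" for z
  proof -
    have "summable (\<lambda>n. c n * z ^ n)"
    proof (rule summable_comparison_test')
      have "(norm z)\<^sup>2 < 1" using z by (simp add: power_less_one_iff abs_square_less_1)
      then show "summable (\<lambda>n. (norm (c n))\<^sup>2 + ((norm z)\<^sup>2) ^ n)"
        by (intro summable_add s summable_geometric) simp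
      fix n
      have "0 \<le> (norm (c n) - norm z ^ n)\<^sup>2" by simp
      moreover have "((norm z)\<^sup>2) ^ n = (norm z ^ n)\<^sup>2"
        by (simp add: mult.commute flip: power_mult)
      ultimately have "2 * (norm (c n) * norm z ^ n) \<le> (norm (c n))\<^sup>2 + ((norm z)\<^sup>2) ^ n"
        by (simp add: power2_diff)
      moreover have "0 \<le> norm (c n) * norm z ^ n" by simp
      ultimately show "norm (c n * z ^ n) \<le> (norm (c n))\<^sup>2 + ((norm z)\<^sup>2) ^ n"
        unfolding norm_mult norm_power by linarith
    qed
    then show ?thesis using z by (simp add: f_def summable_sums)
  qed
  have f: "f \<in> disk_holo" "\<And>n. taylor f n = c n"
    by (rule disk_holo_powser[OF sums]; simp add: f_def)+
  show thesis
    by (rule that[of f]) (use f s in \<open>auto intro!: hardy_2I\<close>)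
qed

definition trunc :: "nat \<Rightarrow> (complex \<Rightarrow> complex) \<Rightarrow> complex \<Rightarrow> complex" where
  "trunc K f z = (\<Sum>n<K. taylor f n * zpow n z)"

lemma trunc_hardy: "0 < p \<Longrightarrow> trunc K f \<in> hardy p"
  unfolding trunc_def[abs_def] by (intro hardy_sum zpow_hardy) auto

lemma taylor_sum_zpow: "taylor (\<lambda>z. \<Sum>n<K. c n * zpow n z) m = (if m < K then c m else 0)"
proof (rule taylor_unique)
  show "disk_map (\<lambda>z. \<Sum>n<K. c n * zpow n z)"
    by (rule hardyD[OF hardy_sum[of _ _ 1]]) (auto intro: zpow_hardy)
  fix z :: complex assume z: "norm z < 1"
  have "(\<lambda>n. if n \<in> {..<K} then c n * z ^ n else 0) sums (\<Sum>n\<in>{..<K}. c n * z ^ n)"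
    by (rule sums_If_finite_set) simp
  also have "(\<lambda>n. if n \<in> {..<K} then c n * z ^ n else 0) = (\<lambda>n. (if n < K then c n else 0) * z ^ n)"
    by auto
  finally show "(\<lambda>n. (if n < K then c n else 0) * z ^ n) sums (\<Sum>n<K. c n * zpow n z)"
    using z by (simp add: zpow_def)
qed

text \<open>By Parseval the squared norm is a tail of the convergent series of squared
  coefficients.\<close>

lemma hardy_norm_trunc_tendsto:
  assumes f: "f \<in> hardy 2"
  shows "(\<lambda>K. hardy_norm 2 (\<lambda>z. f z - trunc K f z)) \<longlonglongrightarrow> 0"
proof -
  note s = hardy_2_taylor(1)[OF f]
  let ?a = "\<lambda>n. (norm (taylor f n))\<^sup>2"
  have "(hardy_norm 2 (\<lambda>z. f z - trunc K f z))\<^sup>2 = (\<Sum>n. ?a (n + K))" for K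
  proof -
    have d: "(\<lambda>z. f z - trunc K f z) \<in> hardy 2" by (intro hardy_diff f trunc_hardy) auto
    have t: "taylor (\<lambda>z. f z - trunc K f z) n = (if n < K then 0 else taylor f n)" for n
      using taylor_lincomb[OF hardyD(2)[OF f] hardyD(2)[OF trunc_hardy[of 2 K f]], of 1 "-1" n]
      by (simp add: trunc_def[abs_def] taylor_sum_zpow)
    have "(hardy_norm 2 (\<lambda>z. f z - trunc K f z))\<^sup>2 = (\<Sum>n. (norm (taylor (\<lambda>z. f z - trunc K f z)
        n))\<^sup>2)"
      using hardy_2_taylor(2)[OF d] by simp
    also have "\<dots> = (\<Sum>n. (norm (taylor (\<lambda>z. f z - trunc K f z) (n + K)))\<^sup>2) + (\<Sum>n<K. (norm (taylor
        (\<lambda>z. f z - trunc K f z) n))\<^sup>2)"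
      by (rule suminf_split_initial_segment[OF hardy_2_taylor(1)[OF d]])
    also have "\<dots> = (\<Sum>n. ?a (n + K))" by (simp add: t)
    finally show ?thesis .
  qed
  moreover have "(\<lambda>K. \<Sum>n. ?a (n + K)) \<longlonglongrightarrow> 0"
    using s by (rule suminf_exist_split2)
  ultimately have "(\<lambda>K. (hardy_norm 2 (\<lambda>z. f z - trunc K f z))\<^sup>2) \<longlonglongrightarrow> 0" by simp
  then have "(\<lambda>K. sqrt ((hardy_norm 2 (\<lambda>z. f z - trunc K f z))\<^sup>2)) \<longlonglongrightarrow> sqrt 0"
    by (rule tendsto_real_sqrt)
  then show ?thesis by (simp add: hardy_norm_nonneg)
qed

lemma pairing_trunc_left:
  assumes g: "g \<in> hardy 2"
  shows "pairing (trunc K f) g = (\<Sum>n<K. taylor f n * cnj (taylor g n))"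
proof -
  have "pairing (trunc K f) g = (\<Sum>n<K. taylor f n * pairing (zpow n) g)"
    unfolding trunc_def[abs_def] by (rule pairing_sum_left[where p=2 and q=2])
        (auto intro: g zpow_hardy)
  then show ?thesis using pairing_zpow_left[OF g] by simp
qed

lemma pairing_Cauchy_Schwarz:
  assumes "f \<in> hardy 2" "g \<in> hardy 2"
  shows "norm (pairing f g) \<le> hardy_norm 2 f * hardy_norm 2 g"
  using pairing_Hoelder(2)[OF assms] by simp

text \<open>The boundary integral is the inner product of coefficients: this holds for Taylor
  polynomials of \<open>f\<close>, and Cauchy-Schwarz carries it over to the limit.\<close>

lemma pairing_hardy_2_sums:
  assumes f: "f \<in> hardy 2" and g: "g \<in> hardy 2"
  shows "(\<lambda>n. taylor f n * cnj (taylor g n)) sums pairing f g"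
  unfolding sums_def
proof (rule LIM_zero_cancel, rule Lim_null_comparison)
  show "eventually (\<lambda>K. norm ((\<Sum>n<K. taylor f n * cnj (taylor g n)) - pairing f g) \<le>
      hardy_norm 2 (\<lambda>z. f z - trunc K f z) * hardy_norm 2 g) sequentially"
  proof (rule always_eventually, rule allI)
    fix K
    have t: "trunc K f \<in> hardy 2" by (intro trunc_hardy) auto
    have "pairing (\<lambda>z. f z - trunc K f z) g = pairing f g - (\<Sum>n<K. taylor f n * cnj (taylor g n))"
      using pairing_diff_left[OF f t g] pairing_trunc_left[OF g] by simp
    then show "norm ((\<Sum>n<K. taylor f n * cnj (taylor g n)) - pairing f g) \<le>
      hardy_norm 2 (\<lambda>z. f z - trunc K f z) * hardy_norm 2 g"
      using pairing_Cauchy_Schwarz[OF hardy_diff[OF f t] g] by (simp add: norm_minus_commute)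
  qed
  have "(\<lambda>K. hardy_norm 2 (\<lambda>z. f z - trunc K f z) * hardy_norm 2 g) \<longlonglongrightarrow> 0 * hardy_norm 2 g"
    by (intro tendsto_intros hardy_norm_trunc_tendsto f)
  then show "(\<lambda>K. hardy_norm 2 (\<lambda>z. f z - trunc K f z) * hardy_norm 2 g) \<longlonglongrightarrow> 0" by simp
qed

lemma pairing_self:
  assumes f: "f \<in> hardy 2"
  shows "pairing f f = of_real ((hardy_norm 2 f)\<^sup>2)"
proof -
  have "(\<lambda>n. of_real ((norm (taylor f n))\<^sup>2)) sums (of_real (\<Sum>n. (norm (taylor f n))\<^sup>2) :: complex)"
    by (intro sums_of_real summable_sums hardy_2_taylor(1)[OF f])
  moreover have "(\<lambda>n. of_real ((norm (taylor f n))\<^sup>2) :: complex) =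
      (\<lambda>n. taylor f n * cnj (taylor f n))"
    by (simp add: complex_norm_square[symmetric])
  ultimately show ?thesis
    using sums_unique2[OF pairing_hardy_2_sums[OF f f]] hardy_2_taylor(2)[OF f] by simp
qed

lemma pairing_lincomb_right:
  assumes "f \<in> hardy 2" "g \<in> hardy 2" "h \<in> hardy 2"
  shows "pairing h (\<lambda>z. c * f z + d * g z) = cnj c * pairing h f + cnj d * pairing h g"
  using pairing_lincomb_left[OF assms, of c d] pairing_commute[of h] by simp

text \<open>Tested on the polynomial with coefficients b_n = \<open>cnj (L (zpow n))\<close>, the
  functional returns the sum of |b_n|^2, so boundedness forces that sum to be at most C^2. The
  function with coefficients b_n represents \<open>L\<close> on polynomials, hence on H^2.\<close>

lemma hardy_2_Riesz:
  assumes lin: "\<And>f g c d. f \<in> hardy 2 \<Longrightarrow> g \<in> hardy 2 \<Longrightarrow> L (\<lambda>z. c * f z + d * g z) = c * L f + d * L g"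
    and bd: "\<And>f. f \<in> hardy 2 \<Longrightarrow> norm (L f) \<le> C * hardy_norm 2 f"
  obtains h where "h \<in> hardy 2" "\<And>f. f \<in> hardy 2 \<Longrightarrow> L f = pairing f h"
proof -
  have two: "(0::real) < 2" by simp
  have L0: "L (\<lambda>z. 0) = 0"
    using lin[OF zpow_hardy[OF two] zpow_hardy[OF two], where c = 0 and d = 0] by simp
  have Lsum: "L (\<lambda>z. \<Sum>n<K. c n * zpow n z) = (\<Sum>n<K. c n * L (zpow n))" for c K
  proof (induction K)
    case (Suc K)
    have "L (\<lambda>z. 1 * (\<Sum>n<K. c n * zpow n z) + c K * zpow K z) = 1 * L (\<lambda>z. \<Sum>n<K. c n * zpow n z) +
        c K * L (zpow K)"
      by (intro lin hardy_sum zpow_hardy) auto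
    then show ?case using Suc by simp
  qed (simp add: L0)
  define b where "b n = cnj (L (zpow n))" for n
  have le: "(\<Sum>n<K. (norm (b n))\<^sup>2) \<le> C\<^sup>2" for K
  proof -
    let ?v = "\<lambda>z. \<Sum>n<K. b n * zpow n z"
    define s where "s = (\<Sum>n<K. (norm (b n))\<^sup>2)"
    have s0: "0 \<le> s" unfolding s_def by (intro sum_nonneg) simp
    have v: "?v \<in> hardy 2" by (intro hardy_sum zpow_hardy) auto
    have "(hardy_norm 2 ?v)\<^sup>2 = (\<Sum>n. (norm (taylor ?v n))\<^sup>2)" using hardy_2_taylor(2)[OF v] by simp
    also have "\<dots> = (\<Sum>n<K. (norm (taylor ?v n))\<^sup>2)"
      by (rule suminf_finite) (auto simp: taylor_sum_zpow)
    also have "\<dots> = s" by (simp add: taylor_sum_zpow s_def)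
    finally have n: "hardy_norm 2 ?v = sqrt s" by (simp add: hardy_norm_nonneg real_sqrt_unique)
    have "L ?v = of_real s"
      unfolding Lsum s_def of_real_sum
      by (intro sum.cong refl) (simp only: b_def complex_norm_square complex_cnj_cnj
          complex_mod_cnj mult.commute)
    then have "s \<le> C * sqrt s" using bd[OF v] s0 n by simp
    show ?thesis
    proof (cases "s = 0")
      case False
      then have "0 < sqrt s" using s0 by simp
      have "sqrt s * sqrt s \<le> C * sqrt s" using \<open>s \<le> C * sqrt s\<close> s0 by simp
      then have "sqrt s \<le> C" using \<open>0 < sqrt s\<close> by (rule mult_right_le_imp_le)
      then have "(sqrt s)\<^sup>2 \<le> C\<^sup>2" using s0 by (intro power_mono) auto
      then show ?thesis using s0 by (simp add: s_def)
    qed (simp add: s_def)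
  qed
  have "summable (\<lambda>n. (norm (b n))\<^sup>2)"
    by (rule bounded_imp_summable[of _ "C\<^sup>2"]) (use le[of
        "Suc _"] in \<open>auto simp: lessThan_Suc_atMost\<close>)
  from hardy_2_of_coeffs[OF this] obtain h where h: "h \<in> hardy 2" "\<And>n. taylor h n = b n"
    by blast
  show thesis
  proof (rule that[OF h(1)])
    fix f assume f: "f \<in> hardy 2"
    have t: "trunc K f \<in> hardy 2" for K by (intro trunc_hardy) auto
    have "(\<lambda>n. taylor f n * L (zpow n)) sums L f"
      unfolding sums_def
    proof (rule LIM_zero_cancel, rule Lim_null_comparison)
      show "eventually (\<lambda>K. norm ((\<Sum>n<K. taylor f n * L (zpow n)) - L f) \<le>
          C * hardy_norm 2 (\<lambda>z. f z - trunc K f z)) sequentially"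
      proof (rule always_eventually, rule allI)
        fix K
        have "L (\<lambda>z. 1 * f z + (-1) * trunc K f z) = 1 * L f + (-1) * L (trunc K f)"
          by (intro lin f t)
        then have "L (\<lambda>z. f z - trunc K f z) = L f - (\<Sum>n<K. taylor f n * L (zpow n))"
          by (simp add: trunc_def[abs_def] Lsum)
        then show "norm ((\<Sum>n<K. taylor f n * L (zpow n)) - L f) \<le>
            C * hardy_norm 2 (\<lambda>z. f z - trunc K f z)"
          using bd[OF hardy_diff[OF f t[of K]]] by (simp add: norm_minus_commute)
      qed
      have "(\<lambda>K. C * hardy_norm 2 (\<lambda>z. f z - trunc K f z)) \<longlonglongrightarrow> C * 0"
        by (intro tendsto_intros hardy_norm_trunc_tendsto f)
      then show "(\<lambda>K. C * hardy_norm 2 (\<lambda>z. f z - trunc K f z)) \<longlonglongrightarrow> 0" by simp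
    qed
    moreover have "(\<lambda>n. taylor f n * L (zpow n)) sums pairing f h"
      using pairing_hardy_2_sums[OF f h(1)] by (simp add: h(2) b_def)
    ultimately show "L f = pairing f h" by (rule sums_unique2)
  qed
qed

section \<open>Outer functions\<close>

definition herglotz :: "(complex \<Rightarrow> real) \<Rightarrow> complex \<Rightarrow> complex" where
  "herglotz v z = (LINT \<zeta>|cm. (\<zeta> + z) / (\<zeta> - z) * of_real (v \<zeta>))"

lemma Re_herglotz_kernel:
  assumes "norm \<zeta> = 1"
  shows "Re ((\<zeta> + z) / (\<zeta> - z)) = poisson z \<zeta>"
proof -
  have "Re ((\<zeta> + z) / (\<zeta> - z)) = Re ((\<zeta> + z) * cnj (\<zeta> - z)) / (norm (\<zeta> - z))\<^sup>2"
    by (simp add: Re_divide cmod_power2 algebra_simps)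
  also have "Re ((\<zeta> + z) * cnj (\<zeta> - z)) = (norm \<zeta>)\<^sup>2 - (norm z)\<^sup>2"
    unfolding cmod_power2 by (simp add: algebra_simps power2_eq_square)
  finally show ?thesis using assms by (simp add: poisson_def)
qed

lemma norm_herglotz_kernel_le:
  fixes \<zeta> z :: complex
  assumes "norm \<zeta> = 1" "norm z < 1"
  shows "norm ((\<zeta> + z) / (\<zeta> - z)) \<le> 2 / (1 - norm z)"
  unfolding norm_divide
proof (rule frac_le)
  show "norm (\<zeta> + z) \<le> 2" using norm_triangle_ineq[of \<zeta> z] assms by simp
  show "1 - norm z \<le> norm (\<zeta> - z)" using norm_triangle_ineq2[of \<zeta> z] assms by simp
qed (use assms in auto)

text \<open>With \<open>w = z * cnj \<zeta>\<close> the kernel is (1 + w) / (1 - w) = 2 / (1 - w) -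
  1.\<close>

lemma herglotz_kernel_sums:
  assumes "norm \<zeta> = 1" "norm z < 1"
  shows "(\<lambda>n. (if n = 0 then 1 else 2) * (z ^ n * cnj \<zeta> ^ n)) sums ((\<zeta> + z) / (\<zeta> - z))"
proof -
  define w where "w = z * cnj \<zeta>"
  have w: "norm w < 1" using assms by (simp add: w_def norm_mult)
  then have w1: "1 - w \<noteq> 0" by auto
  have zz: "\<zeta> * cnj \<zeta> = 1"
    using assms by (metis complex_norm_square of_real_1 one_power2)
  have "(\<lambda>n. 2 * w ^ n - (if n = 0 then 1 else 0)) sums (2 * (1 / (1 - w)) - 1)"
    using sums_diff[OF sums_mult[OF geometric_sums[OF w], of 2] sums_single[of 0 "\<lambda>_. 1"]] by simp
  also have "(\<lambda>n. 2 * w ^ n - (if n = 0 then 1 else 0)) = (\<lambda>n. (if n =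
      0 then 1 else 2) * (z ^ n * cnj \<zeta> ^ n))"
    by (auto simp: w_def power_mult_distrib)
  also have "2 * (1 / (1 - w)) - 1 = (1 + w) / (1 - w)" using w1 by (simp add: field_simps)
  also have "\<dots> = (\<zeta> * (1 + w)) / (\<zeta> * (1 - w))" using assms by auto
  also have "\<zeta> * (1 + w) = \<zeta> + z" using zz by (simp add: w_def algebra_simps)
  also have "\<zeta> * (1 - w) = \<zeta> - z" using zz by (simp add: w_def algebra_simps)
  finally show ?thesis .
qed

lemma integrable_herglotz:
  assumes v: "integrable cm v" and z: "norm z < 1"
  shows "integrable cm (\<lambda>\<zeta>. (\<zeta> + z) / (\<zeta> - z) * complex_of_real (v \<zeta>))"
proof (rule Bochner_Integration.integrable_bound[of _ "\<lambda>\<zeta>. 2 / (1 - norm z) * v \<zeta>"])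
  have [measurable]: "v \<in> borel_measurable borel" using v by (simp add: integrable_iff_bounded)
  show "(\<lambda>\<zeta>. (\<zeta> + z) / (\<zeta> - z) * complex_of_real (v \<zeta>)) \<in> borel_measurable cm" by measurable
  show "AE \<zeta> in cm. norm ((\<zeta> + z) / (\<zeta> - z) * complex_of_real (v \<zeta>)) \<le>
      norm (2 / (1 - norm z) * v \<zeta>)"
    using AE_cm_norm
  proof eventually_elim
    case (elim \<zeta>)
    have "norm ((\<zeta> + z) / (\<zeta> - z) * complex_of_real (v \<zeta>)) = norm ((\<zeta> + z) / (\<zeta> - z)) * \<bar>v \<zeta>\<bar>"
      by (simp only: norm_mult norm_of_real)
    also have "\<dots> \<le> 2 / (1 - norm z) * \<bar>v \<zeta>\<bar>"
      by (rule mult_right_mono[OF norm_herglotz_kernel_le[OF elim z]]) simp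
    also have "\<dots> = norm (2 / (1 - norm z) * v \<zeta>)" using z by (simp add: abs_mult)
    finally show ?case .
  qed
qed (use v in simp)

text \<open>Expanding the kernel yields a power series whose coefficients are, up to a factor,
  Fourier coefficients of \<open>v\<close>. As \<open>v\<close> is merely integrable, the termwise
  integration is dominated by |v| times a geometric series.\<close>

lemma herglotz_holomorphic:
  assumes v: "integrable cm v"
  shows "herglotz v holomorphic_on ball 0 1"
proof -
  have [measurable]: "v \<in> borel_measurable borel" using v by (simp add: integrable_iff_bounded)
  define c where "c n = (if n = 0 then 1 else 2) * (LINT \<zeta>|cm. cnj \<zeta> ^ n * of_real (v \<zeta>))" for n
      :: nat
  have "(\<lambda>n. c n * (z - 0) ^ n) sums herglotz v z" if "z \<in> ball 0 1" for z
  proof -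
    have z: "norm z < 1" using that by simp
    let ?u = "\<lambda>n \<zeta>. (if n = 0 then 1 else 2) * (z ^ n * cnj \<zeta> ^ n) * of_real (v \<zeta>)"
    have i: "integrable cm (?u n)" for n
    proof (rule Bochner_Integration.integrable_bound[of _ "\<lambda>\<zeta>. 2 * v \<zeta>"])
      show "AE \<zeta> in cm. norm (?u n \<zeta>) \<le> norm (2 * v \<zeta>)"
        using AE_cm_norm
      proof eventually_elim
        case (elim \<zeta>)
        have "norm z ^ n \<le> 1" using z by (simp add: power_le_one)
        then have "norm z ^ n * \<bar>v \<zeta>\<bar> \<le> 1 * \<bar>v \<zeta>\<bar>" by (rule mult_right_mono) simp
        then show ?case using elim by (simp add: norm_mult norm_power abs_mult)
      qed
    qed (use v in simp_all)
    have "(\<lambda>n. LINT \<zeta>|cm. ?u n \<zeta>) sums (LINT \<zeta>|cm. (\<Sum>n. ?u n \<zeta>))"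
    proof (rule sums_integral[OF i])
      have le: "norm (?u n \<zeta>) \<le> norm z ^ n * (2 * \<bar>v \<zeta>\<bar>)" if "norm \<zeta> = 1" for n \<zeta>
        using that by (simp add: norm_mult norm_power abs_mult mult_left_mono)
      have sz: "summable (\<lambda>n. norm z ^ n)" using z by (intro summable_geometric) simp
      show "AE \<zeta> in cm. summable (\<lambda>n. norm (?u n \<zeta>))"
        using AE_cm_norm
      proof eventually_elim
        case (elim \<zeta>)
        show ?case
          by (rule summable_comparison_test'[OF summable_mult2[OF sz, of "2 * \<bar>v \<zeta>\<bar>"]])
              (use le[OF elim] in simp)
      qed
      show "summable (\<lambda>n. LINT \<zeta>|cm. norm (?u n \<zeta>))"
      proof (rule summable_comparison_test'[OF summable_mult2[OF sz, of "LINT \<zeta>|cm. 2 * \<bar>v \<zeta>\<bar>"]])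
        fix n
        have "(LINT \<zeta>|cm. norm (?u n \<zeta>)) \<le> (LINT \<zeta>|cm. norm z ^ n * (2 * \<bar>v \<zeta>\<bar>))"
        proof (rule integral_mono_AE)
          show "integrable cm (\<lambda>\<zeta>. norm (?u n \<zeta>))" using i by (rule integrable_norm)
          show "integrable cm (\<lambda>\<zeta>. norm z ^ n * (2 * \<bar>v \<zeta>\<bar>))" using v by simp
          show "AE \<zeta> in cm. norm (?u n \<zeta>) \<le> norm z ^ n * (2 * \<bar>v \<zeta>\<bar>)"
            using AE_cm_norm by eventually_elim (rule le)
        qed
        also have "\<dots> = norm z ^ n * (LINT \<zeta>|cm. 2 * \<bar>v \<zeta>\<bar>)" by (rule integral_mult_right_zero)
        finally show "norm (LINT \<zeta>|cm. norm (?u n \<zeta>)) \<le> norm z ^ n * (LINT \<zeta>|cm. 2 * \<bar>v \<zeta>\<bar>)"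
          by simp
      qed
    qed
    also have "(LINT \<zeta>|cm. (\<Sum>n. ?u n \<zeta>)) = herglotz v z"
      unfolding herglotz_def
    proof (rule integral_cm_cong)
      fix \<zeta> :: complex assume "norm \<zeta> = 1"
      from sums_mult2[OF herglotz_kernel_sums[OF this z], of "of_real (v \<zeta>)"]
      show "(\<Sum>n. ?u n \<zeta>) = (\<zeta> + z) / (\<zeta> - z) * of_real (v \<zeta>)"
        by (rule sums_unique[symmetric])
    qed measurable
    also have "(\<lambda>n. LINT \<zeta>|cm. ?u n \<zeta>) = (\<lambda>n. c n * (z - 0) ^ n)"
    proof
      fix n
      have "(LINT \<zeta>|cm. ?u n \<zeta>) = (LINT \<zeta>|cm. ((if n = 0 then 1 else 2) * z ^ n) * (cnj \<zeta> ^ n *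
          of_real (v \<zeta>)))"
        by (intro Bochner_Integration.integral_cong) (simp_all add: mult_ac)
      also have "\<dots> = ((if n = 0 then 1 else 2) * z ^ n) * (LINT \<zeta>|cm. cnj \<zeta> ^ n * of_real (v \<zeta>))"
        by (rule integral_mult_right_zero)
      finally show "(LINT \<zeta>|cm. ?u n \<zeta>) = c n * (z - 0) ^ n" by (simp add: c_def mult_ac)
    qed
    finally show ?thesis .
  qed
  then show ?thesis by (rule power_series_holomorphic)
qed

lemma herglotz_add:
  assumes "integrable cm v" "integrable cm w" "norm z < 1"
  shows "herglotz (\<lambda>\<zeta>. v \<zeta> + w \<zeta>) z = herglotz v z + herglotz w z"
  using integrable_herglotz[OF assms(1,3)] integrable_herglotz[OF assms(2,3)]
  by (simp add: herglotz_def distrib_left)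

text \<open>The real part is the Poisson integral of \<open>v\<close>, and the kernel is nonnegative
  with mass one. After exponentiation such bounds become bounds for moduli.\<close>

lemma Re_herglotz_le:
  assumes v: "integrable cm v" "\<And>\<zeta>. v \<zeta> \<le> m" and z: "norm z < 1"
  shows "Re (herglotz v z) \<le> m"
proof -
  have [measurable]: "v \<in> borel_measurable borel" using v by (simp add: integrable_iff_bounded)
  have ip: "integrable cm (poisson z)"
    by (rule integrable_cm_bounded[where B="1 / (1 - norm z)\<^sup>2"])
       (use poisson_le[OF z] poisson_nonneg[OF z] in auto)
  have "Re (herglotz v z) = (LINT \<zeta>|cm. Re ((\<zeta> + z) / (\<zeta> - z) * of_real (v \<zeta>)))"
    unfolding herglotz_def by (rule integral_Re[symmetric, OF integrable_herglotz[OF v(1) z]])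
  also have "\<dots> \<le> (LINT \<zeta>|cm. poisson z \<zeta> * m)"
  proof (rule integral_mono_AE)
    show "integrable cm (\<lambda>\<zeta>. Re ((\<zeta> + z) / (\<zeta> - z) * of_real (v \<zeta>)))"
      by (rule integrable_Re[OF integrable_herglotz[OF v(1) z]])
    show "integrable cm (\<lambda>\<zeta>. poisson z \<zeta> * m)" using ip by simp
    show "AE \<zeta> in cm. Re ((\<zeta> + z) / (\<zeta> - z) * of_real (v \<zeta>)) \<le> poisson z \<zeta> * m"
      using AE_cm_norm
    proof eventually_elim
      case (elim \<zeta>)
      have "Re ((\<zeta> + z) / (\<zeta> - z) * of_real (v \<zeta>)) = poisson z \<zeta> * v \<zeta>"
        using Re_herglotz_kernel[OF elim, of z]
          by (simp only: times_complex.sel Re_complex_of_real Im_complex_of_real mult_zero_right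
              diff_zero)
      then show ?case using poisson_nonneg[OF z] v(2) by (simp add: mult_left_mono)
    qed
  qed
  also have "\<dots> = m" by (simp add: integral_poisson[OF z])
  finally show ?thesis .
qed

text \<open>\<open>u n\<close> has the boundary exponent \<open>v n = min n (- ln w)\<close>, so
  \<open>u n * h\<close> has \<open>m n = min (n + ln w) 0\<close>. This is nonpositive, vanishes at
  each point for large n and is dominated by |ln w|; by dominated convergence only the unimodular
  factor \<open>c\<close> of \<open>h\<close> remains.\<close>

lemma outer_approximation:
  assumes h: "outer h"
  obtains c u where "norm c = 1" "\<And>n::nat. u n \<in> disk_holo"
    "\<And>n z. norm z < 1 \<Longrightarrow> norm (u n z) \<le> exp (real n)"
    "\<And>n z. norm z < 1 \<Longrightarrow> norm (u n z * h z) \<le> 1"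
    "\<And>z. norm z < 1 \<Longrightarrow> (\<lambda>n. u n z * h z) \<longlonglongrightarrow> c"
proof -
  obtain c w where c: "norm c = 1" and w [measurable]: "w \<in> borel_measurable borel"
    and i: "integrable cm (\<lambda>\<zeta>. ln (w \<zeta>))"
    and hz: "\<And>z. norm z < 1 \<Longrightarrow> h z = c * exp (herglotz (\<lambda>\<zeta>. ln (w \<zeta>)) z)"
    using h unfolding outer_def herglotz_def by auto
  define v where "v n \<zeta> = min (real n) (- ln (w \<zeta>))" for n \<zeta>
  define m where "m n \<zeta> = min (real n + ln (w \<zeta>)) 0" for n \<zeta>
  have [measurable]: "v n \<in> borel_measurable borel" "m n \<in> borel_measurable borel" for n
    unfolding v_def m_def by measurable
  have iv: "integrable cm (v n)" for n
  proof (rule Bochner_Integration.integrable_bound[of _ "\<lambda>\<zeta>. real n + \<bar>ln (w \<zeta>)\<bar>"])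
    show "AE \<zeta> in cm. norm (v n \<zeta>) \<le> norm (real n + \<bar>ln (w \<zeta>)\<bar>)" by (auto simp: v_def)
  qed (use i in auto)
  have mv: "m n = (\<lambda>\<zeta>. v n \<zeta> + ln (w \<zeta>))" for n by (auto simp: m_def v_def)
  have im: "integrable cm (m n)" for n unfolding mv using iv i by simp
  define u where "u n z = (if norm z < 1 then exp (herglotz (v n) z) else 0)" for n z
  have uh: "u n z * h z = c * exp (herglotz (m n) z)" if "norm z < 1" for n z
    using herglotz_add[OF iv i that, of n] that by (simp add: u_def hz mv exp_add mult_ac)
  show thesis
  proof (rule that[OF c, of u])
    fix n and z :: complex
    have "u n holomorphic_on ball 0 1"
      by (rule holomorphic_transform[of "\<lambda>z. exp (herglotz (v n) z)"])
         (auto simp: u_def intro!: holomorphic_on_exp' herglotz_holomorphic iv)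
    then show "u n \<in> disk_holo" by (auto simp: disk_holo_def u_def)
    assume z: "norm z < 1"
    have "Re (herglotz (v n) z) \<le> real n" by (rule Re_herglotz_le[OF iv _ z]) (simp add: v_def)
    then show "norm (u n z) \<le> exp (real n)" using z by (simp add: u_def)
    have "Re (herglotz (m n) z) \<le> 0" by (rule Re_herglotz_le[OF im _ z]) (simp add: m_def)
    then show "norm (u n z * h z) \<le> 1" using c by (simp add: uh[OF z] norm_mult)
  next
    fix z :: complex assume z: "norm z < 1"
    have "(\<lambda>n. herglotz (m n) z) \<longlonglongrightarrow> (LINT \<zeta>|cm. 0)"
      unfolding herglotz_def
    proof (rule integral_dominated_convergence[where w = "\<lambda>\<zeta>. 2 / (1 - norm z) * \<bar>ln (w \<zeta>)\<bar>"])
      show "integrable cm (\<lambda>\<zeta>. 2 / (1 - norm z) * \<bar>ln (w \<zeta>)\<bar>)" using i by simp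
      show "AE \<zeta> in cm. (\<lambda>n. (\<zeta> + z) / (\<zeta> - z) * complex_of_real (m n \<zeta>)) \<longlonglongrightarrow> 0"
      proof (rule AE_I2)
        fix \<zeta>
        have "eventually (\<lambda>n. m n \<zeta> = 0) sequentially"
        proof -
          obtain N :: nat where "- ln (w \<zeta>) \<le> real N" using real_arch_simple by blast
          then show ?thesis
            unfolding eventually_sequentially m_def by (intro exI[of _ N]) (auto simp: min_def)
        qed
        then have "eventually (\<lambda>n. (\<zeta> + z) / (\<zeta> - z) * complex_of_real (m n \<zeta>) = 0) sequentially"
          by eventually_elim simp
        then show "(\<lambda>n. (\<zeta> + z) / (\<zeta> - z) * complex_of_real (m n \<zeta>)) \<longlonglongrightarrow> 0"
          by (rule tendsto_eventually)
      qed
      show "AE \<zeta> in cm. norm ((\<zeta> + z) / (\<zeta> - z) * complex_of_real (m n \<zeta>)) \<le>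
          2 / (1 - norm z) * \<bar>ln (w \<zeta>)\<bar>" for n
        using AE_cm_norm
      proof eventually_elim
        case (elim \<zeta>)
        have "\<bar>m n \<zeta>\<bar> \<le> \<bar>ln (w \<zeta>)\<bar>" by (auto simp: m_def)
        then show ?case
          unfolding norm_mult norm_of_real using norm_herglotz_kernel_le[OF elim z] z
          by (intro mult_mono) auto
      qed
    qed measurable
    then have "(\<lambda>n. c * exp (herglotz (m n) z)) \<longlonglongrightarrow> c * exp 0"
      by (intro tendsto_intros) simp
    then show "(\<lambda>n. u n z * h z) \<longlonglongrightarrow> c" by (simp add: uh[OF z])
  qed
qed

lemma outer_nonzero:
  assumes "outer h" "norm z < 1"
  shows "h z \<noteq> 0"
  using assms unfolding outer_def by fastforce

text \<open>
  A function bounded by 1 whose value at the origin is close to a unimodular constant is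
  close to that constant in the \<open>H\<^sup>2\<close> norm.
\<close>

lemma hardy_norm_diff_const_le:
  assumes G: "G \<in> disk_holo" "\<And>z. norm z < 1 \<Longrightarrow> norm (G z) \<le> 1" and c: "norm c = 1"
  shows "(hardy_norm 2 (\<lambda>z. G z - c * zpow 0 z))\<^sup>2 \<le> 2 - 2 * Re (cnj c * G 0)"
proof -
  have G2: "G \<in> hardy 2" by (rule hardy_bounded[OF G]) simp_all
  have z2: "zpow 0 \<in> hardy 2" by (rule zpow_hardy) simp
  have z0: "taylor (zpow 0) 0 = 1" by (simp add: taylor_zpow)
  have t0: "taylor G 0 = G 0" by (simp add: taylor_def)
  have D: "(\<lambda>z. G z - c * zpow 0 z) \<in> hardy 2" using hardy_lincomb[OF G2 z2, of 1 "-c"] by simp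
  have NG: "hardy_norm 2 G \<le> 1"
  proof (rule hardy_norm_leI)
    fix r :: real assume r: "0 \<le> r" "r < 1"
    have "integral_mean 2 G r \<le> (LINT \<zeta>|cm. 1)"
      unfolding integral_mean_def
    proof (rule integral_mono_AE)
      show "integrable cm (\<lambda>\<zeta>. norm (G (of_real r * \<zeta>)) powr 2)"
        using r by (intro integrable_powr_dilate hardyD(2)[OF G2]) auto
      show "AE \<zeta> in cm. norm (G (of_real r * \<zeta>)) powr 2 \<le> 1"
        using AE_cm_norm
      proof eventually_elim
        case (elim \<zeta>)
        then have "norm (G (of_real r * \<zeta>)) \<le> 1" using r by (intro G) (simp add: norm_mult)
        then show ?case by (simp add: powr_numeral power_le_one)
      qed
    qed simp
    then show "integral_mean 2 G r \<le> 1 powr 2" using cm.prob_space by simp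
  qed auto
  \<comment> \<open>The squared norm expands to |G|^2 - 2 Re (cnj c * G 0) + 1 with |G| the norm of
    \<open>G\<close>, since pairing with \<open>zpow 0\<close> reads off the value at the
    origin.\<close>
  let ?D = "\<lambda>z. 1 * G z + (-c) * zpow 0 z"
  have a: "pairing ?D ?D = 1 * pairing G ?D + (-c) * pairing (zpow 0) ?D"
    by (rule pairing_lincomb_left[OF G2 z2 hardy_lincomb[OF G2 z2]]) simp_all
  have b: "pairing G ?D = cnj 1 * pairing G G + cnj (-c) * pairing G (zpow 0)"
    "pairing (zpow 0) ?D = cnj 1 * pairing (zpow 0) G + cnj (-c) * pairing (zpow 0) (zpow 0)"
    by (rule pairing_lincomb_right[OF G2 z2]; fact)+
  have "(hardy_norm 2 (\<lambda>z. G z - c * zpow 0 z))\<^sup>2 = Re (pairing ?D ?D)"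
    using pairing_self[OF D] by simp
  also have "\<dots> = Re (pairing G G) - 2 * Re (cnj c * pairing G (zpow 0)) + (norm c)\<^sup>2 * Re (pairing
      (zpow 0) (zpow 0))"
  proof -
    have "Im (pairing (zpow 0) (zpow 0)) = 0" using pairing_self[OF z2] by simp
    then show ?thesis
      unfolding a b pairing_commute[of "zpow 0" G] cmod_power2
        by (simp add: algebra_simps power2_eq_square)
  qed
  also have "pairing G (zpow 0) = G 0"
    using pairing_zpow_left[OF G2] pairing_commute[of G "zpow 0"] t0 by simp
  also have "pairing (zpow 0) (zpow 0) = 1"
    using pairing_zpow_left[OF z2] z0 by simp
  also have "pairing G G = of_real ((hardy_norm 2 G)\<^sup>2)" by (rule pairing_self[OF G2])
  finally have "(hardy_norm 2 (\<lambda>z. G z - c * zpow 0 z))\<^sup>2 = (hardy_norm 2 G)\<^sup>2 - 2 * Re (cnj c * G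
      0) + 1"
    using c by simp
  moreover have "(hardy_norm 2 G)\<^sup>2 \<le> 1" using NG hardy_norm_nonneg by (simp add: power_le_one)
  ultimately show ?thesis by linarith
qed

section \<open>The functions of the span are in every Hardy space\<close>

text \<open>These coefficients decay like n^(-3/4); the fourth power keeps the exponents integral.
  With y = n + 1 successive moduli have ratio 1 - 3 / (4 y), and (1 - 3 / (4 y))^4 <= exp (-3 / y)
  <= (y / (y + 1))^3.\<close>

lemma gbinomial_quarter_le:
  "norm ((- 1/4 :: complex) gchoose n) ^ 4 \<le> 1 / (real n + 1) ^ 3"
proof (induction n)
  case (Suc n)
  define y where "y = real n + 1"
  have y: "1 \<le> y" by (simp add: y_def)
  have "(- 1/4 :: complex) gchoose Suc n = ((- 1/4) gchoose n) * ((- 1/4 - of_nat n) / of_nat (Suc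
      n))"
    by (simp add: gbinomial_prod_rev field_simps)
  moreover have "norm ((- 1/4 - of_nat n :: complex) / of_nat (Suc n)) = 1 - 3 / (4 * y)"
  proof -
    have "(- 1/4 - of_nat n :: complex) = of_real (- (real n + 1/4))" by simp
    then have "norm (- 1/4 - of_nat n :: complex) = real n + 1/4"
      by (simp only: norm_of_real)
    then show ?thesis
      unfolding norm_divide norm_of_nat by (simp add: y_def field_simps)
  qed
  ultimately have "norm ((- 1/4 :: complex) gchoose Suc n) ^ 4 = norm ((- 1/4 :: complex) gchoose
      n) ^ 4 * (1 - 3 / (4 * y)) ^ 4"
    by (simp only: norm_mult power_mult_distrib)
  also have "\<dots> \<le> 1 / y ^ 3 * (1 - 3 / (4 * y)) ^ 4"
    using Suc by (intro mult_right_mono) (auto simp: y_def)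
  also have "\<dots> \<le> 1 / y ^ 3 * (y / (y + 1)) ^ 3"
  proof (rule mult_left_mono)
    have "1 + - (3 / (4 * y)) \<le> exp (- (3 / (4 * y)))" by (rule exp_ge_add_one_self)
    moreover have "3 / (4 * y) \<le> 1" using y by (simp add: field_simps)
    ultimately have "(1 - 3 / (4 * y)) ^ 4 \<le> exp (- (3 / (4 * y))) ^ 4"
      by (intro power_mono) auto
    also have "\<dots> = exp (- (1 / y)) ^ 3"
      by (simp flip: exp_of_nat_mult)
    finally have *: "(1 - 3 / (4 * y)) ^ 4 \<le> exp (- (1 / y)) ^ 3" .
    have "exp (- (1 / y)) \<le> y / (y + 1)"
    proof -
      have "1 + 1 / y \<le> exp (1 / y)" by (rule exp_ge_add_one_self)
      moreover have "0 < 1 + 1 / y" using y by (simp add: add_pos_pos)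
      ultimately have "inverse (exp (1 / y)) \<le> inverse (1 + 1 / y)" by (rule le_imp_inverse_le)
      also have "inverse (1 + 1 / y) = y / (y + 1)" using y by (simp add: field_simps)
      finally show ?thesis by (simp add: exp_minus)
    qed
    then have "exp (- (1 / y)) ^ 3 \<le> (y / (y + 1)) ^ 3" by (intro power_mono) auto
    with * show "(1 - 3 / (4 * y)) ^ 4 \<le> (y / (y + 1)) ^ 3" by (rule order_trans)
  qed (use y in simp)
  also have "1 / y ^ 3 * (y / (y + 1)) ^ 3 = 1 / (y + 1) ^ 3"
    using y by (simp add: power_divide)
  also have "y + 1 = real (Suc n) + 1" by (simp add: y_def)
  finally show ?case .
qed simp

text \<open>
  The integrand is the squared modulus of \<open>(1 - w) powr (-1/4)\<close> at \<open>w = (r \<zeta>)\<^sup>k\<close>, and the Taylor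
  coefficients of that function are square summable.
\<close>

lemma integral_inverse_sqrt_bounded:
  assumes k: "1 \<le> k"
  obtains M where "\<And>r. 0 \<le> r \<Longrightarrow> r < 1 \<Longrightarrow> integrable cm (\<lambda>\<zeta>. norm (1 - (of_real r * \<zeta>) ^ k) powr (-
      1/2))"
    "\<And>r. 0 \<le> r \<Longrightarrow> r < 1 \<Longrightarrow> (LINT \<zeta>|cm. norm (1 - (of_real r * \<zeta>) ^ k) powr (- 1/2)) \<le> M"
proof -
  define f :: "complex \<Rightarrow> complex" where "f w = (if norm w < 1 then (1 + (- w)) powr (- 1/4) else
      0)" for w
  define c :: "nat \<Rightarrow> complex" where "c n = ((- 1/4) gchoose n) * (- 1) ^ n" for n
  have sums: "(\<lambda>n. c n * w ^ n) sums f w" if "norm w < 1" for w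
  proof -
    have "(\<lambda>n. ((- 1/4) gchoose n) * (- w) ^ n) sums (1 + (- w)) powr (- 1/4)"
      using that by (intro gen_binomial_complex) simp
    then show ?thesis using that by (simp add: f_def c_def power_minus[of w] mult.assoc)
  qed
  have f: "f \<in> disk_holo" "\<And>n. taylor f n = c n"
    by (rule disk_holo_powser[OF sums]; simp add: f_def)+
  \<comment> \<open>The square root of \<open>gbinomial_quarter_le\<close>. The exponent -3/2 is
    below -1, which is why -1/4 was taken as the power of 1 - w.\<close>
  have c2: "(norm (c n))\<^sup>2 \<le> (real n + 1) powr (- 3/2)" for n
  proof -
    have "((norm (c n))\<^sup>2)\<^sup>2 = norm ((- 1/4 :: complex) gchoose n) ^ 4"
      by (simp add: c_def norm_mult norm_power flip: power_mult)
    also have "\<dots> \<le> 1 / (real n + 1) ^ 3" by (rule gbinomial_quarter_le)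
    also have "\<dots> = ((real n + 1) powr (- 3/2))\<^sup>2"
      by (simp add: powr_minus_divide power_divide powr_powr flip: powr_numeral powr_realpow)
    finally show ?thesis by (rule power2_le_imp_le) simp
  qed
  have s: "summable (\<lambda>n. (norm (c n))\<^sup>2)"
  proof (rule summable_comparison_test')
    have "summable (\<lambda>n. real (Suc n) powr (- 3/2))"
      by (subst summable_Suc_iff) (simp add: summable_real_powr_iff)
    then show "summable (\<lambda>n. (real n + 1) powr (- 3/2))" by (simp add: add.commute)
  qed (use c2 in simp)
  note dm = disk_holo_disk_map[OF f(1)]
  have eq: "norm (1 - (of_real r * \<zeta>) ^ k) powr (- 1/2) = (norm (f (of_real (r ^ k) * \<zeta> ^ k)))\<^sup>2"
    if "0 \<le> r" "r < 1" "norm \<zeta> = 1" for r \<zeta>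
  proof -
    have "norm (of_real (r ^ k) * \<zeta> ^ k) < 1"
      using that k by (simp add: norm_mult norm_power power_less_one_iff)
    then show ?thesis
      by (simp add: f_def norm_powr_real_powr' power_mult_distrib powr_powr flip: powr_numeral)
  qed
  show thesis
  proof (rule that)
    fix r :: real assume r: "0 \<le> r" "r < 1"
    have rk: "0 \<le> r ^ k" "r ^ k < 1" using r k by (auto simp: power_less_one_iff)
    obtain B where B: "\<And>z. norm z \<le> r ^ k \<Longrightarrow> norm (f z) \<le> B"
      using disk_map_bounded_dilate[OF disk_mapD[OF dm] rk] by blast
    show i: "integrable cm (\<lambda>\<zeta>. norm (1 - (of_real r * \<zeta>) ^ k) powr (- 1/2))"
    proof (rule integrable_cm_bounded)
      fix \<zeta> :: complex assume \<zeta>: "norm \<zeta> = 1"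
      have "norm (f (of_real (r ^ k) * \<zeta> ^ k)) \<le> B" 
        using r \<zeta> by (intro B) (simp add: norm_mult norm_power)
      then show "norm (norm (1 - (of_real r * \<zeta>) ^ k) powr (- 1/2)) \<le> B\<^sup>2"
        unfolding eq[OF r \<zeta>] by (simp add: power_mono)
    qed measurable
    have "(\<lambda>n. taylor f n * cnj (taylor f n) * of_real (r ^ k) ^ (2 * n)) sums
      (LINT \<zeta>|cm. f (of_real (r ^ k) * \<zeta> ^ k) * cnj (f (of_real (r ^ k) * \<zeta> ^ k)))"
      using k by (intro dilate_parseval_pow[OF dm dm rk]) simp
    also have "(LINT \<zeta>|cm. f (of_real (r ^ k) * \<zeta> ^ k) * cnj (f (of_real (r ^ k) * \<zeta> ^ k))) =
      (LINT \<zeta>|cm. of_real (norm (1 - (of_real r * \<zeta>) ^ k) powr (- 1/2)))"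
    proof (rule integral_cm_cong)
      show "(\<lambda>\<zeta>. f (of_real (r ^ k) * \<zeta> ^ k) * cnj (f (of_real (r ^ k) * \<zeta> ^ k))) \<in>
          borel_measurable borel"
        using disk_map_borel[OF dm] by measurable
    qed (simp_all only: eq[OF r] complex_norm_square, measurable)
    also have "\<dots> = of_real (LINT \<zeta>|cm. norm (1 - (of_real r * \<zeta>) ^ k) powr (- 1/2))"
      by (rule integral_complex_of_real)
    also have "(\<lambda>n. taylor f n * cnj (taylor f n) * of_real (r ^ k) ^ (2 * n)) =
       (\<lambda>n. of_real ((norm (c n))\<^sup>2 * (r ^ k) ^ (2 * n)))"
      by (simp add: f(2) complex_norm_square[symmetric])
    finally have S: "(\<lambda>n. (norm (c n))\<^sup>2 * (r ^ k) ^ (2 * n)) sums (LINT \<zeta>|cm. norm (1 - (of_real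
        r * \<zeta>) ^ k) powr (- 1/2))"
      by (simp only: sums_of_real_iff)
    have le: "(norm (c n))\<^sup>2 * (r ^ k) ^ (2 * n) \<le> (norm (c n))\<^sup>2" for n
      using r by (intro mult_right_le_one_le power_le_one) auto
    show "(LINT \<zeta>|cm. norm (1 - (of_real r * \<zeta>) ^ k) powr (- 1/2)) \<le> (\<Sum>n. (norm (c n))\<^sup>2)"
      by (rule sums_le[OF le S summable_sums[OF s]])
  qed
qed

text \<open>Near z = 1 the mean is close to 1, so |Ln| is at most 2 k |1 - z| and cancels the pole.
  Elsewhere 1 / |1 - z| <= 2 k, and the logarithm is large only near zeros of 1 - z^k, where ln t <=
  t for t = |1 - z^k|^(-1 / (2 p)) controls it. This exponent makes the p-th power integrable: it
  becomes -1/2 for every \<open>p\<close>.\<close>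

lemma norm_nyman_h_le:
  assumes k: "1 \<le> k" and z: "norm z < 1" and p: "0 < p"
  shows "norm (nyman_h k z) \<le> 2 * real k * (1 + pi + ln (2 * real k)) + 4 * real k * p * norm (1 -
      z ^ k) powr (- 1 / (2 * p))"
proof -
  let ?g = "geom_mean k z"
  have k0: "0 < real k" using k by simp
  have z1: "z \<noteq> 1" using z by auto
  have zk: "norm (z ^ k) < 1" using z k by (simp add: norm_power power_less_one_iff)
  then have zk1: "1 - z ^ k \<noteq> 0" by auto
  have n1: "0 < norm (1 - z)" using z1 by simp
  have ln0: "0 \<le> ln (2 * real k)" using k by (intro ln_ge_zero) auto
  have eq: "norm (nyman_h k z) = norm (Ln ?g) / norm (1 - z)"
    using z by (simp add: nyman_h_def norm_mult norm_divide)
  have rest: "0 \<le> 4 * real k * p * norm (1 - z ^ k) powr (- 1 / (2 * p))" using p by simp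
  show ?thesis
  proof (cases "real k * norm (1 - z) < 1 / 2")
    case True
    have "?g - 1 = (\<Sum>j<k. z ^ j - 1) / of_nat k"
      using k0 by (simp add: geom_mean_def sum_subtractf field_simps)
    also have "norm \<dots> \<le> (\<Sum>j<k. real k * norm (1 - z)) / real k"
      unfolding norm_divide norm_of_nat
    proof (intro divide_right_mono sum_norm_le)
      fix j assume "j \<in> {..<k}"
      have "norm (z ^ j - 1 ^ j) \<le> real j * norm (z - 1)"
        using z by (intro norm_power_diff) auto
      also have "\<dots> \<le> real k * norm (1 - z)"
        using \<open>j \<in> {..<k}\<close> by (intro mult_mono) (auto simp: norm_minus_commute)
      finally show "norm (z ^ j - 1) \<le> real k * norm (1 - z)" by simp
    qed simp
    also have "\<dots> = real k * norm (1 - z)" using k0 by simp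
    finally have g1: "norm (?g - 1) \<le> real k * norm (1 - z)" .
    then have "norm (Ln (1 + (?g - 1))) \<le> 2 * norm (?g - 1)"
      using True by (intro norm_Ln_le) linarith
    then have "norm (Ln ?g) \<le> 2 * (real k * norm (1 - z))" using g1 by simp
    then have "norm (nyman_h k z) \<le> 2 * real k * 1" unfolding eq using n1
      by (simp add: pos_divide_le_eq)
    also have "\<dots> \<le> 2 * real k * (1 + pi + ln (2 * real k))"
      using k0 ln0 pi_gt_zero by (intro mult_left_mono) auto
    finally show ?thesis using rest by linarith
  next
    case False
    have gn: "?g \<noteq> 0" using geom_mean_notin_nonpos_Reals[of k z] k z by auto
    have "(1 - z) * (\<Sum>j<k. z ^ j) = 1 - z ^ k" by (simp add: one_diff_power_eq)
    then have "(\<Sum>j<k. z ^ j) = (1 - z ^ k) / (1 - z)"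
      using z1 by (simp add: nonzero_eq_divide_eq mult.commute)
    then have "?g = (1 - z ^ k) / (of_nat k * (1 - z))"
      by (simp add: geom_mean_def)
    then have ng: "norm ?g = norm (1 - z ^ k) / (real k * norm (1 - z))"
      by (simp add: norm_divide norm_mult)
    have g_le: "norm ?g \<le> 1"
    proof -
      have "norm (\<Sum>j<k. z ^ j) \<le> (\<Sum>j<k. 1)"
        using z by (intro sum_norm_le) (auto simp: norm_power power_le_one)
      then show ?thesis using k0 by (simp add: geom_mean_def norm_divide)
    qed
    have "ln (norm ?g) = ln (norm (1 - z ^ k)) - ln (real k * norm (1 - z))"
    proof -
      have "0 < norm (1 - z ^ k)" "0 < real k * norm (1 - z)" using zk1 k0 n1 by auto
      then show ?thesis unfolding ng by (simp add: ln_div)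
    qed
    moreover have "ln (real k * norm (1 - z)) \<le> ln (2 * real k)"
      using k0 n1 z norm_triangle_ineq4[of 1 z] by (subst ln_le_cancel_iff) auto
    moreover have "- ln (norm (1 - z ^ k)) \<le> 2 * p * norm (1 - z ^ k) powr (- 1 / (2 * p))"
    proof -
      have "ln (norm (1 - z ^ k) powr (- 1 / (2 * p))) \<le> norm (1 - z ^ k) powr (- 1 / (2 * p))"
        using zk1 by (intro ln_bound) auto
      then have "- 1 / (2 * p) * ln (norm (1 - z ^ k)) \<le> norm (1 - z ^ k) powr (- 1 / (2 * p))"
        using zk1 by (simp add: ln_powr)
      then have "2 * p * (- 1 / (2 * p) * ln (norm (1 - z ^ k))) \<le>
          2 * p * norm (1 - z ^ k) powr (- 1 / (2 * p))"
        using p by (intro mult_left_mono) auto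
      then show ?thesis using p by simp
    qed
    moreover have "ln (norm ?g) \<le> 0" using g_le gn by simp
    moreover have "norm (Ln ?g) \<le> \<bar>ln (norm ?g)\<bar> + pi"
    proof -
      have "\<bar>Im (Ln ?g)\<bar> \<le> pi" using mpi_less_Im_Ln[OF gn] Im_Ln_le_pi[OF gn] by auto
      then show ?thesis using cmod_le[of "Ln ?g"] gn by simp
    qed
    ultimately have L: "norm (Ln ?g) \<le> pi + ln (2 * real k) + 2 * p * norm (1 - z ^ k) powr (- 1 /
        (2 * p))" by linarith
    have "norm (nyman_h k z) = norm (Ln ?g) * (1 / norm (1 - z))" by (simp add: eq)
    also have "\<dots> \<le> norm (Ln ?g) * (2 * real k)"
      using False n1 by (intro mult_left_mono) (auto simp: field_simps)
    also have "\<dots> \<le> (pi + ln (2 * real k) + 2 * p * norm (1 - z ^ k) powr (- 1 / (2 * p))) * (2 *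
        real k)"
      using L by (rule mult_right_mono) simp
    also have "\<dots> \<le> 2 * real k * (1 + pi + ln (2 * real k)) + 4 * real k * p * norm (1 - z ^ k)
        powr (- 1 / (2 * p))"
      using k0 by (simp add: algebra_simps)
    finally show ?thesis .
  qed
qed

lemma nyman_h_hardy:
  assumes k: "1 \<le> k" and p: "0 < p"
  shows "nyman_h k \<in> hardy p"
proof -
  have "nyman_h k holomorphic_on ball 0 1"
    by (rule holomorphic_transform[of "\<lambda>z. 1 / (1 - z) * Ln (geom_mean k z)"])
       (auto simp: nyman_h_def intro!: holomorphic_intros Ln_geom_mean_holomorphic k)
  then have dh: "nyman_h k \<in> disk_holo" by (simp add: disk_holo_def nyman_h_def)
  define A where "A = 2 * real k * (1 + pi + ln (2 * real k))"
  define B where "B = 4 * real k * p"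
  have AB: "0 \<le> A" "0 \<le> B" using k p pi_gt_zero
    by (auto simp: A_def B_def intro!: mult_nonneg_nonneg add_nonneg_nonneg)
  obtain M where M: "\<And>r. 0 \<le> r \<Longrightarrow> r < 1 \<Longrightarrow> integrable cm (\<lambda>\<zeta>. norm (1 - (of_real r * \<zeta>) ^ k) powr (-
      1/2))"
    "\<And>r. 0 \<le> r \<Longrightarrow> r < 1 \<Longrightarrow> (LINT \<zeta>|cm. norm (1 - (of_real r * \<zeta>) ^ k) powr (- 1/2)) \<le> M"
    using integral_inverse_sqrt_bounded[OF k] by blast
  show ?thesis
  proof (rule hardyI[OF dh])
    fix r :: real assume r: "0 \<le> r" "r < 1"
    let ?x = "\<lambda>\<zeta>. norm (1 - (of_real r * \<zeta>) ^ k)"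
    have "integral_mean p (nyman_h k) r \<le> (LINT \<zeta>|cm. 2 powr p * (A powr p + B powr p * ?x \<zeta> powr
        (- 1/2)))"
      unfolding integral_mean_def
    proof (rule integral_mono_AE)
      show "integrable cm (\<lambda>\<zeta>. norm (nyman_h k (of_real r * \<zeta>)) powr p)"
        using r p by (intro integrable_powr_dilate disk_holo_disk_map dh) auto
      show "integrable cm (\<lambda>\<zeta>. 2 powr p * (A powr p + B powr p * ?x \<zeta> powr (- 1/2)))"
        using M(1)[OF r] by simp
      show "AE \<zeta> in cm. norm (nyman_h k (of_real r * \<zeta>)) powr p \<le> 2 powr p * (A powr p +
          B powr p * ?x \<zeta> powr (- 1/2))"
        using AE_cm_norm
      proof eventually_elim
        case (elim \<zeta>)
        have "norm (nyman_h k (of_real r * \<zeta>)) \<le> A + B * ?x \<zeta> powr (- 1 / (2 * p))"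
          using norm_nyman_h_le[OF k _ p, of "of_real r * \<zeta>"] elim r
            by (simp add: A_def B_def norm_mult)
        then have "norm (nyman_h k (of_real r * \<zeta>)) powr p \<le> (A + B * ?x \<zeta> powr (- 1 / (2 * p)))
            powr p"
          using p by (intro powr_mono2) auto
        also have "\<dots> \<le> 2 powr p * (A powr p + (B * ?x \<zeta> powr (- 1 / (2 * p))) powr p)"
          using AB p by (intro powr_add_le) auto
        also have "(B * ?x \<zeta> powr (- 1 / (2 * p))) powr p = B powr p * ?x \<zeta> powr (- 1/2)"
          using AB p by (simp add: powr_mult powr_powr)
        finally show ?case .
      qed
    qed
    also have "\<dots> = 2 powr p * (A powr p + B powr p * (LINT \<zeta>|cm. ?x \<zeta> powr (- 1/2)))"
      using M(1)[OF r] cm.prob_space by simp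
    also have "\<dots> \<le> 2 powr p * (A powr p + B powr p * M)"
      using M(2)[OF r] by (intro mult_left_mono add_left_mono) auto
    finally show "integral_mean p (nyman_h k) r \<le> 2 powr p * (A powr p + B powr p * M)" .
  qed
qed

section \<open>Functionals bounded on the domain\<close>

lemma nyman_span_hardy:
  assumes "f \<in> nyman_span" "0 < p"
  shows "f \<in> hardy p"
  using assms unfolding nyman_span_def by (force intro!: hardy_sum nyman_h_hardy)

lemma toeplitz_inverse:
  assumes "\<And>z. norm z < 1 \<Longrightarrow> \<phi> z \<noteq> 0" "\<And>z. 1 \<le> norm z \<Longrightarrow> f z = 0"
  shows "toeplitz (\<lambda>z. 1 / \<phi> z) (toeplitz \<phi> f) = f"
proof
  fix z show "toeplitz (\<lambda>z. 1 / \<phi> z) (toeplitz \<phi> f) z = f z"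
    using assms[of z] by (cases "norm z < 1") (auto simp: toeplitz_def)
qed

text \<open>Put G_n = u_n h. As |G_n| <= 1 and G_n(0) -> c, the differences G_n - c tend to 0 in
  H^2, and so do their products with z^m. All pairings of z^m G_n with \<open>g\<close> vanish,
  hence so does the one of c z^m, which is the m-th coefficient up to conjugation and a unimodular
  factor.\<close>

lemma zpow_outer_approximation_pairing:
  assumes u: "\<And>n::nat. u n \<in> disk_holo" and h: "h \<in> hardy_inf"
    and le: "\<And>n z. norm z < 1 \<Longrightarrow> norm (u n z * h z) \<le> 1"
    and lim: "(\<lambda>n. u n 0 * h 0) \<longlonglongrightarrow> c" and c: "norm c = 1"
    and g: "g \<in> hardy 2"
    and zero: "\<And>n. pairing (\<lambda>z. zpow m z * (u n z * h z)) g = 0"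
  shows "taylor g m = 0"
proof -
  define G where "G n z = u n z * h z" for n z
  have Gd: "G n \<in> disk_holo" for n
    unfolding G_def[abs_def] using u h by (intro disk_holo_mult) (auto simp: hardy_inf_def)
  have Gle: "norm z < 1 \<Longrightarrow> norm (G n z) \<le> 1" for n z using le by (simp add: G_def)
  have G2: "G n \<in> hardy 2" for n by (rule hardy_bounded[OF Gd Gle]) simp_all
  have z2: "zpow j \<in> hardy 2" for j by (rule zpow_hardy) simp
  define D where "D n z = G n z - c * zpow 0 z" for n z
  have D2: "D n \<in> hardy 2" for n
    using hardy_lincomb[OF G2[of n] z2[of 0], of 1 "-c"] by (simp add: D_def[abs_def])
  have m2: "(\<lambda>z. zpow m z * f z) \<in> hardy 2" "hardy_norm 2 (\<lambda>z. zpow m z * f z) \<le>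
      hardy_norm 2 f" if "f \<in> hardy 2" for f
    using hardy_bounded_mult[OF zpow_disk_holo norm_zpow_le that] by simp_all
  have "(\<lambda>z. zpow m z * zpow 0 z) = zpow m" by (auto simp: zpow_def)
  then have e: "(\<lambda>z. zpow m z * D n z) = (\<lambda>z. 1 * (zpow m z * G n z) + (- c) * zpow m z)" for n
    by (auto simp: D_def algebra_simps fun_eq_iff)
  have "norm (c * pairing (zpow m) g) \<le> hardy_norm 2 (D n) * hardy_norm 2 g" for n
  proof -
    have "pairing (\<lambda>z. zpow m z * D n z) g = 1 * pairing (\<lambda>z. zpow m z * G n z) g +
        (- c) * pairing (zpow m) g"
      unfolding e by (rule pairing_lincomb_left[OF m2(1)[OF G2] z2 g]) simp_all
    also have "pairing (\<lambda>z. zpow m z * G n z) g = 0" unfolding G_def by (rule zero)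
    finally have "norm (c * pairing (zpow m) g) = norm (pairing (\<lambda>z. zpow m z * D n z) g)" by simp
    also have "\<dots> \<le> hardy_norm 2 (\<lambda>z. zpow m z * D n z) * hardy_norm 2 g"
      by (rule pairing_Cauchy_Schwarz[OF m2(1)[OF D2] g])
    also have "\<dots> \<le> hardy_norm 2 (D n) * hardy_norm 2 g"
      by (intro mult_right_mono m2 D2 hardy_norm_nonneg)
    finally show ?thesis .
  qed
  moreover have "(\<lambda>n. hardy_norm 2 (D n) * hardy_norm 2 g) \<longlonglongrightarrow> 0 * hardy_norm 2 g"
  proof (intro tendsto_mult tendsto_const)
    have "(\<lambda>n. sqrt (2 - 2 * Re (cnj c * G n 0))) \<longlonglongrightarrow> sqrt (2 - 2 * Re (cnj c * c))"
      using lim unfolding G_def by (intro tendsto_intros)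
    also have "cnj c * c = 1" using c
      by (metis complex_norm_square mult.commute of_real_1 one_power2)
    finally have "(\<lambda>n. sqrt (2 - 2 * Re (cnj c * G n 0))) \<longlonglongrightarrow> 0" by simp
    moreover have "norm (hardy_norm 2 (D n)) \<le> sqrt (2 - 2 * Re (cnj c * G n 0))" for n
      using hardy_norm_diff_const_le[OF Gd Gle c, of n] hardy_norm_nonneg[of 2 "D n"]
      by (simp add: D_def[abs_def] real_le_rsqrt)
    ultimately show "(\<lambda>n. hardy_norm 2 (D n)) \<longlonglongrightarrow> 0"
      by (rule Lim_null_comparison[OF always_eventually[OF allI], rotated])
  qed
  ultimately have "norm (c * pairing (zpow m) g) \<le> 0 * hardy_norm 2 g"
    by (intro tendsto_lowerbound[of "\<lambda>n. hardy_norm 2 (D n) * hardy_norm 2 g"]) auto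
  then have "pairing (zpow m) g = 0" using c by auto
  then show ?thesis using pairing_zpow_left[OF g] by simp
qed

lemma toeplitz_dom_lincomb:
  assumes "f \<in> toeplitz_dom p \<psi>" "g \<in> toeplitz_dom p \<psi>" "0 < p"
  shows "(\<lambda>z. c * f z + d * g z) \<in> toeplitz_dom p \<psi>"
    "toeplitz \<psi> (\<lambda>z. c * f z + d * g z) = (\<lambda>z. c * toeplitz \<psi> f z + d * toeplitz \<psi> g z)"
proof -
  show e: "toeplitz \<psi> (\<lambda>z. c * f z + d * g z) = (\<lambda>z. c * toeplitz \<psi> f z + d * toeplitz \<psi> g z)"
    by (auto simp: toeplitz_def algebra_simps)
  then show "(\<lambda>z. c * f z + d * g z) \<in> toeplitz_dom p \<psi>"
    using assms by (auto simp: toeplitz_dom_def intro!: hardy_lincomb)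
qed

text \<open>For \<phi> = g / h the element F = z^m u_n g does it, since division by \<phi> replaces
  \<open>g\<close> by \<open>h\<close>. Both functions are bounded on the disk and hence in every
  H^p.\<close>

lemma smirnov_unit_toeplitz_dom:
  assumes \<phi>: "smirnov_unit \<phi>" and p: "0 < p"
  obtains c u h where "norm c = 1" "\<And>n::nat. u n \<in> disk_holo" "h \<in> hardy_inf"
    "\<And>n z. norm z < 1 \<Longrightarrow> norm (u n z * h z) \<le> 1" "(\<lambda>n. u n 0 * h 0) \<longlonglongrightarrow> c"
    "\<And>n m. \<exists>F\<in>toeplitz_dom p (\<lambda>z. 1 / \<phi> z). toeplitz (\<lambda>z. 1 / \<phi> z) F =
        (\<lambda>z. zpow m z * (u n z * h z))"
proof -
  have nz: "\<phi> z \<noteq> 0" if "norm z < 1" for z using \<phi> that by (simp add: smirnov_unit_def)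
  obtain g h where g: "g \<in> hardy_inf" and h: "h \<in> hardy_inf" "outer h"
    and gh: "\<And>z. norm z < 1 \<Longrightarrow> \<phi> z = g z / h z"
    using \<phi> unfolding smirnov_unit_def smirnov_def by auto
  obtain c u where u: "norm c = 1" "\<And>n::nat. u n \<in> disk_holo"
    "\<And>n z. norm z < 1 \<Longrightarrow> norm (u n z) \<le> exp (real n)"
    "\<And>n z. norm z < 1 \<Longrightarrow> norm (u n z * h z) \<le> 1"
    "\<And>z. norm z < 1 \<Longrightarrow> (\<lambda>n. u n z * h z) \<longlonglongrightarrow> c"
    using outer_approximation[OF h(2)] by blast
  show thesis
  proof (rule that[OF u(1,2) h(1) u(4)])
    show "(\<lambda>n. u n 0 * h 0) \<longlonglongrightarrow> c" by (rule u(5)) simp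
    fix n m
    define F where "F z = zpow m z * (u n z * g z)" for z
    obtain B where "\<forall>z\<in>ball 0 1. norm (g z) \<le> B"
      using g by (auto simp: hardy_inf_def bounded_iff)
    then have B: "norm (g z) \<le> B" if "norm z < 1" for z using that by simp
    have gd: "g \<in> disk_holo" and hd: "h \<in> disk_holo" using g h by (auto simp: hardy_inf_def)
    have g1: "g \<in> hardy p" by (rule hardy_bounded[OF gd B p])
    have F: "F \<in> hardy p"
      unfolding F_def[abs_def]
      by (intro hardy_bounded_mult(1)[OF zpow_disk_holo norm_zpow_le] hardy_bounded_mult(1)[OF
          u(2,3)] g1 p)
    have uh: "(\<lambda>z. u n z * h z) \<in> hardy p"
      by (rule hardy_bounded[OF disk_holo_mult[OF u(2) hd] u(4) p])
    have H: "(\<lambda>z. zpow m z * (u n z * h z)) \<in> hardy p"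
      by (rule hardy_bounded_mult(1)[OF zpow_disk_holo norm_zpow_le uh p])
    have e: "toeplitz (\<lambda>z. 1 / \<phi> z) F = (\<lambda>z. zpow m z * (u n z * h z))"
    proof
      fix z show "toeplitz (\<lambda>z. 1 / \<phi> z) F z = zpow m z * (u n z * h z)"
      proof (cases "norm z < 1")
        case True
        then show ?thesis using nz[OF True] unfolding toeplitz_def F_def gh[OF True]
          by (simp add: field_simps)
      qed (simp add: toeplitz_def F_def zpow_def)
    qed
    show "\<exists>F\<in>toeplitz_dom p (\<lambda>z. 1 / \<phi> z). toeplitz (\<lambda>z. 1 / \<phi> z) F =
        (\<lambda>z. zpow m z * (u n z * h z))"
      using F H e by (intro bexI[of _ F]) (simp_all add: toeplitz_dom_def)
  qed
qed

text \<open>The common core of both conclusions, which differ only in how \<open>bd\<close> is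
  obtained. Membership of \<open>g\<close> in H^q makes its pairing linear on H^p, membership in H^2
  serves the final argument with Taylor coefficients.\<close>

lemma nyman_perp_bounded_functional_zero:
  assumes \<phi>: "smirnov_unit \<phi>" and p: "1 < p" "1 / p + 1 / q = 1"
    and dense: "dense_in_hardy p (toeplitz \<phi> ` nyman_span)"
    and g: "g \<in> nyman_perp" "g \<in> hardy q"
    and bd: "\<And>F. F \<in> toeplitz_dom p (\<lambda>z. 1 / \<phi> z) \<Longrightarrow> norm (pairing (toeplitz (\<lambda>z. 1 / \<phi> z) F) g) \<le>
        C * hardy_norm p F"
  shows "g = (\<lambda>z. 0)"
proof -
  let ?\<psi> = "\<lambda>z. 1 / \<phi> z"
  have p0: "0 < p" using p by simp
  have nz: "\<phi> z \<noteq> 0" if "norm z < 1" for z using \<phi> that by (simp add: smirnov_unit_def)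
  have g2: "g \<in> hardy 2" using g by (simp add: nyman_perp_def)
  have zero: "pairing (toeplitz ?\<psi> F) g = 0" if F: "F \<in> toeplitz_dom p ?\<psi>" for F
  proof -
    \<comment> \<open>The absolute value is taken because \<open>bd\<close> says nothing about the
      sign of \<open>C\<close>.\<close>
    have le: "norm (pairing (toeplitz ?\<psi> F) g) \<le> \<bar>C\<bar> * e" if e: "0 < e" for e
    proof -
      have "F \<in> hardy p" using F by (simp add: toeplitz_dom_def)
      then obtain f where f: "f \<in> nyman_span" "toeplitz \<phi> f \<in> hardy p"
          "hardy_norm p (\<lambda>z. F z - toeplitz \<phi> f z) < e"
        using dense e unfolding dense_in_hardy_def by blast
      have fp: "f \<in> hardy p" by (rule nyman_span_hardy[OF f(1) p0])
      \<comment> \<open>Division by \<phi> returns the element f of the span, which is in H^p; so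
        \<phi> f lies in the domain, and the functional there is the pairing of f with
        \<open>g\<close>, that is 0.\<close>
      have inv: "toeplitz ?\<psi> (toeplitz \<phi> f) = f"
        by (rule toeplitz_inverse[OF nz]) (use hardyD(3)[OF fp] in auto)
      have G: "toeplitz \<phi> f \<in> toeplitz_dom p ?\<psi>"
        using f fp by (simp add: toeplitz_dom_def inv)
      note D = toeplitz_dom_lincomb[OF F G p0, of 1 "-1"]
      have "pairing (toeplitz ?\<psi> (\<lambda>z. 1 * F z + (- 1) * toeplitz \<phi> f z)) g =
          1 * pairing (toeplitz ?\<psi> F) g + (- 1) * pairing f g"
        unfolding D(2) inv using F fp by (intro pairing_lincomb_left[OF _ _ g(2) p])
            (auto simp: toeplitz_dom_def)
      moreover have "pairing f g = 0" using g f by (simp add: nyman_perp_def)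
      ultimately have "norm (pairing (toeplitz ?\<psi> F) g) \<le> C * hardy_norm p (\<lambda>z. F z - toeplitz \<phi> f
          z)"
        using bd[OF D(1)] by simp
      also have "\<dots> \<le> \<bar>C\<bar> * hardy_norm p (\<lambda>z. F z - toeplitz \<phi> f z)"
        by (intro mult_right_mono hardy_norm_nonneg) simp
      also have "\<dots> \<le> \<bar>C\<bar> * e" using f by (intro mult_left_mono) auto
      finally show ?thesis .
    qed
    have "((\<lambda>e. \<bar>C\<bar> * e) \<longlongrightarrow> \<bar>C\<bar> * 0) (at_right 0)" by (intro tendsto_intros)
    moreover have "eventually (\<lambda>e. norm (pairing (toeplitz ?\<psi> F) g) \<le> \<bar>C\<bar> * e) (at_right 0)"
      using le by (auto simp: eventually_at_filter)
    ultimately have "norm (pairing (toeplitz ?\<psi> F) g) \<le> \<bar>C\<bar> * 0"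
      by (intro tendsto_lowerbound[of "\<lambda>e. \<bar>C\<bar> * e" _ "at_right 0"]) auto
    then show ?thesis by simp
  qed
  obtain c u h where u: "norm c = 1" "\<And>n::nat. u n \<in> disk_holo" "h \<in> hardy_inf"
    "\<And>n z. norm z < 1 \<Longrightarrow> norm (u n z * h z) \<le> 1" "(\<lambda>n. u n 0 * h 0) \<longlonglongrightarrow> c"
    "\<And>n m. \<exists>F\<in>toeplitz_dom p ?\<psi>. toeplitz ?\<psi> F = (\<lambda>z. zpow m z * (u n z * h z))"
    using smirnov_unit_toeplitz_dom[OF \<phi> p0] by blast
  have "taylor g m = 0" for m
  proof (rule zpow_outer_approximation_pairing[OF u(2-5,1) g2])
    fix n
    obtain F where "F \<in> toeplitz_dom p ?\<psi>" "toeplitz ?\<psi> F = (\<lambda>z. zpow m z * (u n z * h z))"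
      using u(6) by blast
    then show "pairing (\<lambda>z. zpow m z * (u n z * h z)) g = 0" using zero by metis
  qed
  then show ?thesis by (rule taylor_zero_imp[OF hardyD(1)[OF g2]])
qed

lemma zero_hardy: "0 < p \<Longrightarrow> (\<lambda>z. 0) \<in> hardy p"
  using hardy_sum[of "{}" "\<lambda>k. undefined" p] by simp

lemma pairing_zero_right: "pairing f (\<lambda>z. 0) = 0"
proof -
  have "bdry (\<lambda>z. 0) \<zeta> = 0" for \<zeta> by (rule tendsto_bdry) simp
  then show ?thesis by (simp add: pairing_def)
qed

lemma zero_nyman_perp: "(\<lambda>z. 0) \<in> nyman_perp"
  by (simp add: nyman_perp_def zero_hardy pairing_zero_right)

text \<open>The function \<open>h\<close> from the definition of the adjoint domain turns the
  functional into pairing with \<open>h\<close>, so its norm serves as the constant.\<close>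

lemma nyman_perp_adjoint_domain:
  assumes \<phi>: "smirnov_unit \<phi>" and p: "1 < p" "1 / p + 1 / q = 1"
    and dense: "dense_in_hardy p (toeplitz \<phi> ` nyman_span)"
  shows "nyman_perp \<inter> toeplitz_adj_dom p q (\<lambda>z. 1 / \<phi> z) = {\<lambda>z. 0}"
proof (intro equalityI subsetI)
  fix g assume "g \<in> nyman_perp \<inter> toeplitz_adj_dom p q (\<lambda>z. 1 / \<phi> z)"
  then obtain h where g: "g \<in> nyman_perp" "g \<in> hardy q" and h: "h \<in> hardy q"
    "\<And>f. f \<in> toeplitz_dom p (\<lambda>z. 1 / \<phi> z) \<Longrightarrow> pairing f h = pairing (toeplitz (\<lambda>z. 1 / \<phi> z) f) g"
    by (auto simp: toeplitz_adj_dom_def)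
  have "norm (pairing (toeplitz (\<lambda>z. 1 / \<phi> z) F) g) \<le> hardy_norm q h * hardy_norm p F"
    if F: "F \<in> toeplitz_dom p (\<lambda>z. 1 / \<phi> z)" for F
    using pairing_Hoelder(2)[OF _ h(1) p, of F] h(2)[OF F] F
      by (simp add: toeplitz_dom_def mult.commute)
  then show "g \<in> {\<lambda>z. 0}"
    using nyman_perp_bounded_functional_zero[OF \<phi> p dense g] by blast
next
  have "0 < q" using conjugate_exponent_gt_1[OF p] by simp
  fix g :: "complex \<Rightarrow> complex" assume "g \<in> {\<lambda>z. 0}"
  then show "g \<in> nyman_perp \<inter> toeplitz_adj_dom p q (\<lambda>z. 1 / \<phi> z)"
    using zero_nyman_perp zero_hardy[OF \<open>0 < q\<close>]
    by (auto simp: toeplitz_adj_dom_def pairing_zero_right intro!: bexI[of _ "\<lambda>z. 0"])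
qed

section \<open>Positive square roots\<close>

text \<open>The Taylor coefficients of (1 - x)^(1/2) at 0.\<close>

definition sqrt_coeff :: "nat \<Rightarrow> real" where
  "sqrt_coeff k = ((1/2) gchoose k) * (- 1) ^ k"

lemma sqrt_coeff_0: "sqrt_coeff 0 = 1"
  by (simp add: sqrt_coeff_def)

lemma sqrt_coeff_nonpos: "sqrt_coeff (Suc k) \<le> 0"
proof (induction k)
  case (Suc k)
  have "sqrt_coeff (Suc (Suc k)) = sqrt_coeff (Suc k) * ((real (Suc k) - 1/2) / real (Suc (Suc k)))"
    by (simp add: sqrt_coeff_def gbinomial_prod_rev field_simps)
  also have "\<dots> \<le> 0" using Suc by (intro mult_nonpos_nonneg) auto
  finally show ?case .
qed (simp add: sqrt_coeff_def)

lemma gbinomial_minus_half_nonneg: "0 \<le> (- 1) ^ n * ((- 1/2 :: real) gchoose n)"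
proof (induction n)
  case (Suc n)
  have "(- 1) ^ Suc n * ((- 1/2 :: real) gchoose Suc n) = ((- 1) ^ n * ((- 1/2) gchoose n)) *
      ((real n + 1/2) / real (Suc n))"
    by (simp add: gbinomial_prod_rev field_simps)
  then show ?case using Suc by simp
qed simp

text \<open>Dividing (1 - x)^(1/2) by 1 - x shows that the partial sums of its coefficients are the
  coefficients of (1 - x)^(-1/2), which are nonnegative. As all coefficients after the leading 1 are
  nonpositive, their absolute values cannot exceed it in sum.\<close>

lemma sqrt_coeff_partial_sums: "(\<Sum>k<n. \<bar>sqrt_coeff (Suc k)\<bar>) \<le> 1"
proof -
  have "(\<Sum>k\<le>n. sqrt_coeff k) = (- 1) ^ n * ((- 1/2) gchoose n)"
    using gbinomial_sum_lower_neg[of "1/2::real" n] by (simp add: sqrt_coeff_def)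
  then have "0 \<le> (\<Sum>k\<le>n. sqrt_coeff k)" using gbinomial_minus_half_nonneg[of n] by simp
  also have "(\<Sum>k\<le>n. sqrt_coeff k) = 1 + (\<Sum>k<n. sqrt_coeff (Suc k))"
    by (simp add: sum.atMost_shift sqrt_coeff_0)
  finally have "0 \<le> 1 + (\<Sum>k<n. sqrt_coeff (Suc k))" .
  moreover have "(\<Sum>k<n. \<bar>sqrt_coeff (Suc k)\<bar>) = - (\<Sum>k<n. sqrt_coeff (Suc k))"
    using sqrt_coeff_nonpos by (simp add: sum_negf[symmetric] abs_of_nonpos)
  ultimately show ?thesis by linarith
qed

lemma summable_sqrt_coeff_Suc: "summable (\<lambda>k. \<bar>sqrt_coeff (Suc k)\<bar>)"
  by (rule bounded_imp_summable[of _ 1]) (use sqrt_coeff_partial_sums[of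
      "Suc _"] in \<open>auto simp: lessThan_Suc_atMost\<close>)

lemma summable_sqrt_coeff: "summable (\<lambda>k. \<bar>sqrt_coeff k\<bar>)"
  using summable_sqrt_coeff_Suc by (subst (asm) summable_Suc_iff)

text \<open>The square of (1 - x)^(1/2) is 1 - x; in coefficients this is Vandermonde's identity for
  1/2 + 1/2.\<close>

lemma sqrt_coeff_conv: "(\<Sum>i\<le>n. sqrt_coeff i * sqrt_coeff (n - i)) = (if n = 0 then 1 else if n =
    1 then - 1 else 0)"
proof -
  have "(\<Sum>i\<le>n. sqrt_coeff i * sqrt_coeff (n - i)) = (\<Sum>i\<le>n. (- 1) ^ n * (((1/2) gchoose i) * ((1/2)
      gchoose (n - i))))"
  proof (rule sum.cong)
    fix i assume "i \<in> {..n}"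
    then have "(- 1 :: real) ^ n = (- 1) ^ i * (- 1) ^ (n - i)" by (simp flip: power_add)
    then show "sqrt_coeff i * sqrt_coeff (n - i) = (- 1) ^ n * (((1/2) gchoose i) * ((1/2) gchoose
        (n - i)))"
      by (simp add: sqrt_coeff_def)
  qed simp
  also have "\<dots> = (- 1) ^ n * ((1/2 + 1/2) gchoose n)"
    using gbinomial_Vandermonde[of "1/2::real" "1/2" n]
      by (simp add: sum_distrib_left[symmetric] atLeast0AtMost)
  also have "((1/2 + 1/2 :: real) gchoose n) = of_nat (1 choose n)"
    using binomial_gbinomial[of 1 n, where ?'a = real] by simp
  also have "(- 1) ^ n * of_nat (1 choose n) = (if n = 0 then 1 else if n =
      1 then - 1 else (0::real))"
    by (cases n) (auto simp: binomial_eq_0)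
  finally show ?thesis .
qed

text \<open>Squaring an operator series weakly: x_n stands for <h, A^n f> and y_k for <A^k h, S f>.
  The double series of e_k e_j x_(k+j) converges absolutely and may be summed along k + j =
  n.\<close>

lemma iterated_Cauchy_product:
  fixes e :: "nat \<Rightarrow> real" and x y :: "nat \<Rightarrow> complex"
  assumes e: "summable (\<lambda>k. \<bar>e k\<bar>)" and X: "\<And>n. norm (x n) \<le> X"
    and y: "\<And>k. (\<lambda>j. of_real (e j) * x (k + j)) sums y k"
    and s: "(\<lambda>k. of_real (e k) * y k) sums s"
    and conv: "\<And>n. N \<le> n \<Longrightarrow> (\<Sum>i\<le>n. e i * e (n - i)) = 0"
  shows "s = (\<Sum>n<N. of_real (\<Sum>i\<le>n. e i * e (n - i)) * x n)"
proof -
  define f where "f = (\<lambda>(k, j). of_real (e k * e j) * x (k + j))"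
  have X0: "0 \<le> X" using X[of 0] by (rule order_trans[OF norm_ge_zero])
  have es: "(\<lambda>k. \<bar>e k\<bar>) summable_on UNIV" using e by (simp add: summable_on_UNIV_nonneg_real_iff)
  have "(\<lambda>p. norm (case p of (k, j) \<Rightarrow> X * (\<bar>e k\<bar> * \<bar>e j\<bar>))) summable_on UNIV \<times> UNIV"
    unfolding Infinite_Sum.abs_summable_on_Sigma_iff
    using es X0 by (auto simp: abs_mult infsum_cmult_right' intro!: summable_on_cmult_right
        summable_on_cmult_left)
  then have "(\<lambda>p. norm (f p)) summable_on UNIV \<times> UNIV"
  proof (rule Infinite_Sum.abs_summable_on_comparison_test)
    fix p :: "nat \<times> nat"
    show "norm (f p) \<le> norm (case p of (k, j) \<Rightarrow> X * (\<bar>e k\<bar> * \<bar>e j\<bar>))"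
      using X X0 by (cases p) (auto simp: f_def norm_mult abs_mult mult.commute intro!: mult_mono)
  qed
  then have fs: "f summable_on UNIV \<times> UNIV" by (rule Infinite_Sum.abs_summable_summable)
  have nx: "summable (\<lambda>j. norm (of_real (e j) * x (k + j)))" for k
    by (rule summable_comparison_test'[OF summable_mult2[OF e, of X]])
        (use X in \<open>auto simp: norm_mult intro!: mult_left_mono\<close>)
  have yk: "infsum (\<lambda>j. f (k, j)) UNIV = of_real (e k) * y k" for k
  proof -
    have "((\<lambda>j. of_real (e j) * x (k + j)) has_sum y k) UNIV"
      by (rule norm_summable_imp_has_sum[OF nx y])
    then have "((\<lambda>j. of_real (e k) * (of_real (e j) * x (k + j))) has_sum (of_real (e k) * y k))
        UNIV"
      by (rule has_sum_cmult_right)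
    then show ?thesis by (intro infsumI) (simp add: f_def mult.assoc)
  qed
  have ny: "norm (y k) \<le> (\<Sum>k. \<bar>e k\<bar> * X)" for k
  proof -
    have "norm (y k) \<le> (\<Sum>j. norm (of_real (e j) * x (k + j)))"
      using summable_norm[OF nx[of k]] sums_unique[OF y[of k]] by simp
    also have "\<dots> \<le> (\<Sum>k. \<bar>e k\<bar> * X)"
      by (rule suminf_le[OF _ nx summable_mult2[OF e]]) (use X in \<open>auto simp: norm_mult intro!:
          mult_left_mono\<close>)
    finally show ?thesis .
  qed
  have "summable (\<lambda>k. norm (of_real (e k) * y k))"
    by (rule summable_comparison_test'[OF summable_mult2[OF e]]) (use ny in \<open>auto simp: norm_mult
        intro!: mult_left_mono\<close>)
  then have "s = infsum (\<lambda>k. of_real (e k) * y k) UNIV"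
    by (intro infsumI[symmetric] norm_summable_imp_has_sum s)
  also have "\<dots> = infsum (\<lambda>k. infsum (\<lambda>j. f (k, j)) UNIV) UNIV" by (simp add: yk)
  also have "\<dots> = infsum f (UNIV \<times> UNIV)" by (rule infsum_Sigma_banach[OF fs])
  also have "\<dots> = infsum (\<lambda>(n, i). f (i, n - i)) (Sigma UNIV (\<lambda>n. {..n}))"
    by (rule infsum_reindex_bij_witness[of _ "\<lambda>(n, i). (i, n - i)" "\<lambda>(k, j). (k + j, k)"]) auto
  also have "\<dots> = infsum (\<lambda>n. infsum (\<lambda>i. f (i, n - i)) {..n}) UNIV"
  proof -
    have "(\<lambda>(n, i). f (i, n - i)) summable_on (Sigma UNIV (\<lambda>n. {..n})) \<longleftrightarrow> f summable_on UNIV \<times> UNIV"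
      by (rule summable_on_reindex_bij_witness[of _ "\<lambda>(k, j). (k + j, k)"
          "\<lambda>(n, i). (i, n - i)"]) auto
    then show ?thesis using infsum_Sigma_banach[of "\<lambda>(n, i). f (i, n - i)" UNIV "\<lambda>n. {..n}"] fs
      by simp
  qed
  also have "\<dots> = infsum (\<lambda>n. of_real (\<Sum>i\<le>n. e i * e (n - i)) * x n) UNIV"
    by (intro infsum_cong) (simp add: f_def sum_distrib_right)
  also have "\<dots> = infsum (\<lambda>n. of_real (\<Sum>i\<le>n. e i * e (n - i)) * x n) {..<N}"
    by (rule infsum_cong_neutral) (use conv in \<open>auto simp del: of_real_sum of_real_mult\<close>)
  also have "\<dots> = (\<Sum>n<N. of_real (\<Sum>i\<le>n. e i * e (n - i)) * x n)" by (rule infsum_finite) simp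
  finally show ?thesis .
qed

lemma hardy_2_eqI:
  assumes f: "f \<in> hardy 2" and g: "g \<in> hardy 2" and eq: "\<And>h. h \<in> hardy 2 \<Longrightarrow> pairing h f =
      pairing h g"
  shows "f = g"
proof -
  have d: "(\<lambda>z. f z - g z) \<in> hardy 2" by (rule hardy_diff[OF f g]) simp
  have "taylor (\<lambda>z. f z - g z) n = 0" for n
  proof -
    have "taylor (\<lambda>z. 1 * f z + (- 1) * g z) n = 1 * taylor f n + (- 1) * taylor g n"
      by (rule taylor_lincomb) (use f g in \<open>auto intro: hardyD\<close>)
    moreover have "cnj (taylor f n) = cnj (taylor g n)"
      using eq[of "zpow n"] pairing_zpow_left[OF f] pairing_zpow_left[OF g]
        by (simp add: zpow_hardy)
    ultimately show ?thesis by simp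
  qed
  then have "(\<lambda>z. f z - g z) = (\<lambda>z. 0)" by (rule taylor_zero_imp[OF hardyD(1)[OF d]])
  then show ?thesis by (simp add: fun_eq_iff)
qed

lemma hardy_norm_2_eq_pairing:
  assumes "f \<in> hardy 2" shows "(hardy_norm 2 f)\<^sup>2 = Re (pairing f f)"
  using pairing_self[OF assms] by simp

text \<open>
  The square root is the binomial series of \<open>(I - A)\<^sup>1\<^sup>/\<^sup>2\<close>, summed weakly: only the numbers
  \<open>\<langle>g, A\<^sup>k f\<rangle>\<close> enter, and the Riesz representation turns their sum into an element of \<open>H\<^sup>2\<close>.
\<close>

lemma positive_sqrt_exists:
  assumes A: "\<And>f. f \<in> hardy 2 \<Longrightarrow> A f \<in> hardy 2"
    and bd: "\<And>f. f \<in> hardy 2 \<Longrightarrow> hardy_norm 2 (A f) \<le> hardy_norm 2 f"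
    and sym: "\<And>f g. f \<in> hardy 2 \<Longrightarrow> g \<in> hardy 2 \<Longrightarrow> pairing (A f) g = pairing f (A g)"
  shows "\<exists>S. is_positive_sqrt (\<lambda>f z. f z - A f z) S"
proof -
  let ?e = sqrt_coeff
  define E where "E = (\<Sum>k. \<bar>?e k\<bar>)"
  have Ak: "(A ^^ k) f \<in> hardy 2" if "f \<in> hardy 2" for k f
    using that by (induction k) (auto intro: A)
  have bdk: "hardy_norm 2 ((A ^^ k) f) \<le> hardy_norm 2 f" if "f \<in> hardy 2" for k f
  proof (induction k)
    case (Suc k)
    then show ?case using order_trans[OF bd[OF Ak[OF that]] Suc] by simp
  qed simp
  have symk: "pairing ((A ^^ k) f) g = pairing f ((A ^^ k) g)" if "f \<in> hardy 2"
      "g \<in> hardy 2" for k f g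
    using that(1)
  proof (induction k arbitrary: f)
    case (Suc k)
    have "pairing ((A ^^ Suc k) f) g = pairing ((A ^^ k) (A f)) g" by (simp add: funpow_swap1)
    also have "\<dots> = pairing f (A ((A ^^ k) g))"
      using Suc.IH[OF A[OF Suc.prems]] sym[OF Suc.prems Ak[OF that(2)]] by simp
    finally show ?case by simp
  qed simp
  have pb: "norm (pairing g ((A ^^ k) f)) \<le> hardy_norm 2 g * hardy_norm 2 f" if "f \<in> hardy 2"
      "g \<in> hardy 2" for k f g
    by (rule order_trans[OF pairing_Cauchy_Schwarz[OF that(2) Ak[OF that(1)]]])
       (intro mult_left_mono bdk that hardy_norm_nonneg)
  have tb: "norm (of_real (?e k) * pairing g ((A ^^ k) f)) \<le> \<bar>?e k\<bar> * (hardy_norm 2 g * hardy_norm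
      2 f)" if "f \<in> hardy 2" "g \<in> hardy 2" for k f g
    unfolding norm_mult norm_of_real by (intro mult_left_mono pb that) simp
  have sm: "summable (\<lambda>k. of_real (?e k) * pairing g ((A ^^ k) f))" if "f \<in> hardy 2"
      "g \<in> hardy 2" for f g
    by (rule summable_comparison_test'[OF summable_mult2[OF summable_sqrt_coeff]]) (rule tb[OF
        that])
  have "\<exists>F\<in>hardy 2. \<forall>g\<in>hardy 2. (\<lambda>k. of_real (?e k) * pairing g ((A ^^ k) f)) sums
      pairing g F" if f: "f \<in> hardy 2" for f
  proof -
    \<comment> \<open>The series is read as a functional of the left argument, in which the pairing
      is linear, so its Riesz representative can be taken as the value of the root at
      \<open>f\<close>.\<close>
    define L where "L g = (\<Sum>k. of_real (?e k) * pairing g ((A ^^ k) f))" for g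
    have L: "(\<lambda>k. of_real (?e k) * pairing g ((A ^^ k) f)) sums L g" if "g \<in> hardy 2" for g
      unfolding L_def using sm[OF f that] by (rule summable_sums)
    obtain F where F: "F \<in> hardy 2" "\<And>g. g \<in> hardy 2 \<Longrightarrow> L g = pairing g F"
    proof (rule hardy_2_Riesz[of L])
      fix g h c d assume gh: "g \<in> hardy 2" "h \<in> hardy 2"
      have "(\<lambda>k. c * (of_real (?e k) * pairing g ((A ^^ k) f)) + d * (of_real (?e k) * pairing h
          ((A ^^ k) f))) sums (c * L g + d * L h)"
        by (intro sums_add sums_mult L gh)
      moreover have "c * (of_real (?e k) * pairing g ((A ^^ k) f)) + d * (of_real (?e k) * pairing
          h ((A ^^ k) f)) =
          of_real (?e k) * pairing (\<lambda>z. c * g z + d * h z) ((A ^^ k) f)" for k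
        using pairing_lincomb_left[OF gh Ak[OF f]] by (simp add: algebra_simps)
      ultimately have "(\<lambda>k. of_real (?e k) * pairing (\<lambda>z. c * g z + d * h z) ((A ^^ k) f)) sums
          (c * L g + d * L h)"
        by simp
      then show "L (\<lambda>z. c * g z + d * h z) = c * L g + d * L h"
        unfolding L_def[of "\<lambda>z. c * g z + d * h z"] by (rule sums_unique[symmetric])
    next
      fix g assume g: "g \<in> hardy 2"
      have "norm (L g) \<le> (\<Sum>k. \<bar>?e k\<bar> * (hardy_norm 2 g * hardy_norm 2 f))"
        unfolding L_def by (rule norm_suminf_le[OF tb[OF f g] summable_mult2[OF
            summable_sqrt_coeff]])
      then show "norm (L g) \<le> (E * hardy_norm 2 f) * hardy_norm 2 g"
        using suminf_mult2[OF summable_sqrt_coeff, of "hardy_norm 2 g * hardy_norm 2 f"]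
          by (simp add: E_def mult_ac)
    qed blast
    then show ?thesis using L by auto
  qed
  then obtain S where S: "\<And>f. f \<in> hardy 2 \<Longrightarrow> S f \<in> hardy 2"
    and Ss: "\<And>f g. f \<in> hardy 2 \<Longrightarrow> g \<in> hardy 2 \<Longrightarrow> (\<lambda>k. of_real (?e k) * pairing g ((A ^^ k) f)) sums
        pairing g (S f)"
    by metis
  have pS: "norm (pairing g (S f)) \<le> (E * hardy_norm 2 f) * hardy_norm 2 g" if "f \<in> hardy 2"
      "g \<in> hardy 2" for f g
  proof -
    have "norm (pairing g (S f)) \<le> (\<Sum>k. \<bar>?e k\<bar> * (hardy_norm 2 g * hardy_norm 2 f))"
      unfolding sums_unique[OF Ss[OF that]]
        by (rule norm_suminf_le[OF tb[OF that] summable_mult2[OF summable_sqrt_coeff]])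
    then show ?thesis
      using suminf_mult2[OF summable_sqrt_coeff, of "hardy_norm 2 g * hardy_norm 2 f"]
        by (simp add: E_def mult_ac)
  qed
  have S2: "S (S f) = (\<lambda>z. f z - A f z)" if f: "f \<in> hardy 2" for f
  proof (rule hardy_2_eqI)
    show "S (S f) \<in> hardy 2" by (intro S f)
    show fA: "(\<lambda>z. f z - A f z) \<in> hardy 2" by (intro hardy_diff f A) simp
    fix h assume h: "h \<in> hardy 2"
    \<comment> \<open>Symmetry moves the powers of \<open>A\<close> to \<open>h\<close>, so that
      both applications of the series become numerical. Only n = 0 and n = 1 survive, with
      coefficients 1 and -1.\<close>
    have "pairing h (S (S f)) = (\<Sum>n<2. of_real (\<Sum>i\<le>n. ?e i * ?e (n - i)) * pairing h ((A ^^ n) f))"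
    proof (rule iterated_Cauchy_product[OF summable_sqrt_coeff pb[OF f h]])
      fix k
      have "pairing ((A ^^ k) h) ((A ^^ j) f) = pairing h ((A ^^ (k + j)) f)" for j
        using symk[OF h Ak[OF f]] by (simp add: funpow_add)
      then show "(\<lambda>j. of_real (?e j) * pairing h ((A ^^ (k + j)) f)) sums
          pairing ((A ^^ k) h) (S f)"
        using Ss[OF f Ak[OF h, of k]] by simp
    next
      show "(\<lambda>k. of_real (?e k) * pairing ((A ^^ k) h) (S f)) sums pairing h (S (S f))"
        using Ss[OF S[OF f] h] symk[OF h S[OF f]] by simp
    qed (simp add: sqrt_coeff_conv)
    also have "\<dots> = pairing h f - pairing h (A f)"
      by (simp add: sqrt_coeff_conv numeral_2_eq_2)
    also have "\<dots> = pairing h (\<lambda>z. 1 * f z + (- 1) * A f z)"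
      using pairing_lincomb_right[OF f A[OF f] h, of 1 "- 1"] by simp
    finally show "pairing h (S (S f)) = pairing h (\<lambda>z. f z - A f z)" by simp
  qed
  have lin: "S (\<lambda>z. c * f z + d * g z) = (\<lambda>z. c * S f z + d * S g z)" if f: "f \<in> hardy 2" and g:
      "g \<in> hardy 2" for f g c d
  proof (rule hardy_2_eqI)
    have fg: "(\<lambda>z. c * f z + d * g z) \<in> hardy 2" by (intro hardy_lincomb f g) simp
    show "S (\<lambda>z. c * f z + d * g z) \<in> hardy 2" by (rule S[OF fg])
    show "(\<lambda>z. c * S f z + d * S g z) \<in> hardy 2" by (intro hardy_lincomb S f g) simp
    fix h assume h: "h \<in> hardy 2"
    \<comment> \<open>Linearity of the powers of \<open>A\<close> comes out weakly from symmetry, by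
      shifting them to \<open>h\<close>.\<close>
    have "pairing h ((A ^^ k) (\<lambda>z. c * f z + d * g z)) = cnj c * pairing h ((A ^^ k) f) +
        cnj d * pairing h ((A ^^ k) g)" for k
      using symk[OF h fg, of k] symk[OF h f, of k] symk[OF h g, of k] pairing_lincomb_right[OF f g
          Ak[OF h, of k], of c d] by simp
    then have "(\<lambda>k. cnj c * (of_real (?e k) * pairing h ((A ^^ k) f)) + cnj d * (of_real (?e k) *
        pairing h ((A ^^ k) g))) sums pairing h (S (\<lambda>z. c * f z + d * g z))"
      using Ss[OF fg h] by (simp add: algebra_simps)
    moreover have "(\<lambda>k. cnj c * (of_real (?e k) * pairing h ((A ^^ k) f)) + cnj d * (of_real (?e
        k) * pairing h ((A ^^ k) g))) sums (cnj c * pairing h (S f) + cnj d * pairing h (S g))"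
      by (intro sums_add sums_mult Ss f g h)
    ultimately have "pairing h (S (\<lambda>z. c * f z + d * g z)) = cnj c * pairing h (S f) +
        cnj d * pairing h (S g)"
      by (rule sums_unique2)
    also have "\<dots> = pairing h (\<lambda>z. c * S f z + d * S g z)"
      by (rule pairing_lincomb_right[OF S[OF f] S[OF g] h, symmetric])
    finally show "pairing h (S (\<lambda>z. c * f z + d * g z)) = pairing h (\<lambda>z. c * S f z + d * S g z)" .
  qed
  have bound: "hardy_norm 2 (S f) \<le> E * hardy_norm 2 f" if f: "f \<in> hardy 2" for f
  proof (cases "hardy_norm 2 (S f) = 0")
    case False
    then have pos: "0 < hardy_norm 2 (S f)" using hardy_norm_nonneg[of 2 "S f"] by simp
    have "hardy_norm 2 (S f) * hardy_norm 2 (S f) = norm (pairing (S f) (S f))"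
      using pairing_self[OF S[OF f]] by (simp add: norm_mult power2_eq_square)
    also have "\<dots> \<le> (E * hardy_norm 2 f) * hardy_norm 2 (S f)" by (rule pS[OF f S[OF f]])
    finally show ?thesis using pos by (rule mult_right_le_imp_le)
  next
    case True
    have "0 \<le> E" unfolding E_def by (intro suminf_nonneg summable_sqrt_coeff) simp
    then show ?thesis using True by (simp add: hardy_norm_nonneg)
  qed
  \<comment> \<open>The leading term is |f|^2, where |f| is the norm; each later term is at least
    -|e_k| |f|^2, and the later |e_k| add up to at most 1.\<close>
  have nonneg: "pairing (S f) f \<in> \<real>\<^sub>\<ge>\<^sub>0" if f: "f \<in> hardy 2" for f
  proof -
    define r where "r k = Re (pairing f ((A ^^ k) f))" for k
    have "Im (pairing f ((A ^^ k) f)) = 0" for k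
      using symk[OF f f, of k] pairing_commute[of "(A ^^ k) f" f] by (simp add: complex_eq_iff)
    then have real: "pairing f ((A ^^ k) f) = of_real (r k)" for k
      by (simp add: r_def complex_eq_iff)
    have rb: "\<bar>r k\<bar> \<le> (hardy_norm 2 f)\<^sup>2" for k
      using pb[OF f f, of k] by (simp add: real power2_eq_square)
    have "(\<lambda>k. of_real (?e k * r k)) sums pairing f (S f)" using Ss[OF f f] by (simp add: real)
    then have Re_sums: "(\<lambda>k. ?e k * r k) sums Re (pairing f (S f))" and Im0:
        "Im (pairing f (S f)) = 0"
      using sums_Re[of "\<lambda>k. of_real (?e k * r k)"] sums_Im[of "\<lambda>k. of_real (?e k * r k)"]
          sums_unique2[OF sums_zero]
      by force+
    have s1: "(\<lambda>k. ?e (Suc k) * r (Suc k)) sums (Re (pairing f (S f)) - r 0)"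
      using Re_sums by (subst sums_Suc_iff) (simp add: sqrt_coeff_0)
    have s2: "(\<lambda>k. - \<bar>?e (Suc k)\<bar> * (hardy_norm 2 f)\<^sup>2) sums (- (\<Sum>k. \<bar>?e (Suc k)\<bar>) * (hardy_norm 2
        f)\<^sup>2)"
      by (intro sums_mult2 sums_minus summable_sums summable_sqrt_coeff_Suc)
    have "- \<bar>?e (Suc k)\<bar> * (hardy_norm 2 f)\<^sup>2 \<le> ?e (Suc k) * r (Suc k)" for k
    proof -
      have "\<bar>?e (Suc k) * r (Suc k)\<bar> \<le> \<bar>?e (Suc k)\<bar> * (hardy_norm 2 f)\<^sup>2"
        unfolding abs_mult by (intro mult_left_mono rb) simp
      then show ?thesis by linarith
    qed
    then have "- (\<Sum>k. \<bar>?e (Suc k)\<bar>) * (hardy_norm 2 f)\<^sup>2 \<le> Re (pairing f (S f)) - r 0"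
      by (rule sums_le[OF _ s2 s1])
    moreover have "(\<Sum>k. \<bar>?e (Suc k)\<bar>) * (hardy_norm 2 f)\<^sup>2 \<le> 1 * (hardy_norm 2 f)\<^sup>2"
      by (intro mult_right_mono suminf_le_const summable_sqrt_coeff_Suc sqrt_coeff_partial_sums)
          simp
    moreover have "r 0 = (hardy_norm 2 f)\<^sup>2" by (simp add: r_def pairing_self[OF f])
    ultimately have "0 \<le> Re (pairing f (S f))" by simp
    then show ?thesis using Im0 pairing_commute[of "S f" f] by (simp add: complex_nonneg_Reals_iff)
  qed
  show ?thesis
    unfolding is_positive_sqrt_def using S S2 lin bound nonneg by (intro exI[of _ S]) blast
qed

section \<open>De Branges-Rovnyak spaces\<close>

definition defect :: "(complex \<Rightarrow> complex) \<Rightarrow> (complex \<Rightarrow> complex) \<Rightarrow> complex \<Rightarrow> complex" where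
  "defect b f z = f z - toeplitz b (hilbert_adjoint (toeplitz b) f) z"

lemma de_branges_rovnyak_eq: "de_branges_rovnyak b = positive_sqrt (defect b) ` hardy 2"
  by (simp add: de_branges_rovnyak_def defect_def[abs_def])

context
  fixes b :: "complex \<Rightarrow> complex"
  assumes b: "b \<in> disk_holo" "\<forall>z. norm z < 1 \<longrightarrow> norm (b z) \<le> 1"
begin

lemma toeplitz_contraction:
  assumes "f \<in> hardy 2"
  shows "toeplitz b f \<in> hardy 2" "hardy_norm 2 (toeplitz b f) \<le> hardy_norm 2 f"
  using hardy_bounded_mult[OF b(1) b(2)[rule_format] assms] by (simp_all add: toeplitz_def)

text \<open>As \<open>hilbert_adjoint\<close> is a definite description, existence and uniqueness
  are both shown: the first by Riesz representation, the second by testing with elements of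
  H^2.\<close>

lemma hilbert_adjoint_toeplitz:
  assumes g: "g \<in> hardy 2"
  shows "hilbert_adjoint (toeplitz b) g \<in> hardy 2"
    and "\<And>f. f \<in> hardy 2 \<Longrightarrow> pairing (toeplitz b f) g = pairing f (hilbert_adjoint (toeplitz b) g)"
proof -
  obtain h where h: "h \<in> hardy 2" "\<And>f. f \<in> hardy 2 \<Longrightarrow> pairing (toeplitz b f) g = pairing f h"
  proof (rule hardy_2_Riesz[of "\<lambda>f. pairing (toeplitz b f) g"])
    fix f1 f2 c d assume f: "f1 \<in> hardy 2" "f2 \<in> hardy 2"
    have "toeplitz b (\<lambda>z. c * f1 z + d * f2 z) = (\<lambda>z. c * toeplitz b f1 z + d * toeplitz b f2 z)"
      by (auto simp: toeplitz_def algebra_simps)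
    then show "pairing (toeplitz b (\<lambda>z. c * f1 z + d * f2 z)) g = c * pairing (toeplitz b f1) g +
        d * pairing (toeplitz b f2) g"
      using pairing_lincomb_left[OF toeplitz_contraction(1)[OF f(1)] toeplitz_contraction(1)[OF
          f(2)] g] by simp
  next
    fix f assume f: "f \<in> hardy 2"
    have "norm (pairing (toeplitz b f) g) \<le> hardy_norm 2 (toeplitz b f) * hardy_norm 2 g"
      by (rule pairing_Cauchy_Schwarz[OF toeplitz_contraction(1)[OF f] g])
    also have "\<dots> \<le> hardy_norm 2 f * hardy_norm 2 g"
      by (intro mult_right_mono toeplitz_contraction f hardy_norm_nonneg)
    finally show "norm (pairing (toeplitz b f) g) \<le> hardy_norm 2 g * hardy_norm 2 f"
      by (simp add: mult.commute)
  qed blast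
  have "\<exists>!h. h \<in> hardy 2 \<and> (\<forall>f\<in>hardy 2. pairing (toeplitz b f) g = pairing f h)"
  proof (rule ex1I[of _ h])
    show "h \<in> hardy 2 \<and> (\<forall>f\<in>hardy 2. pairing (toeplitz b f) g = pairing f h)" using h by simp
    fix h' assume h': "h' \<in> hardy 2 \<and> (\<forall>f\<in>hardy 2. pairing (toeplitz b f) g = pairing f h')"
    show "h' = h" by (rule hardy_2_eqI) (use h h' in auto)
  qed
  then have "hilbert_adjoint (toeplitz b) g \<in> hardy 2 \<and> (\<forall>f\<in>hardy 2. pairing (toeplitz b f) g =
      pairing f (hilbert_adjoint (toeplitz b) g))"
    unfolding hilbert_adjoint_def by (rule theI')
  then show "hilbert_adjoint (toeplitz b) g \<in> hardy 2"
    and "\<And>f. f \<in> hardy 2 \<Longrightarrow> pairing (toeplitz b f) g = pairing f (hilbert_adjoint (toeplitz b) g)"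
    by blast+
qed

lemma hilbert_adjoint_contraction:
  assumes g: "g \<in> hardy 2"
  shows "hardy_norm 2 (hilbert_adjoint (toeplitz b) g) \<le> hardy_norm 2 g"
proof -
  let ?h = "hilbert_adjoint (toeplitz b) g"
  note h = hilbert_adjoint_toeplitz[OF g]
  have "hardy_norm 2 ?h * hardy_norm 2 ?h = norm (pairing (toeplitz b ?h) g)"
    using h(2)[OF h(1)] pairing_self[OF h(1)] by (simp add: norm_mult power2_eq_square)
  also have "\<dots> \<le> hardy_norm 2 (toeplitz b ?h) * hardy_norm 2 g"
    by (rule pairing_Cauchy_Schwarz[OF toeplitz_contraction(1)[OF h(1)] g])
  also have "\<dots> \<le> hardy_norm 2 ?h * hardy_norm 2 g"
    by (intro mult_right_mono toeplitz_contraction h hardy_norm_nonneg)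
  finally have le: "hardy_norm 2 ?h * hardy_norm 2 ?h \<le> hardy_norm 2 g * hardy_norm 2 ?h"
    by (simp add: mult.commute)
  show ?thesis
  proof (cases "hardy_norm 2 ?h = 0")
    case False
    then have "0 < hardy_norm 2 ?h" using hardy_norm_nonneg[of 2 ?h] by simp
    with le show ?thesis by (rule mult_right_le_imp_le)
  qed (simp add: hardy_norm_nonneg)
qed

text \<open>T_b composed with its adjoint is a symmetric contraction, so
  \<open>positive_sqrt_exists\<close> makes the choice operator meaningful. What follows uses only
  the properties in \<open>is_positive_sqrt\<close>, whichever root is chosen.\<close>

lemma positive_sqrt_defect: "is_positive_sqrt (defect b) (positive_sqrt (defect b))"
proof -
  have "\<exists>S. is_positive_sqrt (\<lambda>f z. f z - toeplitz b (hilbert_adjoint (toeplitz b) f) z) S"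
  proof (rule positive_sqrt_exists)
    fix f g assume f: "f \<in> hardy 2"
    show A: "toeplitz b (hilbert_adjoint (toeplitz b) f) \<in> hardy 2"
      by (intro toeplitz_contraction hilbert_adjoint_toeplitz f)
    show "hardy_norm 2 (toeplitz b (hilbert_adjoint (toeplitz b) f)) \<le> hardy_norm 2 f"
      using toeplitz_contraction(2)[OF hilbert_adjoint_toeplitz(1)[OF f]]
          hilbert_adjoint_contraction[OF f] by linarith
    assume g: "g \<in> hardy 2"
    note F = hilbert_adjoint_toeplitz[OF f] and G = hilbert_adjoint_toeplitz[OF g]
    have "pairing (toeplitz b (hilbert_adjoint (toeplitz b) f)) g =
        pairing (hilbert_adjoint (toeplitz b) f) (hilbert_adjoint (toeplitz b) g)"
      by (rule G(2)[OF F(1)])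
    also have "\<dots> = cnj (pairing (toeplitz b (hilbert_adjoint (toeplitz b) g)) f)"
      unfolding F(2)[OF G(1)] by (rule pairing_commute)
    also have "\<dots> = pairing f (toeplitz b (hilbert_adjoint (toeplitz b) g))"
      by (rule pairing_commute[symmetric])
    finally show "pairing (toeplitz b (hilbert_adjoint (toeplitz b) f)) g =
        pairing f (toeplitz b (hilbert_adjoint (toeplitz b) g))" .
  qed
  then show ?thesis
    unfolding positive_sqrt_def defect_def[abs_def] by (rule someI_ex)
qed

end

section \<open>Symmetry of the root and the norm estimate for H(b)\<close>

lemma is_positive_sqrt_lincomb:
  assumes "is_positive_sqrt T S" "f \<in> hardy 2" "g \<in> hardy 2"
  shows "S (\<lambda>z. c * f z + d * g z) = (\<lambda>z. c * S f z + d * S g z)"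
  using assms by (simp add: is_positive_sqrt_def)

text \<open>A positive operator on a complex Hilbert space is symmetric, by polarization.\<close>

lemma is_positive_sqrt_symmetric:
  assumes S: "is_positive_sqrt T S" and f: "f \<in> hardy 2" and g: "g \<in> hardy 2"
  shows "pairing (S f) g = pairing f (S g)"
proof -
  have Sh: "S f \<in> hardy 2" "S g \<in> hardy 2" using S f g by (auto simp: is_positive_sqrt_def)
  have lin: "S (\<lambda>z. c * f z + d * g z) = (\<lambda>z. c * S f z + d * S g z)" for c d
    by (rule is_positive_sqrt_lincomb[OF S f g])
  have real: "Im (pairing (S h) h) = 0" if "h \<in> hardy 2" for h
    using S that unfolding is_positive_sqrt_def by (auto simp: complex_nonneg_Reals_iff)
  have exp: "Im (c * cnj d * pairing (S f) g + d * cnj c * pairing (S g) f) = 0" for c d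
  proof -
    have h: "(\<lambda>z. c * f z + d * g z) \<in> hardy 2" by (intro hardy_lincomb f g) simp
    have "pairing (S (\<lambda>z. c * f z + d * g z)) (\<lambda>z. c * f z + d * g z) =
      c * pairing (S f) (\<lambda>z. c * f z + d * g z) + d * pairing (S g) (\<lambda>z. c * f z + d * g z)"
      unfolding lin by (rule pairing_lincomb_left[OF Sh h]) simp_all
    also have "\<dots> = c * (cnj c * pairing (S f) f + cnj d * pairing (S f) g) + d * (cnj c * pairing
        (S g) f + cnj d * pairing (S g) g)"
      by (simp only: pairing_lincomb_right[OF f g Sh(1)] pairing_lincomb_right[OF f g Sh(2)])
    also have "\<dots> = (c * cnj c) * pairing (S f) f + (d * cnj d) * pairing (S g) g + (c * cnj d *
        pairing (S f) g + d * cnj c * pairing (S g) f)"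
      by (simp add: algebra_simps)
    finally have "Im ((c * cnj c) * pairing (S f) f + (d * cnj d) * pairing (S g) g + (c * cnj d *
        pairing (S f) g + d * cnj c * pairing (S g) f)) = 0"
      using real[OF h] by simp
    moreover have "Im ((c * cnj c) * pairing (S f) f) = 0" "Im ((d * cnj d) * pairing (S g) g) = 0"
      using real[OF f] real[OF g] by (simp_all add: complex_norm_square[symmetric])
    ultimately show ?thesis by (simp only: plus_complex.sel add_0)
  qed
  \<comment> \<open>The choice c = d = 1 settles the imaginary parts, c = 1 and d = \<i> the real
    parts.\<close>
  have "pairing (S g) f = cnj (pairing (S f) g)"
    using exp[of 1 1] exp[of 1 \<i>] by (simp add: complex_eq_iff)
  then show ?thesis using pairing_commute[of f "S g"] by simp
qed

lemma pythagorean_pairD: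
  assumes "pythagorean_pair \<psi> b a"
  shows "b \<in> disk_holo" "\<forall>z. norm z < 1 \<longrightarrow> norm (b z) \<le> 1" "a \<in> disk_holo"
      "\<forall>z. norm z < 1 \<longrightarrow> norm (a z) \<le> 1"
    "\<And>z. norm z < 1 \<Longrightarrow> \<psi> z = b z / a z" "outer a"
    "AE \<zeta> in circle_measure. (norm (bdry a \<zeta>))\<^sup>2 + (norm (bdry b \<zeta>))\<^sup>2 = 1"
  using assms by (auto simp: pythagorean_pair_def hardy_inf_def)

lemma hardy_norm_2_eq_bdry:
  assumes "f \<in> hardy 2"
  shows "(hardy_norm 2 f)\<^sup>2 = (LINT \<zeta>|cm. (norm (bdry f \<zeta>))\<^sup>2)"
proof -
  have "of_real ((hardy_norm 2 f)\<^sup>2) = (LINT \<zeta>|cm. complex_of_real ((norm (bdry f \<zeta>))\<^sup>2))"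
    using pairing_self[OF assms] by (simp add: pairing_def complex_norm_square[symmetric] del:
        of_real_power)
  then show ?thesis by (simp only: integral_complex_of_real of_real_eq_iff)
qed

text \<open>The circle identity is multiplied by |f|^2 and integrated; this works because H^2 norms
  can be read from boundary values.\<close>

lemma pythagorean_norm:
  assumes pp: "pythagorean_pair \<psi> b a" and f: "f \<in> hardy 2"
  shows "(hardy_norm 2 f)\<^sup>2 = (hardy_norm 2 (toeplitz a f))\<^sup>2 + (hardy_norm 2 (toeplitz b f))\<^sup>2"
proof -
  note P = pythagorean_pairD[OF pp]
  have ab: "a \<in> hardy 2" "b \<in> hardy 2"
    by (rule hardy_bounded[OF P(3) P(4)[rule_format]] hardy_bounded[OF P(1) P(2)[rule_format]];
        simp)+
  have af: "toeplitz a f \<in> hardy 2" and bf: "toeplitz b f \<in> hardy 2"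
    using toeplitz_contraction(1)[OF P(3,4) f] toeplitz_contraction(1)[OF P(1,2) f] by auto
  note [measurable] = hardy_bdry_borel[OF f] hardy_bdry_borel[OF af] hardy_bdry_borel[OF bf]
  have ma: "AE \<zeta> in cm. bdry (toeplitz a f) \<zeta> = bdry a \<zeta> * bdry f \<zeta>"
    and mb: "AE \<zeta> in cm. bdry (toeplitz b f) \<zeta> = bdry b \<zeta> * bdry f \<zeta>"
    unfolding toeplitz_def by (rule bdry_mult[OF ab(1) f] bdry_mult[OF ab(2) f]; simp)+
  have int: "integrable cm (\<lambda>\<zeta>. (norm (bdry h \<zeta>))\<^sup>2)" if "h \<in> hardy 2" for h
    using hardy_bdry_norm(1)[OF that] by (simp add: powr_numeral)
  have "(hardy_norm 2 f)\<^sup>2 = (LINT \<zeta>|cm. (norm (bdry (toeplitz a f) \<zeta>))\<^sup>2 + (norm (bdry (toeplitz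
      b f) \<zeta>))\<^sup>2)"
    unfolding hardy_norm_2_eq_bdry[OF f]
  proof (rule integral_cong_AE)
    show "AE \<zeta> in cm. (norm (bdry f \<zeta>))\<^sup>2 = (norm (bdry (toeplitz a f) \<zeta>))\<^sup>2 + (norm (bdry
        (toeplitz b f) \<zeta>))\<^sup>2"
      using P(7) ma mb
    proof eventually_elim
      case (elim \<zeta>)
      from elim(2,3) have "(norm (bdry (toeplitz a f) \<zeta>))\<^sup>2 + (norm (bdry (toeplitz b f) \<zeta>))\<^sup>2 =
          ((norm (bdry a \<zeta>))\<^sup>2 + (norm (bdry b \<zeta>))\<^sup>2) * (norm (bdry f \<zeta>))\<^sup>2"
        by (simp add: norm_mult power_mult_distrib algebra_simps)
      then show ?case by (simp only: elim(1) mult_1)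
    qed
  qed measurable
  also have "\<dots> = (hardy_norm 2 (toeplitz a f))\<^sup>2 + (hardy_norm 2 (toeplitz b f))\<^sup>2"
    using int[OF af] int[OF bf] by (simp add: hardy_norm_2_eq_bdry[OF af] hardy_norm_2_eq_bdry[OF
        bf])
  finally show ?thesis .
qed

text \<open>
  The functions \<open>u\<^sub>n F\<close>, with \<open>u\<^sub>n\<close> from the outer approximation of \<open>a\<close>, are bounded in \<open>H\<^sup>2\<close> by the
  identity \<open>\<bar>a\<bar>\<^sup>2 + \<bar>b\<bar>\<^sup>2 = 1\<close> on the circle, and they converge pointwise to a multiple of \<open>F / a\<close>.
\<close>

lemma pythagorean_toeplitz_dom:
  assumes pp: "pythagorean_pair \<psi> b a" and F: "F \<in> toeplitz_dom 2 \<psi>"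
  obtains G where "G \<in> hardy 2" "F = toeplitz a G" "toeplitz \<psi> F = toeplitz b G"
proof -
  note P = pythagorean_pairD[OF pp]
  have F2: "F \<in> hardy 2" and pF: "toeplitz \<psi> F \<in> hardy 2" using F by (auto simp: toeplitz_dom_def)
  note F0 = hardyD(3)[OF F2]
  have a0: "a z \<noteq> 0" if "norm z < 1" for z by (rule outer_nonzero[OF P(6) that])
  define G where "G z = F z / a z" for z
  have "G holomorphic_on ball 0 1"
    unfolding G_def using F2 P(3) a0
      by (intro holomorphic_intros) (auto simp: hardy_def disk_holo_def)
  then have G: "G \<in> disk_holo" using F0 by (auto simp: disk_holo_def G_def)
  have aG: "F = toeplitz a G"
  proof
    fix z show "F z = toeplitz a G z"
      using a0[of z] F0[of z] by (cases "norm z < 1") (auto simp: toeplitz_def G_def)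
  qed
  have bG: "toeplitz \<psi> F = toeplitz b G"
  proof
    fix z show "toeplitz \<psi> F z = toeplitz b G z"
      using P(5)[of z] F0[of z] by (cases "norm z < 1") (auto simp: toeplitz_def G_def)
  qed
  obtain c u where u: "norm c = 1" "\<And>n::nat. u n \<in> disk_holo"
    "\<And>n z. norm z < 1 \<Longrightarrow> norm (u n z) \<le> exp (real n)"
    "\<And>n z. norm z < 1 \<Longrightarrow> norm (u n z * a z) \<le> 1"
    "\<And>z. norm z < 1 \<Longrightarrow> (\<lambda>n. u n z * a z) \<longlonglongrightarrow> c"
    using outer_approximation[OF P(6)] by blast
  define M where "M = (hardy_norm 2 F)\<^sup>2 + (hardy_norm 2 (toeplitz \<psi> F))\<^sup>2"
  define H where "H n z = u n z * F z" for n z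
  have H2: "H n \<in> hardy 2" for n
    using hardy_bounded_mult(1)[OF u(2,3) F2] by (simp add: H_def[abs_def])
  have HG: "H n z = (u n z * a z) * G z" for n z
    by (simp add: H_def aG toeplitz_def)
  \<comment> \<open>Multiplying H_n by a or b gives u_n a times F or \<psi> F, and |u_n a| <= 1. So
    both parts of the Pythagorean norm of H_n are bounded independently of n.\<close>
  have HM: "(hardy_norm 2 (H n))\<^sup>2 \<le> M" for n
  proof -
    have ua: "(\<lambda>z. u n z * a z) \<in> disk_holo" by (rule disk_holo_mult[OF u(2) P(3)])
    have "toeplitz a (H n) = (\<lambda>z. (u n z * a z) * F z)" by (simp add: toeplitz_def H_def mult_ac)
    then have 1: "hardy_norm 2 (toeplitz a (H n)) \<le> hardy_norm 2 F"
      using hardy_bounded_mult(2)[OF ua u(4) F2] by simp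
    have "toeplitz b (H n) = (\<lambda>z. (u n z * a z) * toeplitz \<psi> F z)"
      unfolding bG by (simp add: toeplitz_def HG mult_ac)
    then have 2: "hardy_norm 2 (toeplitz b (H n)) \<le> hardy_norm 2 (toeplitz \<psi> F)"
      using hardy_bounded_mult(2)[OF ua u(4) pF] by simp
    show ?thesis
      unfolding pythagorean_norm[OF pp H2] M_def using 1 2
      by (intro add_mono power_mono hardy_norm_nonneg)
  qed
  have "G \<in> hardy 2"
  proof (rule hardyI[OF G])
    fix r :: real assume r: "0 \<le> r" "r < 1"
    note [measurable] = borel_measurable_dilate[OF disk_holo_disk_map[OF G]]
        borel_measurable_dilate[OF hardyD(2)[OF H2]]
    \<comment> \<open>On a fixed circle |H_n| = |u_n a| |G| <= |G|, with |H_n| -> |c G| = |G|; the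
      uniform bound \<open>M\<close> thus passes to \<open>G\<close> by dominated
      convergence.\<close>
    have lim: "(\<lambda>n. LINT \<zeta>|cm. norm (H n (of_real r * \<zeta>)) powr 2) \<longlonglongrightarrow> (LINT \<zeta>|cm. norm (G (of_real r
        * \<zeta>)) powr 2)"
    proof (rule integral_dominated_convergence[where w = "\<lambda>\<zeta>. norm (G (of_real r * \<zeta>)) powr 2"])
      show "integrable cm (\<lambda>\<zeta>. norm (G (of_real r * \<zeta>)) powr 2)"
        using r by (intro integrable_powr_dilate disk_holo_disk_map G) auto
      show "AE \<zeta> in cm. (\<lambda>n. norm (H n (of_real r * \<zeta>)) powr 2) \<longlonglongrightarrow> norm (G (of_real r * \<zeta>)) powr 2"
        using AE_cm_norm
      proof eventually_elim
        case (elim \<zeta>)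
        then have z: "norm (of_real r * \<zeta>) < 1" using r by (simp add: norm_mult)
        have "(\<lambda>n. norm ((u n (of_real r * \<zeta>) * a (of_real r * \<zeta>)) * G (of_real r * \<zeta>)) powr 2) \<longlonglongrightarrow>
            norm (c * G (of_real r * \<zeta>)) powr 2"
          by (intro tendsto_powr' tendsto_norm tendsto_mult u(5)[OF z] tendsto_const) simp
        then show ?case using u(1) by (simp add: HG norm_mult)
      qed
      show "AE \<zeta> in cm. norm (norm (H n (of_real r * \<zeta>)) powr 2) \<le>
          norm (G (of_real r * \<zeta>)) powr 2" for n
        using AE_cm_norm
      proof eventually_elim
        case (elim \<zeta>)
        then have z: "norm (of_real r * \<zeta>) < 1" using r by (simp add: norm_mult)
        have "norm (H n (of_real r * \<zeta>)) \<le> 1 * norm (G (of_real r * \<zeta>))"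
          unfolding HG norm_mult[of "_ * _"] by (rule mult_right_mono[OF u(4)[OF z]]) simp
        then show ?case by (simp add: powr_mono2)
      qed
    qed measurable
    have le: "(LINT \<zeta>|cm. norm (H n (of_real r * \<zeta>)) powr 2) \<le> M" for n
      using integral_mean_le_hardy_norm[OF H2 _ r, of n] HM[of n]
        by (simp add: integral_mean_def powr_numeral hardy_norm_nonneg)
    show "integral_mean 2 G r \<le> M"
      unfolding integral_mean_def
      by (rule tendsto_upperbound[OF lim always_eventually[OF allI[OF le]] sequentially_bot])
  qed
  then show thesis using aG bG by (rule that)
qed

text \<open>Let v = b G and let B be the adjoint of T_b. Then |S v|^2 = |v|^2 - |B v|^2 in norms,
  and <G, B v> = <b G, v> = |v|^2 turns |G - B v|^2 >= 0 into |v|^2 - |B v|^2 <= |G|^2 - |v|^2 = |a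
  G|^2. By symmetry of S the functional is <S v, f>, and Cauchy-Schwarz finishes.\<close>

lemma de_branges_rovnyak_bounded_functional:
  assumes pp: "pythagorean_pair \<psi> b a" and f: "f \<in> hardy 2" and F: "F \<in> toeplitz_dom 2 \<psi>"
  shows "norm (pairing (toeplitz \<psi> F) (positive_sqrt (defect b) f)) \<le>
      hardy_norm 2 f * hardy_norm 2 F"
proof -
  note P = pythagorean_pairD[OF pp]
  obtain G where G: "G \<in> hardy 2" "F = toeplitz a G" "toeplitz \<psi> F = toeplitz b G"
    using pythagorean_toeplitz_dom[OF pp F] .
  let ?S = "positive_sqrt (defect b)" and ?B = "hilbert_adjoint (toeplitz b)"
  note S = positive_sqrt_defect[OF P(1,2)]
  have S2: "?S h \<in> hardy 2" "?S (?S h) = defect b h" if "h \<in> hardy 2" for h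
    using S that by (auto simp: is_positive_sqrt_def)
  define v where "v = toeplitz b G"
  have v: "v \<in> hardy 2" unfolding v_def by (rule toeplitz_contraction[OF P(1,2) G(1)])
  note B = hilbert_adjoint_toeplitz[OF P(1,2) v]
  have bB: "toeplitz b (?B v) \<in> hardy 2" by (rule toeplitz_contraction[OF P(1,2) B(1)])
  have dv: "defect b v = (\<lambda>z. v z - toeplitz b (?B v) z)"
    by (simp add: defect_def[abs_def])
  have "pairing (?S v) (?S v) = pairing (?S (?S v)) v"
    using is_positive_sqrt_symmetric[OF S S2(1)[OF v] v] by simp
  also have "\<dots> = pairing v v - pairing (toeplitz b (?B v)) v"
    unfolding S2(2)[OF v] dv by (rule pairing_diff_left[OF v bB v]) simp_all
  also have "pairing (toeplitz b (?B v)) v = pairing (?B v) (?B v)" by (rule B(2)[OF B(1)])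
  finally have "Re (pairing (?S v) (?S v)) = Re (pairing v v) - Re (pairing (?B v) (?B v))" by simp
  then have 1: "(hardy_norm 2 (?S v))\<^sup>2 = (hardy_norm 2 v)\<^sup>2 - (hardy_norm 2 (?B v))\<^sup>2"
    by (simp add: hardy_norm_2_eq_pairing[symmetric] v B S2)
  define D where "D = (\<lambda>z. G z - ?B v z)"
  have D2: "D \<in> hardy 2" unfolding D_def by (rule hardy_diff[OF G(1) B(1)]) simp
  have "pairing D D = pairing G D - pairing (?B v) D"
    unfolding D_def by (rule pairing_diff_left[OF G(1) B(1) D2[unfolded D_def]]) simp_all
  also have "pairing G D = pairing G G - pairing G (?B v)"
    using pairing_lincomb_right[OF G(1) B(1) G(1), of 1 "- 1"] by (simp add: D_def)
  also have "pairing (?B v) D = cnj (pairing G (?B v)) - pairing (?B v) (?B v)"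
    using pairing_lincomb_right[OF G(1) B(1) B(1), of 1 "- 1"] pairing_commute[of "?B v" G]
      by (simp add: D_def)
  also have "pairing G (?B v) = pairing v v" using B(2)[OF G(1)] by (simp add: v_def)
  finally have "Re (pairing D D) = Re (pairing G G) - 2 * Re (pairing v v) + Re (pairing (?B v)
      (?B v))" by simp
  then have "(hardy_norm 2 D)\<^sup>2 = (hardy_norm 2 G)\<^sup>2 - 2 * (hardy_norm 2 v)\<^sup>2 + (hardy_norm 2 (?B
      v))\<^sup>2"
    by (simp add: hardy_norm_2_eq_pairing[symmetric] v B D2 G)
  then have "0 \<le> (hardy_norm 2 G)\<^sup>2 - 2 * (hardy_norm 2 v)\<^sup>2 + (hardy_norm 2 (?B v))\<^sup>2"
    by (metis zero_le_power2)
  moreover have "(hardy_norm 2 G)\<^sup>2 = (hardy_norm 2 F)\<^sup>2 + (hardy_norm 2 v)\<^sup>2"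
    using pythagorean_norm[OF pp G(1)] by (simp add: G(2) v_def)
  ultimately have "(hardy_norm 2 (?S v))\<^sup>2 \<le> (hardy_norm 2 F)\<^sup>2" using 1 by linarith
  then have SF: "hardy_norm 2 (?S v) \<le> hardy_norm 2 F"
    by (rule power2_le_imp_le) (rule hardy_norm_nonneg)
  have "norm (pairing (toeplitz \<psi> F) (?S f)) = norm (pairing (?S v) f)"
    unfolding G(3) v_def[symmetric] by (simp add: is_positive_sqrt_symmetric[OF S v f])
  also have "\<dots> \<le> hardy_norm 2 (?S v) * hardy_norm 2 f"
    by (rule pairing_Cauchy_Schwarz[OF S2(1)[OF v] f])
  also have "\<dots> \<le> hardy_norm 2 F * hardy_norm 2 f" by (rule mult_right_mono[OF SF hardy_norm_nonneg])
  finally show ?thesis by (simp add: mult.commute)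
qed

lemma nyman_perp_de_branges_rovnyak:
  assumes \<phi>: "smirnov_unit \<phi>" and dense: "dense_in_hardy 2 (toeplitz \<phi> ` nyman_span)"
    and pp: "pythagorean_pair (\<lambda>z. 1 / \<phi> z) b a"
  shows "nyman_perp \<inter> de_branges_rovnyak b = {\<lambda>z. 0}"
proof (intro equalityI subsetI)
  note P = pythagorean_pairD[OF pp]
  note S = positive_sqrt_defect[OF P(1,2)]
  fix g assume "g \<in> nyman_perp \<inter> de_branges_rovnyak b"
  then obtain f where g: "g \<in> nyman_perp" and f: "f \<in> hardy 2" "g = positive_sqrt (defect b) f"
    by (auto simp: de_branges_rovnyak_eq)
  have "g = (\<lambda>z. 0)"
  proof (rule nyman_perp_bounded_functional_zero[OF \<phi> _ _ dense g])
    show "g \<in> hardy 2" using g by (simp add: nyman_perp_def)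
    show "norm (pairing (toeplitz (\<lambda>z. 1 / \<phi> z) F) g) \<le> hardy_norm 2 f * hardy_norm 2 F"
      if "F \<in> toeplitz_dom 2 (\<lambda>z. 1 / \<phi> z)" for F
      unfolding f(2) by (rule de_branges_rovnyak_bounded_functional[OF pp f(1) that])
  qed simp_all
  then show "g \<in> {\<lambda>z. 0}" by simp
next
  note P = pythagorean_pairD[OF pp]
  note S = positive_sqrt_defect[OF P(1,2)]
  fix g :: "complex \<Rightarrow> complex" assume g: "g \<in> {\<lambda>z. 0}"
  have z: "(\<lambda>z. 0) \<in> hardy 2" by (rule zero_hardy) simp
  \<comment> \<open>Both coefficients zero: linearity sends the zero function to itself, which
    places it in the range of the root.\<close>
  from is_positive_sqrt_lincomb[OF S z z, of 0 0] have "positive_sqrt (defect b) (\<lambda>z. 0) =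
      (\<lambda>z. 0)" by simp
  then have "(\<lambda>z. 0) \<in> de_branges_rovnyak b"
    unfolding de_branges_rovnyak_eq using z by force
  then show "g \<in> nyman_perp \<inter> de_branges_rovnyak b" using g zero_nyman_perp by simp
qed

theorem proposition11:
  fixes \<phi> :: "complex \<Rightarrow> complex" and p q :: real
  assumes "smirnov_unit \<phi>"
    and "p > 1" and "1 / p + 1 / q = 1"
    and "dense_in_hardy p (toeplitz \<phi> ` nyman_span)"
  shows "nyman_perp \<inter> toeplitz_adj_dom p q (\<lambda>z. 1 / \<phi> z) = {\<lambda>z. 0} \<and>
    (p = 2 \<longrightarrow> (\<forall>b a. pythagorean_pair (\<lambda>z. 1 / \<phi> z) b a \<longrightarrow>
       nyman_perp \<inter> de_branges_rovnyak b = {\<lambda>z. 0}))"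
  using nyman_perp_adjoint_domain[OF assms] nyman_perp_de_branges_rovnyak[OF assms(1)] assms(4) by blast

end
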